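(* Assume the Generalized Riemann Hypothesis and that $\sum_{0<\gamma\le X}|\zeta'(\rho)|^{-2}\ll X$. Fix $\delta\in[1,2)$. If $\delta\in[\tfrac32,2)$, fix $0<\varepsilon<(\delta-1)/2$ and put $\theta=\delta-1-2\varepsilon$; if $\delta\in[1,\tfrac32)$, fix $0<\varepsilon<1/4$ and put $\theta=\tfrac12-2\varepsilon$. Let $N\ge4$ be a natural number, let $\beta>0$ be such that $N\beta$ is a positive integer, and let $f:\mathbb R\to\mathbb C$ have support in $[0,\beta)$ and belong to the H\"older--Zygmund space $\mathcal C^\delta(\mathbb R)$. Then $$\sum_{1<q\le N^\theta}\frac1{\varphi(q)}\left|\sum_{\chi\ne\chi_0}\overline{\chi^*}(N)\sum_{n\le N\beta}\ \sum_{m\le N\beta-n}\Lambda(n)\chi^*(n)\mu(m)f\!\left(\frac{n+m}N\right)\right|\ll_{f,\beta,\varepsilon,\delta}N^{2-\varepsilon}.$$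
   Context: $\Lambda$ is the von Mangoldt function, $\mu$ the M\"obius function, $\varphi$ Euler's totient. Sums $\sum_{n\le A}$ run over integers $0<n\le A$. $\sum_{\chi\ne\chi_0}$ is over all non-principal Dirichlet characters modulo $q$, and $\chi^*$ denotes the primitive character inducing $\chi$. GRH: all non-trivial zeros (those with $0<\mathrm{Re}(s)<1$) of $\zeta(s)$ and of all Dirichlet $L$-functions have real part $1/2$. $\rho=\frac12+i\gamma$ runs over the non-trivial zeros of $\zeta(s)$. The assumption $\sum_{0<\gamma\le X}|\zeta'(\rho)|^{-2}\ll X$ (a weak form of the Gonek--Hejhal conjecture) is for $X\to\infty$ and includes that all non-trivial zeros of $\zeta$ are simple. Forward differences: $\Delta_h^r(f,x):=\sum_{k=0}^r\binom rk(-1)^{r-k}f(x+hk)$. H\"older--Zygmund spaces: $\mathcal C^1(\mathbb R)$ is the set of bounded continuous $f$ on $\mathbb R$ with $\|f\|_\infty+\sup_{x,\,h\ne0}|\Delta_h^2(f,x)|/|h|<\infty$. For $0<s<1$, $\|f\|_{\mathcal C^{s}}:=\|f\|_\infty+\sup_{x,\,h\neq0}|\Delta_h^1(f,x)|/|h|^{s}$. For $1<\delta<2$, $\mathcal C^\delta(\mathbb R)$ is the set of bounded $f\in C^1(\mathbb R)$ with $\|f\|_{\mathcal C^{\delta-1}}+\|f'\|_{\mathcal C^{\delta-1}}<\infty$. *)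

theory Defs
  imports
    "HOL-Complex_Analysis.Complex_Analysis"
    "HOL-Number_Theory.Prime_Powers"
    "HOL-Number_Theory.Residues"
    "HOL-Real_Asymp.Real_Asymp"
    "HOL-Computational_Algebra.Squarefree"
begin

section \<open>Arithmetic functions\<close>

definition moebius_mu :: "nat \<Rightarrow> int" where
  "moebius_mu n = (if squarefree n then (-1) ^ card (prime_factors n) else 0)"

section \<open>Dirichlet characters\<close>

text \<open>The value \<open>\<xi> 1 = 1\<close> is forced: \<open>\<xi> 1\<close> is a nonzero idempotent.\<close>

definition dirichlet_character :: "nat \<Rightarrow> (nat \<Rightarrow> complex) \<Rightarrow> bool" where
  "dirichlet_character q \<xi> \<longleftrightarrow>
     q > 0 \<and>
     (\<forall>a b. \<xi> (a * b) = \<xi> a * \<xi> b) \<and>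
     (\<forall>a. \<xi> (a + q) = \<xi> a) \<and>
     (\<forall>a. \<xi> a \<noteq> 0 \<longleftrightarrow> coprime a q)"

definition principal_character :: "nat \<Rightarrow> nat \<Rightarrow> complex" where
  "principal_character q a = (if coprime a q then 1 else 0)"

definition nonprincipal_characters :: "nat \<Rightarrow> (nat \<Rightarrow> complex) set" where
  "nonprincipal_characters q =
     {\<xi>. dirichlet_character q \<xi> \<and> \<xi> \<noteq> principal_character q}"

definition induces_character ::
  "nat \<Rightarrow> (nat \<Rightarrow> complex) \<Rightarrow> nat \<Rightarrow> (nat \<Rightarrow> complex) \<Rightarrow> bool" where
  "induces_character d \<psi> q \<xi> \<longleftrightarrow>
     dirichlet_character d \<psi> \<and> dirichlet_character q \<xi> \<and> d dvd q \<and>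
     (\<forall>a. coprime a q \<longrightarrow> \<xi> a = \<psi> a)"

definition primitive_character :: "nat \<Rightarrow> (nat \<Rightarrow> complex) \<Rightarrow> bool" where
  "primitive_character q \<xi> \<longleftrightarrow>
     dirichlet_character q \<xi> \<and> (\<forall>d \<psi>. induces_character d \<psi> q \<xi> \<longrightarrow> d = q)"

definition inducing_primitive_character ::
  "nat \<Rightarrow> (nat \<Rightarrow> complex) \<Rightarrow> nat \<Rightarrow> complex" where
  "inducing_primitive_character q \<xi> =
     (THE \<psi>. \<exists>d. primitive_character d \<psi> \<and> induces_character d \<psi> q \<xi>)"


section \<open>L-functions\<close>

text \<open>
  The meromorphic continuation to the whole plane of the Dirichlet series with coefficients \<open>a\<close>.
  \<open>nicely_meromorphic_on\<close> makes the function unique: removable singularities are removed, and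
  the value at a pole is 0 by convention.
\<close>

definition is_dirichlet_L :: "(nat \<Rightarrow> complex) \<Rightarrow> (complex \<Rightarrow> complex) \<Rightarrow> bool" where
  "is_dirichlet_L a F \<longleftrightarrow>
     F nicely_meromorphic_on UNIV \<and>
     (\<forall>s. Re s > 1 \<longrightarrow> (\<lambda>n. a (Suc n) / of_nat (Suc n) powr s) sums F s)"

definition dirichlet_L :: "(nat \<Rightarrow> complex) \<Rightarrow> complex \<Rightarrow> complex" where
  "dirichlet_L a = (THE F. is_dirichlet_L a F)"

definition zeta :: "complex \<Rightarrow> complex" where
  "zeta = dirichlet_L (\<lambda>_. 1)"

definition nontrivial_zeros :: "(complex \<Rightarrow> complex) \<Rightarrow> complex set" where
  "nontrivial_zeros L = {s. 0 < Re s \<and> Re s < 1 \<and> L s = 0}"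

definition GRH :: bool where
  "GRH \<longleftrightarrow>
     (\<forall>\<rho>\<in>nontrivial_zeros zeta. Re \<rho> = 1 / 2) \<and>
     (\<forall>q \<xi>. dirichlet_character q \<xi> \<longrightarrow>
        (\<forall>\<rho>\<in>nontrivial_zeros (dirichlet_L \<xi>). Re \<rho> = 1 / 2))"

text \<open>
  Simplicity of the zeros has to be stated separately, because \<open>1 / 0 = 0\<close>.
\<close>

definition weak_Gonek_Hejhal :: bool where
  "weak_Gonek_Hejhal \<longleftrightarrow>
     (\<forall>\<rho>\<in>nontrivial_zeros zeta. zorder zeta \<rho> = 1) \<and>
     (\<lambda>X::real. \<Sum>\<rho> | \<rho> \<in> nontrivial_zeros zeta \<and> 0 < Im \<rho> \<and> Im \<rho> \<le> X.
        1 / (norm (deriv zeta \<rho>))\<^sup>2) \<in> O[at_top](\<lambda>X. X)"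


section \<open>Hoelder--Zygmund spaces\<close>

definition forward_diff :: "nat \<Rightarrow> real \<Rightarrow> (real \<Rightarrow> complex) \<Rightarrow> real \<Rightarrow> complex" where
  "forward_diff r h f x =
     (\<Sum>k=0..r. of_nat (r choose k) * (-1) ^ (r - k) * f (x + h * real k))"

text \<open>
  The Hoelder norm of order \<open>s\<close> (used for \<open>0 < s < 1\<close>) and the Zygmund norm,
  both with value \<open>\<infinity>\<close> allowed.
\<close>

definition hoelder_norm :: "real \<Rightarrow> (real \<Rightarrow> complex) \<Rightarrow> ennreal" where
  "hoelder_norm s f =
     (SUP x. ennreal (norm (f x))) +
     (SUP x. SUP h\<in>-{0}. ennreal (norm (forward_diff 1 h f x) / \<bar>h\<bar> powr s))"

definition zygmund_norm :: "(real \<Rightarrow> complex) \<Rightarrow> ennreal" where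
  "zygmund_norm f =
     (SUP x. ennreal (norm (f x))) +
     (SUP x. SUP h\<in>-{0}. ennreal (norm (forward_diff 2 h f x) / \<bar>h\<bar>))"

text \<open>The definition is meant for \<open>1 \<le> \<delta> < 2\<close>.\<close>

definition hoelder_zygmund :: "real \<Rightarrow> (real \<Rightarrow> complex) set" where
  "hoelder_zygmund \<delta> =
     (if \<delta> = 1
      then {f. bounded (range f) \<and> continuous_on UNIV f \<and> zygmund_norm f < \<infinity>}
      else {f. bounded (range f) \<and> f C1_differentiable_on UNIV \<and>
               hoelder_norm (\<delta> - 1) f
                 + hoelder_norm (\<delta> - 1) (\<lambda>x. vector_derivative f (at x)) < \<infinity>})"


section \<open>Existence and uniqueness of the inducing primitive character\<close>

lemma dirichlet_character_cong:
  assumes "dirichlet_character q \<xi>" "[a = b] (mod q)"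
  shows "\<xi> a = \<xi> b"
proof -
  have *: "\<xi> (n * q + r) = \<xi> r" for n r
    using assms(1) by (induction n) (auto simp: dirichlet_character_def add_ac, metis add.assoc add.commute)
  have "\<xi> n = \<xi> (n mod q)" for n
    using *[of "n div q" "n mod q"] by simp
  thus ?thesis using assms(2) by (metis cong_def)
qed

lemma coprime_lift:
  fixes a d q :: nat
  assumes "d dvd q" "q > 0" "coprime a d"
  shows "\<exists>b. [b = a] (mod d) \<and> coprime b q"
proof -
  define P where "P = {p \<in> prime_factors q. \<not> p dvd a}"
  define b where "b = a + d * \<Prod>P"
  have P: "finite P" "\<And>p. p \<in> P \<Longrightarrow> prime p" by (auto simp: P_def)
  have "coprime b q"
  proof (rule ccontr)
    assume "\<not> coprime b q"
    hence "gcd b q \<noteq> 1" by (simp add: coprime_iff_gcd_eq_1)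
    then obtain p where "prime p" "p dvd gcd b q" using prime_factor_nat by blast
    hence p: "prime p" "p dvd b" "p dvd q" by simp_all
    hence pf: "p \<in> prime_factors q" using assms(2) by (auto simp: prime_factors_dvd)
    show False
    proof (cases "p dvd a")
      case True
      hence "\<not> p dvd d" using assms(3) p(1) by (metis coprime_common_divisor not_prime_unit)
      moreover have "p dvd d * \<Prod>P" using True p(2) unfolding b_def by (simp add: dvd_add_right_iff)
      ultimately have "p dvd \<Prod>P" using p(1) by (simp add: prime_dvd_mult_iff)
      then obtain r where "r \<in> P" "p dvd r" using P p(1) by (auto simp: prime_dvd_prod_iff)
      thus False using True P p(1) primes_dvd_imp_eq by (auto simp: P_def)
    next
      case False
      hence "p dvd d * \<Prod>P" using pf P by (auto simp: P_def intro!: dvd_mult dvd_prodI)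
      thus False using False p(2) by (simp add: b_def dvd_add_left_iff)
    qed
  qed
  moreover have "[b = a] (mod d)" by (simp add: b_def cong_def)
  ultimately show ?thesis by blast
qed

lemma chinese_remainder_gcd:
  fixes b1 b2 d1 d2 :: nat
  assumes "d1 > 0" "d2 > 0" "[b1 = b2] (mod (gcd d1 d2))"
  shows "\<exists>x. [x = b1] (mod d1) \<and> [x = b2] (mod d2)"
proof -
  define g where "g = gcd d1 d2"
  define c where "c = b2 + b1 * (d2 - 1)"
  have c: "b1 + c = b2 + b1 * d2" using assms(2) by (cases d2) (auto simp: c_def)
  hence c2: "[b1 + c = b2] (mod d2)" by (simp add: cong_def)
  hence "[b1 + c = b2] (mod g)" by (rule cong_dvd_modulus_nat) (simp add: g_def)
  also have "[b2 = b1 + 0] (mod g)" using assms(3) by (simp add: g_def cong_sym)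
  finally have "[c = 0] (mod g)" by (simp only: cong_add_lcancel_nat)
  hence "g dvd c" by (simp add: cong_0_iff)
  then obtain e where e: "c = g * e" by blast
  obtain t where t: "[d1 * t = g] (mod d2)"
    using cong_solve_nat[of d1 d2] assms(1) by (auto simp: g_def)
  hence "[d1 * t * e = c] (mod d2)" unfolding e by (rule cong_scalar_right)
  hence "[b1 + d1 * t * e = b1 + c] (mod d2)" by (rule cong_add[OF cong_refl])
  hence "[b1 + d1 * t * e = b2] (mod d2)" using c2 cong_trans by blast
  moreover have "[b1 + d1 * t * e = b1] (mod d1)" by (simp add: cong_def mult.assoc)
  ultimately show ?thesis by blast
qed

lemma dirichlet_character_eqI:
  assumes "dirichlet_character d \<psi>1" "dirichlet_character d \<psi>2" "d dvd q" "q > 0"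
    and "\<And>a. coprime a q \<Longrightarrow> \<psi>1 a = \<psi>2 a"
  shows "\<psi>1 = \<psi>2"
proof
  fix a show "\<psi>1 a = \<psi>2 a"
  proof (cases "coprime a d")
    case True
    then obtain b where "[b = a] (mod d)" "coprime b q" using coprime_lift assms by blast
    thus ?thesis using assms dirichlet_character_cong by metis
  next
    case False
    thus ?thesis using assms by (metis dirichlet_character_def)
  qed
qed

lemma induces_character_trans:
  assumes "induces_character c \<phi> d \<psi>" "induces_character d \<psi> q \<xi>"
  shows "induces_character c \<phi> q \<xi>"
  using assms unfolding induces_character_def
  by (metis coprime_divisors dvd_refl dvd_trans)

lemma induces_character_gcd:
  assumes 1: "induces_character d1 \<psi>1 q \<xi>" and 2: "induces_character d2 \<psi>2 q \<xi>"
  shows "\<exists>\<psi>. induces_character (gcd d1 d2) \<psi> q \<xi>"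
proof -
  define g where "g = gcd d1 d2"
  have \<xi>: "dirichlet_character q \<xi>" and q: "q > 0" and \<psi>: "dirichlet_character d1 \<psi>1" "dirichlet_character d2 \<psi>2"
    and dvd: "d1 dvd q" "d2 dvd q" and d: "d1 > 0" "d2 > 0"
    and eq: "\<And>a. coprime a q \<Longrightarrow> \<xi> a = \<psi>1 a" "\<And>a. coprime a q \<Longrightarrow> \<xi> a = \<psi>2 a"
    using 1 2 by (auto simp: induces_character_def dirichlet_character_def)
  have g: "g > 0" "g dvd q" "g dvd d1" "g dvd d2" using d dvd by (auto simp: g_def)
  have mult: "\<xi> (a * b) = \<xi> a * \<xi> b" and nz: "\<xi> a \<noteq> 0 \<longleftrightarrow> coprime a q" for a b
    using \<xi> by (auto simp: dirichlet_character_def)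
  have wd: "\<xi> b = \<xi> b'" if b: "coprime b q" "coprime b' q" "[b = b'] (mod g)" for b b'
  proof -
    obtain x where x: "[x = b] (mod d1)" "[x = b'] (mod d2)"
      using chinese_remainder_gcd d b(3) unfolding g_def by blast
    have "coprime b d1" "coprime b' d2" using b dvd by (meson coprime_divisors dvd_refl)+
    hence "coprime x d1" "coprime x d2" using x by (meson cong_imp_coprime cong_sym)+
    hence "coprime x (d1 * d2)" by simp
    hence "coprime x (lcm d1 d2)" by (meson coprime_divisors dvd_refl lcm_least dvd_triv_left dvd_triv_right)
    moreover have "lcm d1 d2 dvd q" using dvd by simp
    ultimately obtain y where y: "[y = x] (mod lcm d1 d2)" "coprime y q"
      using coprime_lift q by blast
    have "[y = x] (mod d1)" "[y = x] (mod d2)"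
      using y(1) by (meson cong_dvd_modulus_nat dvd_lcm1 dvd_lcm2)+
    hence "[y = b] (mod d1)" "[y = b'] (mod d2)" using x cong_trans by blast+
    hence "\<psi>1 y = \<psi>1 b" "\<psi>2 y = \<psi>2 b'" using \<psi> dirichlet_character_cong by blast+
    thus ?thesis using eq b y(2) by metis
  qed
  define \<psi> where "\<psi> = (\<lambda>a. if coprime a g then \<xi> (SOME b. [b = a] (mod g) \<and> coprime b q) else 0)"
  have \<psi>_eq: "\<psi> a = \<xi> b" if "[b = a] (mod g)" "coprime b q" for a b
  proof -
    have "coprime b g" using that(2) g(2) by (meson coprime_divisors dvd_refl)
    hence ca: "coprime a g" using that(1) cong_imp_coprime by blast
    define b' where "b' = (SOME b. [b = a] (mod g) \<and> coprime b q)"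
    have "[b' = a] (mod g) \<and> coprime b' q"
      unfolding b'_def by (rule someI[where x = b]) (use that in auto)
    hence "\<xi> b' = \<xi> b" using wd that by (meson cong_sym cong_trans)
    thus ?thesis using ca by (simp add: \<psi>_def b'_def)
  qed
  have lift: "\<exists>b. [b = a] (mod g) \<and> coprime b q" if "coprime a g" for a
    using coprime_lift that g q by blast
  have "dirichlet_character g \<psi>"
    unfolding dirichlet_character_def
  proof (intro conjI allI)
    show "\<psi> (a * b) = \<psi> a * \<psi> b" for a b
    proof (cases "coprime a g \<and> coprime b g")
      case True
      then obtain a' b' where "[a' = a] (mod g)" "coprime a' q" "[b' = b] (mod g)" "coprime b' q"
        using lift by metis
      thus ?thesis using \<psi>_eq[of "a' * b'" "a * b"] \<psi>_eq[of a' a] \<psi>_eq[of b' b]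
        by (simp add: mult cong_mult)
    qed (auto simp: \<psi>_def)
    show "\<psi> (a + g) = \<psi> a" for a
      unfolding \<psi>_def by (simp add: cong_def coprime_iff_gcd_eq_1)
    show "\<psi> a \<noteq> 0 \<longleftrightarrow> coprime a g" for a
    proof (cases "coprime a g")
      case True
      then obtain b where b: "[b = a] (mod g)" "coprime b q" using lift by blast
      have "\<psi> a \<noteq> 0" unfolding \<psi>_eq[OF b] nz by (rule b)
      thus ?thesis using True by blast
    qed (simp add: \<psi>_def)
  qed (use g in auto)
  moreover have "\<xi> a = \<psi> a" if "coprime a q" for a
    using \<psi>_eq[of a a] that by simp
  ultimately show ?thesis
    using \<xi> g unfolding induces_character_def g_def by blast
qed

lemma induces_character_descend:
  assumes 1: "induces_character c \<phi> q \<xi>" and 2: "induces_character d \<psi> q \<xi>" and "c dvd d"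
  shows "induces_character c \<phi> d \<psi>"
proof -
  have "\<psi> a = \<phi> a" if a: "coprime a d" for a
  proof -
    have "d dvd q" "q > 0" using 2 by (auto simp: induces_character_def dirichlet_character_def)
    then obtain b where b: "[b = a] (mod d)" "coprime b q" using coprime_lift a by blast
    have "[b = a] (mod c)" using b(1) assms(3) by (rule cong_dvd_modulus_nat)
    hence "\<phi> b = \<phi> a" "\<psi> b = \<psi> a"
      using 1 2 b(1) by (simp_all only: induces_character_def dirichlet_character_cong[of c \<phi> b a] dirichlet_character_cong[of d \<psi> b a])
    thus ?thesis using 1 2 b by (auto simp: induces_character_def)
  qed
  thus ?thesis using 1 2 assms(3) by (auto simp: induces_character_def)
qed

lemma ex1_inducing_primitive_character:
  assumes "dirichlet_character q \<xi>"
  shows "\<exists>!\<psi>. \<exists>d. primitive_character d \<psi> \<and> induces_character d \<psi> q \<xi>"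
proof (rule ex_ex1I)
  have q: "\<exists>\<psi>. induces_character q \<psi> q \<xi>"
    using assms by (auto simp: induces_character_def)
  define d where "d = (LEAST d. \<exists>\<psi>. induces_character d \<psi> q \<xi>)"
  from LeastI[of "\<lambda>d. \<exists>\<psi>. induces_character d \<psi> q \<xi>", OF q]
  obtain \<psi> where \<psi>: "induces_character d \<psi> q \<xi>" unfolding d_def by blast
  have "primitive_character d \<psi>"
    unfolding primitive_character_def
  proof (intro conjI allI impI)
    show "dirichlet_character d \<psi>" using \<psi> by (simp add: induces_character_def)
    fix c \<phi> assume *: "induces_character c \<phi> d \<psi>"
    hence "\<exists>\<phi>. induces_character c \<phi> q \<xi>" using \<psi> induces_character_trans by blast
    hence "d \<le> c" unfolding d_def by (rule Least_le)
    moreover have "c \<le> d"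
      using * by (intro dvd_imp_le) (auto simp: induces_character_def dirichlet_character_def)
    ultimately show "c = d" by simp
  qed
  thus "\<exists>\<psi> d. primitive_character d \<psi> \<and> induces_character d \<psi> q \<xi>" using \<psi> by blast
next
  fix \<psi>1 \<psi>2
  assume "\<exists>d. primitive_character d \<psi>1 \<and> induces_character d \<psi>1 q \<xi>"
    and "\<exists>d. primitive_character d \<psi>2 \<and> induces_character d \<psi>2 q \<xi>"
  then obtain d1 d2 where p: "primitive_character d1 \<psi>1" "primitive_character d2 \<psi>2"
    and i: "induces_character d1 \<psi>1 q \<xi>" "induces_character d2 \<psi>2 q \<xi>" by blast
  obtain \<psi> where \<psi>: "induces_character (gcd d1 d2) \<psi> q \<xi>"
    using induces_character_gcd[OF i] by blast
  have "induces_character (gcd d1 d2) \<psi> d1 \<psi>1" "induces_character (gcd d1 d2) \<psi> d2 \<psi>2"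
    using induces_character_descend[OF \<psi>] i by auto
  hence "gcd d1 d2 = d1" "gcd d1 d2 = d2" using p unfolding primitive_character_def by blast+
  hence d: "d1 = d2" by simp
  show "\<psi>1 = \<psi>2"
    by (rule dirichlet_character_eqI[where d = d1 and q = q])
       (use i d in \<open>auto simp: induces_character_def dirichlet_character_def\<close>)
qed

lemma finite_dirichlet_characters: "finite {\<xi>. dirichlet_character q \<xi>}"
proof (cases "q = 0")
  case False
  define R where "R = insert 0 {z::complex. z ^ totient q = 1}"
  have "finite {z::complex. z ^ totient q = 1}"
    by (rule finite_roots_unity) (use False in \<open>auto simp: Suc_le_eq\<close>)
  hence R: "finite R" by (simp add: R_def)
  have val: "\<xi> a \<in> R" if \<xi>: "dirichlet_character q \<xi>" for \<xi> a
  proof (cases "coprime a q")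
    case True
    have mult: "\<And>a b. \<xi> (a * b) = \<xi> a * \<xi> b" using \<xi> by (simp add: dirichlet_character_def)
    have "\<xi> 1 \<noteq> 0" using \<xi> by (auto simp: dirichlet_character_def)
    hence 1: "\<xi> 1 = 1" using mult[of 1 1] by simp
    have "\<xi> (a ^ n) = \<xi> a ^ n" for n by (induction n) (use 1 mult in auto)
    hence "\<xi> a ^ totient q = \<xi> (a ^ totient q)" by simp
    also have "\<dots> = \<xi> 1"
      by (rule dirichlet_character_cong[OF \<xi>]) (use True in \<open>rule euler_theorem\<close>)
    finally show ?thesis using 1 by (simp add: R_def)
  next
    case False
    thus ?thesis using \<xi> by (auto simp: dirichlet_character_def R_def)
  qed
  show ?thesis
  proof (rule inj_on_finite[where f = "\<lambda>\<xi>. restrict \<xi> {..<q}" and B = "{..<q} \<rightarrow>\<^sub>E R"])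
    show "inj_on (\<lambda>\<xi>. restrict \<xi> {..<q}) {\<xi>. dirichlet_character q \<xi>}"
    proof (rule inj_onI, rule ext, clarsimp)
      fix \<xi>1 \<xi>2 :: "nat \<Rightarrow> complex" and a
      assume c: "dirichlet_character q \<xi>1" "dirichlet_character q \<xi>2"
        and r: "restrict \<xi>1 {..<q} = restrict \<xi>2 {..<q}"
      have "\<xi>1 (a mod q) = \<xi>2 (a mod q)"
        using fun_cong[OF r, of "a mod q"] False by simp
      moreover have "[a = a mod q] (mod q)" by (simp add: cong_def)
      ultimately show "\<xi>1 a = \<xi>2 a" using c dirichlet_character_cong by metis
    qed
  qed (use val R in \<open>auto intro!: finite_PiE split: if_splits\<close>)
qed (simp add: dirichlet_character_def)


section \<open>Existence and uniqueness of the meromorphic continuation\<close>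

text \<open>
  For periodic coefficients the Dirichlet series splits into the series \<open>\<Sum>n. (a + n q) powr -s\<close>.
  These are continued one half-plane at a time: summing the Taylor expansion of
  \<open>u powr (1 - s)\<close> between \<open>u = a + n q\<close> and \<open>u + q\<close> over \<open>n\<close> expresses the series at \<open>s\<close> by
  its values at \<open>s + 1, s + 2, \<dots>\<close> and a remainder that is holomorphic further to the left.
\<close>

lemma powr_complex_has_deriv:
  fixes t c :: complex
  assumes "t \<notin> \<real>\<^sub>\<le>\<^sub>0"
  shows "((\<lambda>t. t powr c) has_field_derivative (c * t powr (c - 1))) (at t within S)"
  using assms by (auto intro!: derivative_eq_intros has_field_derivative_powr simp: has_field_derivative_at_within)

definition fallfact :: "complex \<Rightarrow> nat \<Rightarrow> complex" where
  "fallfact z i = (\<Prod>j<i. z - of_nat j)"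

lemma fallfact_Suc: "fallfact z (Suc i) = fallfact z i * (z - of_nat i)"
  by (simp add: fallfact_def)

definition taylor_rem :: "nat \<Rightarrow> real \<Rightarrow> real \<Rightarrow> complex \<Rightarrow> complex" where
  "taylor_rem m q u s = of_real (u + q) powr (1 - s)
     - (\<Sum>i\<le>m. fallfact (1 - s) i * of_real u powr (1 - s - of_nat i) * of_real q ^ i / fact i)"

lemma taylor_rem_bound:
  assumes u: "u \<ge> 1" and q: "q > 0" and s: "Re s + real m \<ge> 0"
  shows "norm (taylor_rem m q u s) \<le> norm (fallfact (1 - s) (Suc m)) * q ^ Suc m / fact m * u powr (- (Re s + real m))"
proof -
  define S where "S = closed_segment (of_real u :: complex) (of_real (u + q))"
  define f where "f = (\<lambda>i (t::complex). fallfact (1 - s) i * t powr (1 - s - of_nat i))"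
  have S: "\<exists>v. t = of_real v \<and> v \<ge> u" if "t \<in> S" for t
    using that q unfolding S_def closed_segment_of_real 
    by (auto simp: closed_segment_eq_real_ivl simp del: of_real_add)
  have "norm (f 0 (of_real (u + q)) - (\<Sum>i\<le>m. f i (of_real u) * (of_real (u + q) - of_real u) ^ i / fact i))
      \<le> (norm (fallfact (1 - s) (Suc m)) * u powr (- (Re s + real m)))
         * norm (of_real (u + q) - of_real u :: complex) ^ Suc m / fact m"
  proof (rule complex_Taylor[where S = S])
    show "convex S" by (simp add: S_def)
    show "(f i has_field_derivative f (Suc i) t) (at t within S)" if "t \<in> S" "i \<le> m" for i t
    proof -
      from S[OF that(1)] obtain v where v: "t = of_real v" "v \<ge> u" by auto
      have t: "t \<notin> \<real>\<^sub>\<le>\<^sub>0" using v u by (auto simp: complex_nonpos_Reals_iff)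
      show ?thesis unfolding f_def fallfact_Suc
        by (rule derivative_eq_intros powr_complex_has_deriv t refl)+ (simp add: algebra_simps)
    qed
    show "norm (f (Suc m) t) \<le> norm (fallfact (1 - s) (Suc m)) * u powr (- (Re s + real m))" if "t \<in> S" for t
    proof -
      from S[OF that(1)] obtain v where v: "t = of_real v" "v \<ge> u" by auto
      have "norm (t powr (1 - s - of_nat (Suc m))) = v powr (- (Re s + real m))"
        using v u by (simp add: norm_powr_real_powr)
      also have "\<dots> \<le> u powr (- (Re s + real m))"
        using v u s by (intro powr_mono2') auto
      finally show ?thesis unfolding f_def norm_mult by (intro mult_left_mono) auto
    qed
  qed (auto simp: S_def)
  thus ?thesis using q by (simp add: taylor_rem_def f_def fallfact_def mult_ac)
qed

lemma taylor_rem_holomorphic: "u > 0 \<Longrightarrow> q > 0 \<Longrightarrow> taylor_rem m q u holomorphic_on A"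
  unfolding taylor_rem_def fallfact_def by (intro holomorphic_intros) auto

lemma summable_arith_powr:
  assumes "a \<ge> 1" "q > 0" "\<sigma> > (1::real)"
  shows "summable (\<lambda>n. (a + real n * q) powr (- \<sigma>))"
proof -
  have s: "summable (\<lambda>n. (min 1 q) powr (-\<sigma>) * (real (Suc n) powr (- \<sigma>)))"
    using assms by (intro summable_mult) (subst summable_Suc_iff[of "\<lambda>n. real n powr -\<sigma>"], simp add: summable_real_powr_iff)
  show ?thesis
  proof (rule summable_comparison_test[OF _ s], intro exI allI impI)
    fix n
    have "min 1 q * real (Suc n) \<le> a + real n * q"
    proof -
      have "min 1 q * real (Suc n) = min 1 q + min 1 q * real n" by (simp add: algebra_simps)
      also have "\<dots> \<le> a + q * real n" using assms by (intro add_mono mult_right_mono) auto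
      finally show ?thesis by (simp add: mult_ac)
    qed
    hence "(a + real n * q) powr (- \<sigma>) \<le> (min 1 q * real (Suc n)) powr (-\<sigma>)"
      using assms by (intro powr_mono2') (auto intro!: mult_pos_pos)
    also have "\<dots> = (min 1 q) powr (-\<sigma>) * (real (Suc n) powr (- \<sigma>))"
      using assms by (subst powr_mult) auto
    finally show "norm ((a + real n * q) powr (- \<sigma>)) \<le> \<dots>" by simp
  qed
qed

text \<open>Locally uniformly dominated series of holomorphic functions on a half-plane\<close>

lemma holomorphic_suminf_halfplane:
  fixes g :: "nat \<Rightarrow> complex \<Rightarrow> complex"
  assumes hol: "\<And>n. g n holomorphic_on {s. Re s > c}"
    and bound: "\<And>s n. Re s > c \<Longrightarrow> norm (g n s) \<le> B s * (a + real n * q) powr (- (Re s - c + 1))"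
    and B: "continuous_on UNIV B" and a: "a \<ge> 1" "q > 0"
  shows "(\<lambda>s. \<Sum>n. g n s) holomorphic_on {s. Re s > c}"
    and "Re s > c \<Longrightarrow> summable (\<lambda>n. g n s)"
proof -
  have op: "open {s. Re s > c}" by (rule open_halfspace_Re_gt)
  show "(\<lambda>s. \<Sum>n. g n s) holomorphic_on {s. Re s > c}"
  proof (rule holomorphic_uniform_sequence[OF op])
    show "(\<lambda>s. \<Sum>k<n. g k s) holomorphic_on {s. Re s > c}" for n
      by (intro holomorphic_intros hol)
    fix s0 assume "s0 \<in> {s. Re s > c}"
    then obtain e where e: "e > 0" "cball s0 e \<subseteq> {s. Re s > c}"
      using op by (meson open_contains_cball)
    have ne: "cball s0 e \<noteq> {}" using e by simp
    have cpt: "compact (cball s0 e)" by simp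
    obtain M where M: "\<And>s. s \<in> cball s0 e \<Longrightarrow> B s \<le> M"
      using continuous_attains_sup[OF cpt ne continuous_on_subset[OF B]] by blast
    obtain s1 where s1: "s1 \<in> cball s0 e" "\<And>s. s \<in> cball s0 e \<Longrightarrow> Re s1 \<le> Re s"
      using continuous_attains_inf[OF cpt ne continuous_on_Re[OF continuous_on_id]] by auto
    define \<sigma> where "\<sigma> = Re s1 - c + 1"
    have \<sigma>: "\<sigma> > 1" using s1(1) e(2) by (auto simp: \<sigma>_def)
    have "uniform_limit (cball s0 e) (\<lambda>n s. \<Sum>k<n. g k s) (\<lambda>s. \<Sum>n. g n s) sequentially"
    proof (rule Weierstrass_m_test)
      show "summable (\<lambda>n. max M 0 * (a + real n * q) powr (-\<sigma>))"
        by (intro summable_mult summable_arith_powr a \<sigma>)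
      fix n s assume s: "s \<in> cball s0 e"
      have "norm (g n s) \<le> B s * (a + real n * q) powr (- (Re s - c + 1))"
        using s e(2) by (intro bound) auto
      also have "\<dots> \<le> max M 0 * (a + real n * q) powr (-\<sigma>)"
      proof (rule mult_mono)
        have "1 \<le> a + real n * q" using a by (simp add: add_increasing2)
        thus "(a + real n * q) powr (- (Re s - c + 1)) \<le> (a + real n * q) powr (-\<sigma>)"
          using s1(2)[OF s] by (intro powr_mono) (auto simp: \<sigma>_def)
      qed (use M[OF s] in auto)
      finally show "norm (g n s) \<le> \<dots>" .
    qed
    thus "\<exists>d>0. cball s0 d \<subseteq> {s. Re s > c} \<and>
        uniform_limit (cball s0 d) (\<lambda>n s. \<Sum>k<n. g k s) (\<lambda>s. \<Sum>n. g n s) sequentially"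
      using e by blast
  qed
  assume s: "Re s > c"
  show "summable (\<lambda>n. g n s)"
    by (rule summable_comparison_test[OF _ summable_mult[OF summable_arith_powr[OF a, of "Re s - c + 1"]]])
       (use s bound[OF s] in auto)
qed

definition arith_series :: "real \<Rightarrow> real \<Rightarrow> complex \<Rightarrow> complex" where
  "arith_series a q s = (\<Sum>n. of_real (a + real n * q) powr (-s))"

lemma arith_pos: "a \<ge> 1 \<Longrightarrow> q > 0 \<Longrightarrow> a + real n * q \<ge> (1::real)"
  by (simp add: add_increasing2)

lemma arith_series:
  assumes a: "a \<ge> 1" "q > 0"
  shows "arith_series a q holomorphic_on {s. Re s > 1}"
    and "Re s > 1 \<Longrightarrow> (\<lambda>n. of_real (a + real n * q) powr (-s)) sums arith_series a q s"
proof -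
  have pos: "a + real n * q > 0" for n using arith_pos[OF a, of n] by linarith
  have *: "(\<lambda>s. of_real (a + real n * q) powr (-s)) holomorphic_on {s. Re s > 1}" for n
    using pos[of n] by (intro holomorphic_intros) (auto simp del: of_real_add simp: complex_nonpos_Reals_iff)
  have **: "norm (of_real (a + real n * q) powr (-s) :: complex) \<le> 1 * (a + real n * q) powr (- (Re s - 1 + 1))" for n s
    using pos[of n] by (simp add: norm_powr_real_powr del: of_real_add)
  show "arith_series a q holomorphic_on {s. Re s > 1}"
    unfolding arith_series_def by (rule holomorphic_suminf_halfplane[OF * ** _ a]) auto
  show "Re s > 1 \<Longrightarrow> (\<lambda>n. of_real (a + real n * q) powr (-s)) sums arith_series a q s"
    unfolding arith_series_def by (rule summable_sums, rule holomorphic_suminf_halfplane(2)[OF * ** _ a]) auto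
qed

lemma arith_series_rec:
  assumes a: "a \<ge> 1" "q > 0" and s: "Re s > 1" and m: "m \<ge> 1"
  shows "of_real a powr (1 - s) =
     - (\<Sum>i=1..m. fallfact (1 - s) i * of_real q ^ i / fact i * arith_series a q (s + of_nat i - 1))
     - (\<Sum>n. taylor_rem m q (a + real n * q) s)"
    and "summable (\<lambda>n. taylor_rem m q (a + real n * q) s)"
proof -
  define u where "u = (\<lambda>n. a + real n * q)"
  have u: "u n \<ge> 1" for n unfolding u_def by (rule arith_pos[OF a])
  have uSuc: "u (Suc n) = u n + q" for n by (simp add: u_def algebra_simps)
  define h where "h = (\<lambda>n. (of_real (u n) :: complex) powr (1 - s))"
  have "filterlim (\<lambda>n. a + q * real n) at_top sequentially"
    using a by real_asymp
  hence ulim: "filterlim u at_top sequentially" by (simp add: u_def mult_ac)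
  have "((\<lambda>n. u n powr (1 - Re s)) \<longlongrightarrow> 0) sequentially"
    using tendsto_neg_powr[OF _ ulim, of "1 - Re s"] s by simp
  hence "h \<longlonglongrightarrow> 0"
  proof (rule Lim_null_comparison[rotated], intro always_eventually allI)
    fix n show "norm (h n) \<le> u n powr (1 - Re s)"
      using u[of n] by (simp add: h_def norm_powr_real_powr)
  qed
  from telescope_sums[OF this] have tele: "(\<lambda>n. h (Suc n) - h n) sums (0 - h 0)" .
  have eq: "taylor_rem m q (u n) s = h (Suc n) - h n - 
     (\<Sum>i=1..m. fallfact (1 - s) i * of_real q ^ i / fact i * of_real (u n) powr (- (s + of_nat i - 1)))" for n
  proof -
    have "{..m} = insert 0 {1..m}" by auto
    thus ?thesis unfolding taylor_rem_def h_def uSuc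
      by (simp add: fallfact_def algebra_simps)
  qed
  have "(\<lambda>n. taylor_rem m q (u n) s) sums ((0 - h 0) - 
     (\<Sum>i=1..m. fallfact (1 - s) i * of_real q ^ i / fact i * arith_series a q (s + of_nat i - 1)))"
    unfolding eq
  proof (rule sums_diff[OF tele], intro sums_sum sums_mult)
    fix i assume "i \<in> {1..m}"
    thus "(\<lambda>n. of_real (u n) powr (- (s + of_nat i - 1))) sums arith_series a q (s + of_nat i - 1)"
      unfolding u_def by (intro arith_series a) (use s in auto)
  qed
  note sums = this
  show "summable (\<lambda>n. taylor_rem m q (a + real n * q) s)"
    using sums_summable[OF sums] by (simp only: u_def)
  have h0: "h 0 = of_real a powr (1 - s)" by (simp add: h_def u_def)
  show "of_real a powr (1 - s) =
     - (\<Sum>i=1..m. fallfact (1 - s) i * of_real q ^ i / fact i * arith_series a q (s + of_nat i - 1))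
     - (\<Sum>n. taylor_rem m q (a + real n * q) s)"
    unfolding sums_unique[OF sums, symmetric, unfolded u_def] h0[symmetric] by simp
qed

lemma arith_series_meromorphic_halfplane:
  assumes a: "a \<ge> 1" "q > 0"
  shows "\<exists>F. F meromorphic_on {s. Re s > 1 - real K} \<and> (\<forall>s. Re s > 1 \<longrightarrow> F s = arith_series a q s)"
proof (induction K)
  case 0
  have "arith_series a q meromorphic_on {s. Re s > 1}"
    by (intro analytic_on_imp_meromorphic_on)
       (use arith_series(1)[OF a] in \<open>simp add: analytic_on_open open_halfspace_Re_gt\<close>)
  thus ?case by (intro exI[of _ "arith_series a q"]) auto
next
  case (Suc K)
  then obtain F where F: "F meromorphic_on {s. Re s > 1 - real K}"
    and F_eq: "\<And>s. Re s > 1 \<Longrightarrow> F s = arith_series a q s" by blast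
  define m where "m = Suc K"
  define R where "R = (\<lambda>s. \<Sum>n. taylor_rem m q (a + real n * q) s)"
  define H where "H = {s. Re s > - real K}"
  have opH: "open H" unfolding H_def by (rule open_halfspace_Re_gt)
  have "R holomorphic_on {s. Re s > - real K}"
    unfolding R_def
  proof (rule holomorphic_suminf_halfplane(1)[OF _ _ _ a])
    fix n s
    have u: "a + real n * q \<ge> 1" by (rule arith_pos[OF a])
    show "taylor_rem m q (a + real n * q) holomorphic_on {s. Re s > - real K}"
      using u a by (intro taylor_rem_holomorphic) linarith+
    assume "Re s > - real K"
    hence "norm (taylor_rem m q (a + real n * q) s) \<le>
        norm (fallfact (1 - s) (Suc m)) * q ^ Suc m / fact m * (a + real n * q) powr (- (Re s + real m))"
      by (intro taylor_rem_bound u a) (auto simp: m_def)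
    thus "norm (taylor_rem m q (a + real n * q) s) \<le>
        norm (fallfact (1 - s) (Suc m)) * q ^ Suc m / fact m * (a + real n * q) powr (- (Re s - - real K + 1))"
      by (simp add: m_def algebra_simps)
  qed (auto simp: fallfact_def intro!: continuous_intros)
  hence R: "R meromorphic_on H"
    by (intro analytic_on_imp_meromorphic_on) (simp add: analytic_on_open opH H_def open_halfspace_Re_gt)
  define G where "G = (\<lambda>s. (of_real a powr (1 - s) + 
      (\<Sum>i=2..m. fallfact (1 - s) i * of_real q ^ i / fact i * F (s + of_nat i - 1)) + R s) / ((s - 1) * of_real q))"
  have "G meromorphic_on H"
    unfolding G_def
  proof (intro meromorphic_intros R)
    show "(\<lambda>s. of_real a powr (1 - s)) meromorphic_on H"
      using a by (intro analytic_on_imp_meromorphic_on analytic_intros) (auto simp: complex_nonpos_Reals_iff)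
    show "(\<lambda>s. fallfact (1 - s) i) meromorphic_on H" for i
      unfolding fallfact_def by (intro meromorphic_intros)
    show "(\<lambda>s. F (s + of_nat i - 1)) meromorphic_on H" if "i \<in> {2..m}" for i
      by (rule meromorphic_on_compose[OF F])
         (use that in \<open>auto simp: H_def intro!: analytic_intros\<close>)
  qed
  moreover have "G s = arith_series a q s" if s: "Re s > 1" for s
  proof -
    define c where "c = (\<lambda>i. fallfact (1 - s) i * of_real q ^ i / fact i)"
    have "{1..m} = insert 1 {2..m}" by (auto simp: m_def)
    hence 1: "(\<Sum>i=1..m. c i * arith_series a q (s + of_nat i - 1)) = 
       c 1 * arith_series a q s + (\<Sum>i=2..m. c i * arith_series a q (s + of_nat i - 1))"
      by simp
    have 2: "(\<Sum>i=2..m. c i * arith_series a q (s + of_nat i - 1)) = (\<Sum>i=2..m. c i * F (s + of_nat i - 1))"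
      using s by (intro sum.cong) (auto simp: F_eq)
    have "of_real a powr (1 - s) = - (\<Sum>i=1..m. c i * arith_series a q (s + of_nat i - 1)) - R s"
      unfolding c_def R_def by (rule arith_series_rec[OF a s]) (simp add: m_def)
    hence "of_real a powr (1 - s) + (\<Sum>i=2..m. c i * F (s + of_nat i - 1)) + R s = (s - 1) * of_real q * arith_series a q s"
      unfolding 1 2 by (simp add: c_def fallfact_def algebra_simps)
    moreover have "(s - 1) * of_real q \<noteq> 0" using s a by auto
    ultimately show ?thesis unfolding G_def c_def by (simp add: field_simps)
  qed
  ultimately show ?case by (intro exI[of _ G]) (auto simp: H_def)
qed


lemma nicely_meromorphic_identity:
  assumes F: "F nicely_meromorphic_on A" and G: "G nicely_meromorphic_on A"
    and A: "open A" "connected A" and B: "open B" "B \<subseteq> A" "B \<noteq> {}"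
    and eq: "\<And>z. z \<in> B \<Longrightarrow> F z = G z" and z: "z \<in> A"
  shows "F z = G z"
proof -
  have "(\<lambda>w. F w - G w) meromorphic_on A"
    using F G by (intro meromorphic_intros) (auto simp: nicely_meromorphic_on_def)
  from meromorphic_imp_constant_or_avoid[OF this A, of 0]
  have "eventually (\<lambda>w. F w - G w = 0) (cosparse A)"
  proof
    assume *: "eventually (\<lambda>w. F w - G w \<noteq> 0) (cosparse A)"
    from B obtain b where b: "b \<in> B" by auto
    have "eventually (\<lambda>w. F w - G w \<noteq> 0) (at b)"
      using * b B by (auto simp: eventually_cosparse_open_eq A)
    moreover have "eventually (\<lambda>w. w \<in> B) (at b)"
      using b B by (intro eventually_at_in_open') auto
    ultimately have "eventually (\<lambda>w. False) (at b)"
      by eventually_elim (simp add: eq)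
    thus ?thesis by simp
  qed
  hence ev: "eventually (\<lambda>w. F w = G w) (at z)"
    using z by (auto simp: eventually_cosparse_open_eq A)
  have pole: "is_pole F z \<longleftrightarrow> is_pole G z"
    by (rule is_pole_cong[OF ev refl])
  have lim: "(F \<longlongrightarrow> l) (at z) \<longleftrightarrow> (G \<longlongrightarrow> l) (at z)" for l
    by (rule tendsto_cong[OF ev])
  from F G z have "is_pole F z \<and> F z = 0 \<or> (F \<longlongrightarrow> F z) (at z)" "is_pole G z \<and> G z = 0 \<or> (G \<longlongrightarrow> G z) (at z)"
    by (auto simp: nicely_meromorphic_on_def)
  thus ?thesis using pole lim
    by (metis LIM_unique is_pole_def not_tendsto_and_filterlim_at_infinity trivial_limit_at)
qed

lemma arith_series_meromorphic:
  assumes a: "a \<ge> 1" "q > 0"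
  shows "\<exists>F. F meromorphic_on UNIV \<and> (\<forall>s. Re s > 1 \<longrightarrow> F s = arith_series a q s)"
proof -
  define H where "H = (\<lambda>K. {s. Re s > 1 - real K})"
  have H: "open (H K)" "connected (H K)" for K
    unfolding H_def by (auto intro!: open_halfspace_Re_gt convex_connected convex_halfspace_Re_gt)
  have H0: "H 0 = {s. Re s > 1}" by (simp add: H_def)
  have "\<exists>F. F nicely_meromorphic_on H K \<and> (\<forall>s\<in>H 0. F s = arith_series a q s)" for K
  proof -
    obtain F where F: "F meromorphic_on H K" "\<And>s. s \<in> H 0 \<Longrightarrow> F s = arith_series a q s"
      using arith_series_meromorphic_halfplane[OF a, of K] unfolding H0 by (auto simp: H_def)
    have "remove_sings F s = arith_series a q s" if s: "s \<in> H 0" for s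
    proof -
      have "F holomorphic_on H 0 \<longleftrightarrow> arith_series a q holomorphic_on H 0"
        by (rule holomorphic_cong) (auto simp: F)
      hence "F analytic_on {s}"
        using arith_series(1)[OF a] s H(1)[of 0] by (auto simp: H0 intro: holomorphic_on_imp_analytic_at)
      hence "remove_sings F s = F s" by (rule remove_sings_at_analytic)
      thus ?thesis using F(2)[OF s] by simp
    qed
    thus ?thesis using remove_sings_nicely_meromorphic[OF F(1)] by blast
  qed
  then obtain F where F: "\<And>K. F K nicely_meromorphic_on H K"
    "\<And>K s. s \<in> H 0 \<Longrightarrow> F K s = arith_series a q s"
    by metis
  have mono: "H K \<subseteq> H L" if "K \<le> L" for K L using that by (auto simp: H_def)
  have eq': "F K s = F L s" if "K \<le> L" "s \<in> H K" for K L s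
  proof (rule nicely_meromorphic_identity[where F = "F K" and G = "F L" and A = "H K" and B = "H 0"])
    show "F L nicely_meromorphic_on H K"
      using F(1) mono[OF that(1)] by (rule nicely_meromorphic_on_subset)
    show "H 0 \<noteq> {}" by (auto simp: H0 intro!: exI[of _ 2])
  qed (use that H F mono in simp_all)
  have eq: "F K s = F L s" if "s \<in> H K" "s \<in> H L" for K L s
    using eq'[OF _ that(1), of L] eq'[OF _ that(2), of K] nat_le_linear[of K L] by metis
  define k where "k = (\<lambda>s. nat \<lceil>1 - Re s\<rceil> + 1)"
  have k: "s \<in> H (k s)" for s unfolding H_def k_def by (auto; linarith)
  define G where "G = (\<lambda>s. F (k s) s)"
  have G: "G s = F K s" if "s \<in> H K" for s K
    unfolding G_def by (rule eq[OF k that])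
  have "G meromorphic_on {s}" for s
  proof -
    have "F (k s) meromorphic_on {s}"
      using F(1)[of "k s"] k[of s] by (auto simp: nicely_meromorphic_on_def intro: meromorphic_on_subset)
    moreover have "eventually (\<lambda>w. G w = F (k s) w) (at s)"
      using eventually_at_in_open'[OF H(1) k, of s] by eventually_elim (simp add: G)
    ultimately show ?thesis by (subst meromorphic_on_cong[of _ G "F (k s)"]) auto
  qed
  hence "G meromorphic_on UNIV"
    using meromorphic_on_meromorphic_at by blast
  moreover have "G s = arith_series a q s" if "Re s > 1" for s
    using that G[of s 0] F(2)[of s 0] by (simp add: H0)
  ultimately show ?thesis by blast
qed

lemma periodic_mult: 
  assumes "\<And>n. a (n + q) = a n"
  shows "a (n * q + r) = a (r::nat)"
  using assms[of "_ * q + r"] by (induction n) (auto simp: add_ac)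

lemma periodic_dirichlet_series:
  fixes a :: "nat \<Rightarrow> complex"
  assumes q: "q > 0" and per: "\<And>n. a (n + q) = a n" and s: "Re s > 1"
  shows "(\<lambda>n. a (Suc n) / of_nat (Suc n) powr s) sums
    (\<Sum>r<q. a (Suc r) * arith_series (real (Suc r)) (real q) s)"
proof -
  define t where "t = (\<lambda>n. a (Suc n) / of_nat (Suc n) powr s)"
  have mod: "a n = a (n mod q)" for n
    using periodic_mult[of a q "n div q" "n mod q"] per by simp
  define B where "B = Max ((\<lambda>n. norm (a n)) ` {..<q})"
  have B: "norm (a n) \<le> B" for n
    unfolding B_def by (subst mod) (intro Max_ge; use q in auto)
  have norm: "norm (t n) \<le> B * (1 + real n * 1) powr (- Re s)" for n
  proof -
    have "norm (t n) = norm (a (Suc n)) * real (Suc n) powr (- Re s)"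
      unfolding t_def norm_divide by (subst norm_powr_real_powr) (auto simp: powr_minus divide_simps)
    also have "\<dots> \<le> B * real (Suc n) powr (- Re s)" by (intro mult_right_mono B) auto
    finally show ?thesis by (simp add: add_ac)
  qed
  have "summable t"
    by (rule summable_comparison_test[OF _ summable_mult[OF summable_arith_powr[of 1 1 "Re s"]]])
       (use norm s in auto)
  hence t: "t sums suminf t" by (rule summable_sums)
  from sums_group[OF t q] have "(\<lambda>n. sum t {n * q..<n * q + q}) sums suminf t" .
  also have "(\<lambda>n. sum t {n * q..<n * q + q}) =
     (\<lambda>n. \<Sum>r<q. a (Suc r) * of_real (real (Suc r) + real n * real q) powr (-s))"
  proof
    fix n
    have "sum t {n * q..<n * q + q} = (\<Sum>r<q. t (r + n * q))"
      using sum.shift_bounds_nat_ivl[of t 0 "n * q" q] by (simp add: add_ac lessThan_atLeast0)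
    also have "\<dots> = (\<Sum>r<q. a (Suc r) * of_real (real (Suc r) + real n * real q) powr (-s))"
    proof (rule sum.cong[OF refl])
      fix r
      have "a (Suc (r + n * q)) = a (Suc r)"
        using periodic_mult[of a q n "Suc r"] per by (simp add: add_ac)
      thus "t (r + n * q) = a (Suc r) * of_real (real (Suc r) + real n * real q) powr (-s)"
        by (simp add: t_def powr_minus divide_inverse add_ac)
    qed
    finally show "sum t {n * q..<n * q + q} = \<dots>" .
  qed
  finally have 1: "(\<lambda>n. \<Sum>r<q. a (Suc r) * of_real (real (Suc r) + real n * real q) powr (-s)) sums suminf t" .
  have 2: "(\<lambda>n. \<Sum>r<q. a (Suc r) * of_real (real (Suc r) + real n * real q) powr (-s)) sums
     (\<Sum>r<q. a (Suc r) * arith_series (real (Suc r)) (real q) s)"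
    by (intro sums_sum sums_mult arith_series) (use q s in auto)
  show ?thesis using t sums_unique2[OF 1 2] by (simp add: t_def)
qed

lemma ex1_dirichlet_L:
  fixes a :: "nat \<Rightarrow> complex"
  assumes q: "q > 0" and per: "\<And>n. a (n + q) = a n"
  shows "\<exists>!F. is_dirichlet_L a F"
proof -
  define D where "D = (\<lambda>s. \<Sum>r<q. a (Suc r) * arith_series (real (Suc r)) (real q) s)"
  have "\<exists>F. F meromorphic_on UNIV \<and> (\<forall>s. Re s > 1 \<longrightarrow> F s = arith_series (real (Suc r)) (real q) s)" for r
    by (rule arith_series_meromorphic) (use q in auto)
  then obtain F where F: "\<And>r. F r meromorphic_on UNIV"
    "\<And>r s. Re s > 1 \<Longrightarrow> F r s = arith_series (real (Suc r)) (real q) s" by metis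
  define G where "G = (\<lambda>s. \<Sum>r<q. a (Suc r) * F r s)"
  have G: "G meromorphic_on UNIV" unfolding G_def by (intro meromorphic_intros F)
  have GD: "G s = D s" if "Re s > 1" for s
    using that by (simp add: G_def D_def F(2))
  have "D holomorphic_on {s. Re s > 1}"
    unfolding D_def by (intro holomorphic_intros arith_series) (use q in auto)
  hence "G holomorphic_on {s. Re s > 1}"
    by (subst holomorphic_cong[OF refl, of _ _ D]) (auto simp: GD)
  hence "G analytic_on {s}" if "Re s > 1" for s
    using that by (auto intro!: holomorphic_on_imp_analytic_at open_halfspace_Re_gt)
  hence "remove_sings G s = D s" if "Re s > 1" for s
    using that GD by (simp add: remove_sings_at_analytic)
  hence ex: "is_dirichlet_L a (remove_sings G)"
    using periodic_dirichlet_series[of q a, OF q per] remove_sings_nicely_meromorphic[OF G]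
    by (auto simp: is_dirichlet_L_def D_def)
  have "F1 = F2" if "is_dirichlet_L a F1" "is_dirichlet_L a F2" for F1 F2
  proof
    fix z
    show "F1 z = F2 z"
      by (rule nicely_meromorphic_identity[where F = F1 and G = F2 and A = UNIV and B = "{s. Re s > 1}"])
         (use that in \<open>auto simp: is_dirichlet_L_def open_halfspace_Re_gt
            intro: sums_unique2 intro!: exI[of _ 2]\<close>)
  qed
  thus ?thesis using ex by blast
qed

lemma is_dirichlet_L_zeta: "is_dirichlet_L (\<lambda>_. 1) zeta"
  unfolding zeta_def dirichlet_L_def
  using theI'[OF ex1_dirichlet_L[of 1 "\<lambda>_. 1"]] by simp

lemma finite_nontrivial_zeros_zeta:
  "finite {\<rho>. \<rho> \<in> nontrivial_zeros zeta \<and> 0 < Im \<rho> \<and> Im \<rho> \<le> X}"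
proof -
  have nm: "zeta nicely_meromorphic_on UNIV"
    and s: "\<And>s. Re s > 1 \<Longrightarrow> (\<lambda>n. 1 / of_nat (Suc n) powr s) sums zeta s"
    using is_dirichlet_L_zeta unfolding is_dirichlet_L_def by blast+
  have s2: "(\<lambda>n. 1 / of_nat (Suc n) powr 2) sums zeta 2" by (rule s) simp
  have "(\<lambda>n. Re (1 / of_nat (Suc n) powr 2)) sums Re (zeta 2)"
    by (rule sums_Re[OF s2])
  also have "(\<lambda>n. Re (1 / of_nat (Suc n) powr 2)) = (\<lambda>n. 1 / real (Suc n) ^ 2)"
  proof
    fix n
    have "(1 :: complex) / of_nat (Suc n) powr 2 = of_real (1 / real (Suc n) ^ 2)"
      by (simp del: of_nat_Suc)
    thus "Re (1 / of_nat (Suc n) powr 2) = 1 / real (Suc n) ^ 2" by (simp only: Re_complex_of_real)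
  qed
  finally have r: "(\<lambda>n. 1 / real (Suc n) ^ 2) sums Re (zeta 2)" .
  have "0 < (\<Sum>n. 1 / real (Suc n) ^ 2)"
    by (rule suminf_pos[OF sums_summable[OF r]]) auto
  hence "zeta 2 \<noteq> 0" using sums_unique[OF r] by auto
  hence "eventually (\<lambda>s. zeta s \<noteq> 0) (cosparse UNIV)"
    using nicely_meromorphic_imp_constant_or_avoid[OF nm, of 0] by auto
  hence "{s. zeta s = 0} sparse_in UNIV" by (simp add: eventually_cosparse)
  hence "{s. zeta s = 0} sparse_in cbox 0 (Complex 1 X)"
    by (rule sparse_in_subset) auto
  hence "finite (cbox 0 (Complex 1 X) \<inter> {s. zeta s = 0})"
    by (intro sparse_in_compact_finite) auto
  thus ?thesis
    by (rule rev_finite_subset) (auto simp: nontrivial_zeros_def in_cbox_complex_iff)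
qed


end

(*
  Partial summation in both variables turns the double sum into one over the products of
  A(n) = sum of Lambda(k) chi(k) over k <= n and M(m) = sum of mu(k) over k <= m, weighted by
  second differences of f. Under GRH both A and M have size about the square root of the length.
  As f only has smoothness delta < 2, it is first replaced by an average over a window of
  length about N^(-1/2); the error, estimated trivially, costs N^(2 - delta/2), and so does the main
  part. With at most totient(q) characters for each q <= N^theta this suffices, because
  theta + epsilon <= delta/2 - epsilon.

  For the bounds on A and M, partial summation continues L(s, chi) and
  (s - 1) zeta(s) to Re s > 0 with polynomial growth. Landau's positivity argument excludes zeros on
  Re s = 1, about which GRH is silent. Borel-Caratheodory then bounds log L, hence L'/L, and together with a
  weak three circles theorem 1/zeta. Perron's formula with a trapezoidal weight of slope 1/sqrt x, so that the
  kernel is absolutely integrable, transfers these bounds to A and M.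
*)
theory Submission
  imports Defs
begin

section \<open>Smoothing and double summation by parts\<close>

text \<open>Partial summation with \<open>f\<close> itself would not suffice: its second differences
  at distance \<open>1 / N\<close> have size \<open>N powr (-\<delta>)\<close>, the two square roots
  contribute a factor of about N, and there are about N^2 pairs. This yields about
  \<open>N powr (3 - \<delta>)\<close>, which at \<delta> = 1 is no better than the trivial bound.
  Averaging over H integers replaces the second differences by E / H^2, where E has size
  \<open>(H / N) powr \<delta>\<close>. The main part N^2 * E * N / H^2 and the replacement error
  N^2 * E then agree exactly when H^2 is about N.

  The estimates must be uniform in the character. The modulus enters L'/L only through a logarithm,
  which is weakened to \<open>q powr \<eta>\<close> and absorbed because q is at most N.

  The Mertens function is harder than the twisted Chebyshev sum. A bound of log zeta by a large
  constant times log t is good enough for L'/L, but after exponentiation it gives a fixed power of t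
  for 1/zeta, where an arbitrarily small power is required. This is why only 1/zeta calls for a
  second circle. Everything takes place to the right of Re s = 1/2, so no functional equation
  enters.\<close>

lemma zygmund_second_difference:
  assumes "zygmund_norm f < \<infinity>"
  shows "\<exists>K\<ge>0. \<forall>x h. norm (f (x + h) - 2 * f x + f (x - h)) \<le> K * \<bar>h\<bar>"
proof -
  define Z where "Z = (SUP x. SUP h\<in>-{0}. ennreal (norm (forward_diff 2 h f x) / \<bar>h\<bar>))"
  have "Z < \<infinity>"
    using assms unfolding zygmund_norm_def Z_def by (simp add: ennreal_add_eq_top less_top)
  then obtain K where K: "K \<ge> 0" "Z = ennreal K"
    by (metis ennreal_cases infinity_ennreal_def less_irrefl)
  have "norm (f (x + h) - 2 * f x + f (x - h)) \<le> K * \<bar>h\<bar>" for x h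
  proof (cases "h = 0")
    case False
    have "ennreal (norm (forward_diff 2 h f (x - h)) / \<bar>h\<bar>) \<le> Z"
      unfolding Z_def using False by (intro SUP_upper2[of "x - h"] SUP_upper2[of h]) auto
    hence "norm (forward_diff 2 h f (x - h)) / \<bar>h\<bar> \<le> K"
      using K by (simp add: ennreal_le_iff)
    moreover have "forward_diff 2 h f (x - h) = f (x + h) - 2 * f x + f (x - h)"
      by (simp add: forward_diff_def numeral_2_eq_2 algebra_simps)
    ultimately show ?thesis using False by (simp add: field_simps)
  qed simp
  thus ?thesis using K by blast
qed

lemma hoelder_first_difference:
  assumes "hoelder_norm s f < \<infinity>"
  shows "\<exists>K\<ge>0. \<forall>x h. norm (f (x + h) - f x) \<le> K * \<bar>h\<bar> powr s"
proof -
  define Z where "Z = (SUP x. SUP h\<in>-{0}. ennreal (norm (forward_diff 1 h f x) / \<bar>h\<bar> powr s))"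
  have "Z < \<infinity>"
    using assms unfolding hoelder_norm_def Z_def by (simp add: ennreal_add_eq_top less_top)
  then obtain K where K: "K \<ge> 0" "Z = ennreal K"
    by (metis ennreal_cases infinity_ennreal_def less_irrefl)
  have "norm (f (x + h) - f x) \<le> K * \<bar>h\<bar> powr s" for x h
  proof (cases "h = 0")
    case False
    have "ennreal (norm (forward_diff 1 h f x) / \<bar>h\<bar> powr s) \<le> Z"
      unfolding Z_def using False by (intro SUP_upper2[of x] SUP_upper2[of h]) auto
    hence "norm (forward_diff 1 h f x) / \<bar>h\<bar> powr s \<le> K"
      using K by (simp add: ennreal_le_iff)
    moreover have "forward_diff 1 h f x = f (x + h) - f x"
      by (simp add: forward_diff_def)
    ultimately show ?thesis using False by (simp add: pos_divide_le_eq)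
  qed simp
  thus ?thesis using K by blast
qed

text \<open>For \<open>\<delta> > 1\<close> the second difference is \<open>g x - g (x - h)\<close>
  with \<open>g u = f (u + h) - f u\<close>. The derivative of \<open>g\<close> is an increment of
  \<open>f'\<close>, of size \<open>\<bar>h\<bar> powr (\<delta> - 1)\<close>, and the mean value
  inequality supplies the missing factor \<open>\<bar>h\<bar>\<close>. The Zygmund case is separate
  because \<open>f'\<close> need not exist there.\<close>

lemma hoelder_zygmund_second_difference:
  assumes f: "f \<in> hoelder_zygmund \<delta>" and \<delta>: "1 \<le> \<delta>" "\<delta> < 2"
  shows "\<exists>K\<ge>0. \<forall>x h. norm (f (x + h) - 2 * f x + f (x - h)) \<le> K * \<bar>h\<bar> powr \<delta>"
proof (cases "\<delta> = 1")
  case True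
  thus ?thesis using zygmund_second_difference[of f] f by (auto simp: hoelder_zygmund_def)
next
  case False
  define f' where "f' = (\<lambda>x. vector_derivative f (at x))"
  have C1: "f C1_differentiable_on UNIV" and "hoelder_norm (\<delta> - 1) f' < \<infinity>"
    using f False unfolding hoelder_zygmund_def f'_def by (auto simp: ennreal_add_eq_top less_top)
  then obtain K where K: "K \<ge> 0" "\<And>x h. norm (f' (x + h) - f' x) \<le> K * \<bar>h\<bar> powr (\<delta> - 1)"
    using hoelder_first_difference by blast
  have der: "(f has_vector_derivative f' x) (at x)" for x
    using C1 unfolding f'_def C1_differentiable_on_eq by (simp add: vector_derivative_works)
  have "norm (f (x + h) - 2 * f x + f (x - h)) \<le> K * \<bar>h\<bar> powr \<delta>" for x h
  proof -
    define g where "g = (\<lambda>u. f (u + h) - f u)"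
    have dg: "(g has_derivative (\<lambda>t. t *\<^sub>R (f' (u + h) - f' u))) (at u within UNIV)" for u
    proof -
      have "((\<lambda>u. f (u + h)) has_vector_derivative f' (u + h)) (at u)"
        using vector_diff_chain_at[of "\<lambda>u. u + h" 1 u f "f' (u + h)"] der[of "u + h"] DERIV_ident
        by (simp add: o_def has_real_derivative_iff_has_vector_derivative[symmetric] DERIV_shift[of "\<lambda>x. x", symmetric])
      hence "(g has_vector_derivative (f' (u + h) - f' u)) (at u)"
        unfolding g_def by (intro has_vector_derivative_diff der)
      thus ?thesis by (simp add: has_vector_derivative_def)
    qed
    have on: "onorm (\<lambda>t. t *\<^sub>R (f' (u + h) - f' u)) \<le> K * \<bar>h\<bar> powr (\<delta> - 1)" for u
      by (rule onorm_le) (use mult_left_mono[OF K(2)[of u h], of "\<bar>_\<bar>"] in \<open>simp add: mult_ac\<close>)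
    have "norm (g x - g (x - h)) \<le> K * \<bar>h\<bar> powr (\<delta> - 1) * norm (x - (x - h))"
      by (rule differentiable_bound[OF convex_UNIV dg on]) auto
    also have "\<dots> = K * \<bar>h\<bar> powr \<delta>"
      by (cases "h = 0") (auto simp: powr_diff)
    finally show ?thesis by (simp add: g_def algebra_simps)
  qed
  thus ?thesis using K by blast
qed

text \<open>Convolution with the normalised triangular (Fejer) weight on the differences
  \<open>i - j\<close>. The weight is even, so the error only sees symmetric second differences; as
  a double average it lets a second difference telescope twice.\<close>

definition smoothing :: "nat \<Rightarrow> (int \<Rightarrow> complex) \<Rightarrow> int \<Rightarrow> complex" where
  "smoothing H g k = (\<Sum>i<H. \<Sum>j<H. g (k + int i - int j)) / of_nat H ^ 2"

text \<open>Exchanging the roles of \<open>i\<close> and \<open>j\<close> leaves the average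
  unchanged. Adding both versions expresses twice the error as an average of second differences of
  \<open>g\<close> at \<open>k\<close> with steps \<open>i - j\<close>.\<close>

lemma smoothing_close:
  assumes "H > 0" and E: "\<And>j. \<bar>j\<bar> \<le> int H \<Longrightarrow> norm (g (k + j) - 2 * g k + g (k - j)) \<le> E"
  shows "norm (smoothing H g k - g k) \<le> E"
proof -
  define S where "S = (\<Sum>i<H. \<Sum>j<H. g (k + int i - int j))"
  have "S = (\<Sum>i<H. \<Sum>j<H. g (k + int j - int i))"
    unfolding S_def by (rule sum.swap)
  hence "2 * (S - of_nat H ^ 2 * g k) =
      (\<Sum>i<H. \<Sum>j<H. g (k + int i - int j)) + (\<Sum>i<H. \<Sum>j<H. g (k + int j - int i)) - (\<Sum>i<H. \<Sum>j<H. 2 * g k)"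
    by (simp add: S_def power2_eq_square)
  also have "\<dots> = (\<Sum>i<H. \<Sum>j<H. g (k + (int i - int j)) - 2 * g k + g (k - (int i - int j)))"
    by (simp add: sum.distrib sum_subtractf algebra_simps)
  also have "norm \<dots> \<le> (\<Sum>i<H. \<Sum>j<H. E)"
    by (intro sum_norm_le E) auto
  finally have 1: "norm (2 * (S - of_nat H ^ 2 * g k)) \<le> real H ^ 2 * E" by (simp add: power2_eq_square)
  have "0 \<le> E" using E[of 0] by simp
  have "smoothing H g k - g k = (S - of_nat H ^ 2 * g k) / of_nat H ^ 2"
    using assms(1) by (simp add: smoothing_def S_def field_simps)
  also have "norm \<dots> = norm (2 * (S - of_nat H ^ 2 * g k)) / (2 * real H ^ 2)"
    by (simp only: norm_divide norm_mult norm_power) simp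
  also have "\<dots> \<le> (real H ^ 2 * E) / (2 * real H ^ 2)" by (intro divide_right_mono 1) auto
  also have "\<dots> \<le> E" using assms(1) \<open>0 \<le> E\<close> by (simp add: field_simps)
  finally show ?thesis .
qed

text \<open>Each of the two sums telescopes one unit difference into a difference of length
  \<open>H\<close>. A second difference with step 1 thus becomes one with step \<open>H\<close>, and
  the normalisation gains \<open>H ^ 2\<close>.\<close>

lemma smoothing_second_difference:
  assumes "H > 0"
  shows "smoothing H g k - 2 * smoothing H g (k + 1) + smoothing H g (k + 2) =
     (g (k + 1 + int H) - 2 * g (k + 1) + g (k + 1 - int H)) / of_nat H ^ 2"
proof -
  define T where "T = (\<lambda>k. \<Sum>j<H. g (k - int j))"
  define S where "S = (\<lambda>k. \<Sum>i<H. T (k + int i))"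
  have tele: "(\<Sum>i<H. u (k + 1 + int i)) - (\<Sum>i<H. u (k + int i)) = u (k + int H) - u k"
    for u :: "int \<Rightarrow> complex" and k
    using sum_lessThan_telescope[of "\<lambda>i. u (k + int i)" H] by (simp add: sum_subtractf add_ac)
  have S1: "S (k + 1) - S k = T (k + int H) - T k" for k
    unfolding S_def by (rule tele)
  have T1: "T (k + 1) - T k = g (k + 1) - g (k + 1 - int H)" for k
    using sum_lessThan_telescope'[of "\<lambda>i. g (k + 1 - int i)" H]
    by (simp add: T_def sum_subtractf algebra_simps)
  have "S k - 2 * S (k + 1) + S (k + 2) = (S (k + 1 + 1) - S (k + 1)) - (S (k + 1) - S k)"
    by (simp add: algebra_simps)
  also have "\<dots> = (T (k + int H + 1) - T (k + int H)) - (T (k + 1) - T k)"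
    unfolding S1 by (simp add: algebra_simps)
  also have "\<dots> = g (k + 1 + int H) - 2 * g (k + 1) + g (k + 1 - int H)"
    unfolding T1 by (simp add: algebra_simps)
  finally have eq: "S k - 2 * S (k + 1) + S (k + 2) = g (k + 1 + int H) - 2 * g (k + 1) + g (k + 1 - int H)" .
  have sm: "smoothing H g k = S k / of_nat H ^ 2" for k
    by (simp add: smoothing_def S_def T_def)
  show ?thesis unfolding sm eq[symmetric] by (simp add: add_divide_distrib diff_divide_distrib)
qed

lemma summation_by_parts:
  fixes a u :: "nat \<Rightarrow> complex"
  assumes "u (Suc L) = 0"
  shows "(\<Sum>n=1..L. a n * u n) = (\<Sum>n=1..L. (\<Sum>k=1..n. a k) * (u n - u (Suc n)))"
proof -
  have "(\<Sum>n=1..L. a n * u n) = (\<Sum>n=1..L. (\<Sum>k=1..n. a k) * (u n - u (Suc n))) + (\<Sum>k=1..L. a k) * u (Suc L)"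
    by (induction L) (auto simp: algebra_simps)
  thus ?thesis using assms by simp
qed

text \<open>Split \<open>g\<close> into \<open>g - G\<close> and its average \<open>G\<close>. The
  first part is estimated term by term. In the second, summation by parts is done once in each
  variable; as \<open>G\<close> is evaluated at \<open>n + m\<close>, the mixed difference is an
  ordinary second difference with step 1, which the averaging made smaller by
  \<open>H ^ 2\<close>.\<close>

lemma bilinear_form_bound:
  fixes a b :: "nat \<Rightarrow> complex" and g :: "int \<Rightarrow> complex"
  assumes H: "H > 0"
    and E: "\<And>k j. \<bar>j\<bar> \<le> int H \<Longrightarrow> norm (g (k + j) - 2 * g k + g (k - j)) \<le> E"
    and g: "\<And>k. k \<ge> int M \<Longrightarrow> g k = 0"
    and A: "\<And>n. n \<le> M + H \<Longrightarrow> norm (\<Sum>k=1..n. a k) \<le> \<alpha>"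
    and B: "\<And>n. n \<le> M + H \<Longrightarrow> norm (\<Sum>k=1..n. b k) \<le> \<beta>"
    and a: "\<And>n. n \<in> {1..M+H} \<Longrightarrow> norm (a n) \<le> a0" and b: "\<And>n. n \<in> {1..M+H} \<Longrightarrow> norm (b n) \<le> b0"
  shows "norm (\<Sum>n=1..M+H. \<Sum>m=1..M+H. a n * b m * g (int n + int m)) \<le>
     real (M + H) ^ 2 * (E * a0 * b0 + E * \<alpha> * \<beta> / real H ^ 2)"
proof -
  \<comment> \<open>Averaging enlarges the support to the right by less than \<open>H\<close>, so
    with this length all boundary terms of the summations by parts vanish.\<close>
  define L where "L = M + H"
  define G where "G = smoothing H g"
  have E0: "E \<ge> 0" using E[of 0 0] by simp
  have \<alpha>0: "\<alpha> \<ge> 0" and \<beta>0: "\<beta> \<ge> 0" using A[of 0] B[of 0] by simp_all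
  have a0: "a0 \<ge> 0" using order.trans[OF norm_ge_zero a[of 1]] H by auto
  have b0: "b0 \<ge> 0" using order.trans[OF norm_ge_zero b[of 1]] H by auto
  have G0: "G k = 0" if "k \<ge> int L" for k
    unfolding G_def smoothing_def using that g by (auto simp: L_def intro!: sum.neutral)
  have close: "norm (g k - G k) \<le> E" for k
    using smoothing_close[OF H E] unfolding G_def by (subst norm_minus_commute) blast
  have G2: "norm (G k - 2 * G (k + 1) + G (k + 2)) \<le> E / real H ^ 2" for k
    unfolding G_def smoothing_second_difference[OF H] norm_divide norm_power norm_of_nat
    by (intro divide_right_mono E) auto
  define u where "u = (\<lambda>n. \<Sum>m=1..L. b m * G (int n + int m))"
  have "(\<Sum>n=1..L. \<Sum>m=1..L. a n * b m * G (int n + int m)) = (\<Sum>n=1..L. a n * u n)"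
    by (simp add: u_def sum_distrib_left mult_ac)
  also have "\<dots> = (\<Sum>n=1..L. (\<Sum>k=1..n. a k) * (u n - u (Suc n)))"
    by (rule summation_by_parts) (auto simp: u_def intro!: sum.neutral G0)
  also have "\<dots> = (\<Sum>n=1..L. \<Sum>m=1..L. (\<Sum>k=1..n. a k) * ((\<Sum>k=1..m. b k) *
      (G (int n + int m) - 2 * G (int n + int m + 1) + G (int n + int m + 2))))"
  proof (rule sum.cong[OF refl])
    fix n
    have "u n - u (Suc n) = (\<Sum>m=1..L. b m * (G (int n + int m) - G (int n + int m + 1)))"
      by (simp add: u_def sum_subtractf[symmetric] algebra_simps)
    also have "\<dots> = (\<Sum>m=1..L. (\<Sum>k=1..m. b k) *
      (G (int n + int m) - G (int n + int m + 1) - (G (int n + int (Suc m)) - G (int n + int (Suc m) + 1))))"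
      by (rule summation_by_parts) (auto simp: G0)
    also have "\<dots> = (\<Sum>m=1..L. (\<Sum>k=1..m. b k) *
      (G (int n + int m) - 2 * G (int n + int m + 1) + G (int n + int m + 2)))"
      by (intro sum.cong refl) (simp add: algebra_simps)
    finally show "(\<Sum>k=1..n. a k) * (u n - u (Suc n)) = (\<Sum>m=1..L. (\<Sum>k=1..n. a k) * ((\<Sum>k=1..m. b k) *
      (G (int n + int m) - 2 * G (int n + int m + 1) + G (int n + int m + 2))))"
      by (simp only: sum_distrib_left)
  qed
  also have "norm \<dots> \<le> (\<Sum>n=1..L. \<Sum>m=1..L. \<alpha> * (\<beta> * (E / real H ^ 2)))"
  proof (intro sum_norm_le)
    fix n m assume "n \<in> {1..L}" "m \<in> {1..L}"
    thus "norm ((\<Sum>k=1..n. a k) * ((\<Sum>k=1..m. b k) *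
      (G (int n + int m) - 2 * G (int n + int m + 1) + G (int n + int m + 2)))) \<le> \<alpha> * (\<beta> * (E / real H ^ 2))"
      unfolding norm_mult L_def by (intro mult_mono A B G2 \<alpha>0 \<beta>0) auto
  qed
  finally have 1: "norm (\<Sum>n=1..L. \<Sum>m=1..L. a n * b m * G (int n + int m)) \<le> real L ^ 2 * (E * \<alpha> * \<beta> / real H ^ 2)"
    by (simp add: power2_eq_square mult_ac)
  have "norm (\<Sum>n=1..L. \<Sum>m=1..L. a n * b m * (g (int n + int m) - G (int n + int m))) \<le>
      (\<Sum>n=1..L. \<Sum>m=1..L. a0 * b0 * E)"
    unfolding norm_mult
  proof (intro sum_norm_le)
    fix n m assume "n \<in> {1..L}" "m \<in> {1..L}"
    thus "norm (a n * b m * (g (int n + int m) - G (int n + int m))) \<le> a0 * b0 * E"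
      unfolding norm_mult L_def by (intro mult_mono a b close mult_nonneg_nonneg a0 b0) auto
  qed
  hence 2: "norm (\<Sum>n=1..L. \<Sum>m=1..L. a n * b m * (g (int n + int m) - G (int n + int m))) \<le> real L ^ 2 * (E * a0 * b0)"
    by (simp add: power2_eq_square mult_ac)
  have "(\<Sum>n=1..L. \<Sum>m=1..L. a n * b m * g (int n + int m)) =
     (\<Sum>n=1..L. \<Sum>m=1..L. a n * b m * (g (int n + int m) - G (int n + int m))) +
     (\<Sum>n=1..L. \<Sum>m=1..L. a n * b m * G (int n + int m))"
    unfolding sum.distrib[symmetric] by (intro sum.cong refl) (simp add: algebra_simps)
  also have "norm \<dots> \<le> real L ^ 2 * (E * a0 * b0) + real L ^ 2 * (E * \<alpha> * \<beta> / real H ^ 2)"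
    by (rule norm_triangle_le[OF add_mono[OF 2 1]])
  finally show ?thesis by (simp add: L_def algebra_simps)
qed

section \<open>The Perron kernel\<close>

text \<open>The Mellin kernel of the Cesaro weight \<open>max 0 (1 - 1 / y)\<close>: its residues at
  0 and -1 are 1 and \<open>- 1 / y\<close>. The quadratic decay makes vertical integrals absolutely
  convergent.\<close>

definition perron_integrand :: "real \<Rightarrow> complex \<Rightarrow> complex" where
  "perron_integrand y s = of_real y powr s / (s * (s + 1))"

section \<open>Rectangular contours and the truncated Perron formula\<close>

lemma rectpath_contour_integral:
  assumes f: "continuous_on (path_image (rectpath (Complex a c) (Complex b d))) f"
    and int: "(f has_contour_integral I) (rectpath (Complex a c) (Complex b d))"
  shows "I = contour_integral (linepath (Complex a c) (Complex b c)) f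
       + contour_integral (linepath (Complex b c) (Complex b d)) f
       + contour_integral (linepath (Complex b d) (Complex a d)) f
       + contour_integral (linepath (Complex a d) (Complex a c)) f"
proof -
  have path: "rectpath (Complex a c) (Complex b d) = linepath (Complex a c) (Complex b c) +++
     linepath (Complex b c) (Complex b d) +++ linepath (Complex b d) (Complex a d) +++
     linepath (Complex a d) (Complex a c)"
    by (simp add: rectpath_def Let_def)
  have img: "path_image (rectpath (Complex a c) (Complex b d)) =
      closed_segment (Complex a c) (Complex b c) \<union> (closed_segment (Complex b c) (Complex b d) \<union>
      (closed_segment (Complex b d) (Complex a d) \<union> closed_segment (Complex a d) (Complex a c)))"
    unfolding path by (simp add: path_image_join)
  have c: "f contour_integrable_on linepath (Complex a c) (Complex b c)"
    "f contour_integrable_on linepath (Complex b c) (Complex b d)"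
    "f contour_integrable_on linepath (Complex b d) (Complex a d)"
    "f contour_integrable_on linepath (Complex a d) (Complex a c)"
    by (intro contour_integrable_continuous_linepath continuous_on_subset[OF f]; auto simp: img)+
  have "I = contour_integral (rectpath (Complex a c) (Complex b d)) f"
    using int by (simp add: contour_integral_unique)
  thus ?thesis unfolding path using c by (simp add: contour_integrable_join contour_integral_join valid_path_join)
qed

lemma path_image_rectpath_subset:
  assumes "a \<le> b" "c \<le> d" "z \<in> path_image (rectpath (Complex a c) (Complex b d))"
  shows "a \<le> Re z \<and> Re z \<le> b \<and> c \<le> Im z \<and> Im z \<le> d"
  using path_image_rectpath_subset_cbox[of "Complex a c" "Complex b d"] assms
  by (auto simp: in_cbox_complex_iff)

lemma norm_powr_le_of_Re_mono:
  assumes "y > 0" "y \<le> 1 \<and> \<sigma> \<le> Re s \<or> 1 \<le> y \<and> Re s \<le> \<sigma>"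
  shows "norm (of_real y powr s) \<le> y powr \<sigma>"
  using assms by (auto simp: norm_powr_real_powr powr_mono powr_mono')

lemma horizontal_in_segment:
  assumes "z \<in> closed_segment (Complex a c) (Complex b c)"
  shows "Im z = c \<and> min a b \<le> Re z \<and> Re z \<le> max a b"
proof (intro conjI)
  obtain u where u: "0 \<le> u" "u \<le> 1" "z = (1 - u) *\<^sub>R Complex a c + u *\<^sub>R Complex b c"
    using assms by (auto simp: in_segment)
  show "Im z = c" unfolding u(3) by (simp add: algebra_simps)
  have "Re z \<in> closed_segment a b" using u by (auto simp: in_segment)
  thus "min a b \<le> Re z" "Re z \<le> max a b" by (auto simp: closed_segment_eq_real_ivl split: if_splits)
qed

lemma vertical_in_segment:
  assumes "z \<in> closed_segment (Complex a c) (Complex a d)"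
  shows "Re z = a \<and> min c d \<le> Im z \<and> Im z \<le> max c d"
proof (intro conjI)
  obtain u where u: "0 \<le> u" "u \<le> 1" "z = (1 - u) *\<^sub>R Complex a c + u *\<^sub>R Complex a d"
    using assms by (auto simp: in_segment)
  show "Re z = a" unfolding u(3) by (simp add: algebra_simps)
  have "Im z \<in> closed_segment c d" using u by (auto simp: in_segment)
  thus "min c d \<le> Im z" "Im z \<le> max c d" by (auto simp: closed_segment_eq_real_ivl split: if_splits)
qed

lemma holomorphic_of_real_powr:
  "y > 0 \<Longrightarrow> (\<lambda>s. of_real y powr (f s)) holomorphic_on A" if "f holomorphic_on A" for y :: real
  using that by (intro holomorphic_intros) auto

text \<open>Serves both to close a vertical segment around poles, where \<open>I\<close> comes from
  the residues, and to shift a line of integration, where \<open>I = 0\<close>. In both cases the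
  horizontal sides are only an error of \<open>(b - a) * B\<close> each.\<close>

lemma rectangle_integral_bound:
  assumes ab: "a \<le> b" "c \<le> d"
    and cont: "continuous_on (path_image (rectpath (Complex a c) (Complex b d))) f"
    and int: "(f has_contour_integral I) (rectpath (Complex a c) (Complex b d))"
    and B: "\<And>s. a \<le> Re s \<Longrightarrow> Re s \<le> b \<Longrightarrow> Im s \<in> {c, d} \<Longrightarrow> norm (f s) \<le> B" and B0: "B \<ge> 0"
  shows "norm (contour_integral (linepath (Complex b c) (Complex b d)) f
     - contour_integral (linepath (Complex a c) (Complex a d)) f - I) \<le> 2 * (b - a) * B"
    and "(\<And>s. Re s = a \<Longrightarrow> c \<le> Im s \<Longrightarrow> Im s \<le> d \<Longrightarrow> norm (f s) \<le> B) \<Longrightarrow>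
      norm (contour_integral (linepath (Complex a c) (Complex a d)) f) \<le> (d - c) * B"
    and "(\<And>s. Re s = b \<Longrightarrow> c \<le> Im s \<Longrightarrow> Im s \<le> d \<Longrightarrow> norm (f s) \<le> B) \<Longrightarrow>
      norm (contour_integral (linepath (Complex b c) (Complex b d)) f) \<le> (d - c) * B"
proof -
  define J where "J = (\<lambda>u v. contour_integral (linepath u v) f)"
  have seg: "closed_segment u v \<subseteq> path_image (rectpath (Complex a c) (Complex b d))"
    if "(u, v) \<in> {(Complex a c, Complex b c), (Complex b c, Complex b d), (Complex b d, Complex a d), (Complex a d, Complex a c)}" for u v
    using that unfolding rectpath_def Let_def by (auto simp: path_image_join)
  have seg': "closed_segment (Complex a c) (Complex a d) \<subseteq> path_image (rectpath (Complex a c) (Complex b d))"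
    using seg[of "Complex a d" "Complex a c"] by (simp add: closed_segment_commute)
  have bound: "norm (J u v) \<le> B * norm (v - u)"
    if "closed_segment u v \<subseteq> path_image (rectpath (Complex a c) (Complex b d))" "\<And>s. s \<in> closed_segment u v \<Longrightarrow> norm (f s) \<le> B" for u v
    unfolding J_def by (intro contour_integral_bound_linepath contour_integrable_continuous_linepath continuous_on_subset[OF cont] that B0)
  have n: "norm (Complex b c - Complex a c) = b - a" "norm (Complex a d - Complex b d) = b - a"
    "norm (Complex b d - Complex b c) = d - c" "norm (Complex a d - Complex a c) = d - c"
    using ab by (auto simp: cmod_def)
  have "norm (J (Complex a c) (Complex b c)) \<le> B * norm (Complex b c - Complex a c)"
    by (rule bound[OF seg]) (use ab in \<open>auto dest!: horizontal_in_segment intro!: B\<close>)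
  moreover have "norm (J (Complex b d) (Complex a d)) \<le> B * norm (Complex a d - Complex b d)"
    by (rule bound[OF seg]) (use ab in \<open>auto dest!: horizontal_in_segment intro!: B\<close>)
  moreover have "I = J (Complex a c) (Complex b c) + J (Complex b c) (Complex b d) + J (Complex b d) (Complex a d) - J (Complex a c) (Complex a d)"
    using rectpath_contour_integral[OF cont int] contour_integral_reversepath[of "linepath (Complex a c) (Complex a d)" f]
    by (simp add: J_def)
  hence "J (Complex b c) (Complex b d) - J (Complex a c) (Complex a d) - I = - (J (Complex a c) (Complex b c) + J (Complex b d) (Complex a d))"
    by (simp add: algebra_simps)
  hence "norm (J (Complex b c) (Complex b d) - J (Complex a c) (Complex a d) - I) \<le> norm (J (Complex a c) (Complex b c)) + norm (J (Complex b d) (Complex a d))"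
    by (metis norm_minus_cancel norm_triangle_ineq)
  ultimately show "norm (contour_integral (linepath (Complex b c) (Complex b d)) f
     - contour_integral (linepath (Complex a c) (Complex a d)) f - I) \<le> 2 * (b - a) * B"
    unfolding n J_def by (simp add: algebra_simps)
  show "norm (contour_integral (linepath (Complex a c) (Complex a d)) f) \<le> (d - c) * B"
    if "\<And>s. Re s = a \<Longrightarrow> c \<le> Im s \<Longrightarrow> Im s \<le> d \<Longrightarrow> norm (f s) \<le> B"
    using bound[OF seg'] that ab unfolding n J_def by (force dest!: vertical_in_segment simp: mult.commute)
  show "norm (contour_integral (linepath (Complex b c) (Complex b d)) f) \<le> (d - c) * B"
    if "\<And>s. Re s = b \<Longrightarrow> c \<le> Im s \<Longrightarrow> Im s \<le> d \<Longrightarrow> norm (f s) \<le> B"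
    using bound[OF seg[of "Complex b c" "Complex b d"]] that ab unfolding n J_def by (force dest!: vertical_in_segment simp: mult.commute)
qed

text \<open>The alternative in the assumption selects the side of \<open>Re s = 2\<close> on which
  \<open>y powr s\<close> does not exceed \<open>y\<^sup>2\<close>. The value \<open>T - 2\<close>
  is the distance from 0 of the remote side \<open>Re s = 2 - T\<close>, the closest of all sides
  concerned.\<close>

lemma perron_integrand_bound:
  assumes y: "y > 0" "y \<le> 1 \<and> 2 \<le> Re s \<or> 1 \<le> y \<and> Re s \<le> 2" and T: "T \<ge> 6" "norm s \<ge> T - 2"
  shows "norm (perron_integrand y s) \<le> 8 * y\<^sup>2 / T\<^sup>2"
proof -
  have 1: "norm (of_real y powr s) \<le> y\<^sup>2"
    using norm_powr_le_of_Re_mono[of y 2 s] y by (simp add: powr_numeral)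
  have "norm (s + 1) \<ge> norm s - 1" using norm_triangle_ineq2[of s "-1"] by simp
  hence "T / 2 * (T / 4) \<le> norm s * norm (s + 1)" using T by (intro mult_mono) auto
  hence "norm (of_real y powr s) / (norm s * norm (s + 1)) \<le> y\<^sup>2 / (T\<^sup>2 / 8)"
    using 1 T y by (intro frac_le) (auto simp: power2_eq_square)
  thus ?thesis by (simp add: perron_integrand_def norm_divide norm_mult mult_ac)
qed

text \<open>For \<open>y \<ge> 1\<close> the segment is closed up to the left, around both poles; for \<open>y < 1\<close> to the right.\<close>

lemma perron_kernel_ge_1:
  assumes y: "y \<ge> 1" and T: "T \<ge> 6"
  shows "norm (contour_integral (linepath (Complex 2 (-T)) (Complex 2 T)) (perron_integrand y)
     - 2 * pi * \<i> * of_real (1 - 1 / y)) \<le> 32 * y\<^sup>2 / T"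
proof -
  define p where "p = rectpath (Complex (2 - T) (-T)) (Complex 2 T)"
  define f where "f = perron_integrand y"
  have hol: "(\<lambda>s. of_real y powr s) holomorphic_on UNIV"
    using y by (intro holomorphic_of_real_powr) auto
  have box: "0 \<in> box (Complex (2 - T) (-T)) (Complex 2 T)" "-1 \<in> box (Complex (2 - T) (-T)) (Complex 2 T)"
    using T by (auto simp: in_box_complex_iff)
  have img: "path_image p = cbox (Complex (2 - T) (-T)) (Complex 2 T) - box (Complex (2 - T) (-T)) (Complex 2 T)"
    unfolding p_def using T by (intro path_image_rectpath_cbox_minus_box) auto
  have np: "0 \<notin> path_image p" "-1 \<notin> path_image p" using box unfolding img by auto
  have w: "winding_number p 0 = 1" "winding_number p (-1) = 1"
    unfolding p_def using winding_number_rectpath[OF box(1)] winding_number_rectpath[OF box(2)] by auto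
  have i0: "((\<lambda>s. of_real y powr s / (s - 0)) has_contour_integral 2 * pi * \<i> * winding_number p 0 * of_real y powr 0) p"
    by (rule Cauchy_integral_formula_convex_simple[OF convex_UNIV hol]) (use np in \<open>auto simp: p_def\<close>)
  have i1: "((\<lambda>s. of_real y powr s / (s - (-1))) has_contour_integral 2 * pi * \<i> * winding_number p (-1) * of_real y powr (-1)) p"
    by (rule Cauchy_integral_formula_convex_simple[OF convex_UNIV hol]) (use np in \<open>auto simp: p_def\<close>)
  \<comment> \<open>Partial fractions of \<open>1 / (s * (s + 1))\<close> reduce the residue
    computation to two instances of Cauchy's formula.\<close>
  have "((\<lambda>s. of_real y powr s / (s - 0) - of_real y powr s / (s - (-1))) has_contour_integral
      2 * pi * \<i> * of_real (1 - 1 / y)) p"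
    using has_contour_integral_diff[OF i0 i1] y w by (simp add: algebra_simps powr_minus divide_inverse)
  hence int: "(f has_contour_integral 2 * pi * \<i> * of_real (1 - 1 / y)) p"
  proof (rule has_contour_integral_eq)
    fix s assume "s \<in> path_image p"
    hence "s \<noteq> 0" "s + 1 \<noteq> 0" using np by (auto simp: add_eq_0_iff2)
    thus "of_real y powr s / (s - 0) - of_real y powr s / (s - (-1)) = f s"
      by (simp add: f_def perron_integrand_def field_simps)
  qed
  have cont: "continuous_on (path_image p) f"
    unfolding f_def perron_integrand_def using np y
    by (intro continuous_intros holomorphic_on_imp_continuous_on[OF holomorphic_of_real_powr])
       (auto simp: add_eq_0_iff2)
  define Q where "Q = 8 * y\<^sup>2 / T\<^sup>2"
  have norm_ge: "norm s \<ge> T - 2" if "Re s = 2 - T \<or> \<bar>Im s\<bar> = T" for s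
    using that abs_Re_le_cmod[of s] abs_Im_le_cmod[of s] by auto
  have bound: "norm (f s) \<le> Q" if "Re s \<le> 2" "Re s = 2 - T \<or> \<bar>Im s\<bar> = T" for s
    unfolding f_def Q_def using that y T norm_ge by (intro perron_integrand_bound) auto
  have "Q \<ge> 0" by (simp add: Q_def)
  define J where "J = (\<lambda>a. contour_integral (linepath (Complex a (-T)) (Complex a T)) f)"
  have "norm (J 2 - J (2 - T) - 2 * pi * \<i> * of_real (1 - 1 / y)) \<le> 2 * (2 - (2 - T)) * Q"
    unfolding J_def by (rule rectangle_integral_bound(1)[OF _ _ cont[unfolded p_def] int[unfolded p_def]])
      (use T \<open>Q \<ge> 0\<close> in \<open>auto intro!: bound\<close>)
  moreover have "norm (J (2 - T)) \<le> (T - (- T)) * Q"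
    unfolding J_def by (rule rectangle_integral_bound(2)[OF _ _ cont[unfolded p_def] int[unfolded p_def]])
      (use T \<open>Q \<ge> 0\<close> in \<open>auto intro!: bound\<close>)
  ultimately have "norm (J 2 - 2 * pi * \<i> * of_real (1 - 1 / y)) \<le> 4 * T * Q"
    using norm_triangle_ineq[of "J 2 - J (2 - T) - 2 * pi * \<i> * of_real (1 - 1 / y)" "J (2 - T)"] by (simp add: algebra_simps)
  also have "\<dots> = 32 * y\<^sup>2 / T" using T by (simp add: Q_def field_simps power2_eq_square)
  finally show ?thesis unfolding J_def f_def .
qed

lemma perron_kernel_le_1:
  assumes y: "0 < y" "y \<le> 1" and T: "T \<ge> 6"
  shows "norm (contour_integral (linepath (Complex 2 (-T)) (Complex 2 T)) (perron_integrand y)) \<le> 32 * y\<^sup>2 / T"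
proof -
  define p where "p = rectpath (Complex 2 (-T)) (Complex (2 + T) T)"
  define f where "f = perron_integrand y"
  have hol: "f holomorphic_on {s. Re s > 0}"
    unfolding f_def perron_integrand_def using y
    by (intro holomorphic_intros holomorphic_of_real_powr) (auto simp: add_eq_0_iff2)
  have img: "path_image p \<subseteq> {s. Re s > 0}"
    unfolding p_def using path_image_rectpath_subset[of 2 "2 + T" "-T" T] T by force
  have int: "(f has_contour_integral 0) p"
    by (rule Cauchy_theorem_convex_simple[OF hol convex_halfspace_Re_gt])
       (use img in \<open>auto simp: p_def\<close>)
  have cont: "continuous_on (path_image p) f"
    using hol img holomorphic_on_imp_continuous_on continuous_on_subset by blast
  define Q where "Q = 8 * y\<^sup>2 / T\<^sup>2"
  have norm_ge: "norm s \<ge> T - 2" if "Re s = 2 + T \<or> \<bar>Im s\<bar> = T" for s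
    using that abs_Re_le_cmod[of s] abs_Im_le_cmod[of s] by auto
  have bound: "norm (f s) \<le> Q" if "2 \<le> Re s" "Re s = 2 + T \<or> \<bar>Im s\<bar> = T" for s
    unfolding f_def Q_def using that y T norm_ge by (intro perron_integrand_bound) auto
  have "Q \<ge> 0" by (simp add: Q_def)
  define J where "J = (\<lambda>a. contour_integral (linepath (Complex a (-T)) (Complex a T)) f)"
  have "norm (J (2 + T) - J 2 - 0) \<le> 2 * (2 + T - 2) * Q"
    unfolding J_def by (rule rectangle_integral_bound(1)[OF _ _ cont[unfolded p_def] int[unfolded p_def]])
      (use T \<open>Q \<ge> 0\<close> in \<open>auto intro!: bound\<close>)
  moreover have "norm (J (2 + T)) \<le> (T - (- T)) * Q"
    unfolding J_def by (rule rectangle_integral_bound(3)[OF _ _ cont[unfolded p_def] int[unfolded p_def]])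
      (use T \<open>Q \<ge> 0\<close> in \<open>auto intro!: bound\<close>)
  ultimately have "norm (J 2) \<le> 4 * T * Q"
    using norm_triangle_ineq4[of "J (2 + T)" "J (2 + T) - J 2"] by (simp add: algebra_simps)
  also have "\<dots> = 32 * y\<^sup>2 / T" using T by (simp add: Q_def field_simps power2_eq_square)
  finally show ?thesis unfolding J_def f_def .
qed

lemma perron_kernel:
  assumes y: "y > 0" and T: "T \<ge> 6"
  shows "norm (contour_integral (linepath (Complex 2 (-T)) (Complex 2 T)) (perron_integrand y)
     - 2 * pi * \<i> * of_real (max 0 (1 - 1 / y))) \<le> 32 * y\<^sup>2 / T"
proof (cases "y \<ge> 1")
  case True
  thus ?thesis using perron_kernel_ge_1[OF True T] by simp
next
  case False
  thus ?thesis using perron_kernel_le_1[OF y _ T] y by simp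
qed

text \<open>The nth term of the series times the kernel at \<open>X\<close> is \<open>a n\<close>
  times the kernel at \<open>X / n\<close>. Uniform convergence on the segment permits termwise
  integration, and the individual errors, proportional to \<open>(X / n)\<^sup>2 / T\<close>, are
  summable because the series converges absolutely at 2.\<close>

lemma perron_formula_truncated:
  assumes a: "summable (\<lambda>n. norm (a (Suc n)) / real (Suc n) ^ 2)"
    and F: "\<And>s. Re s = 2 \<Longrightarrow> (\<lambda>n. a (Suc n) / of_nat (Suc n) powr s) sums F s"
    and X: "0 < X" "X \<le> real M" and T: "T \<ge> 6"
  shows "norm (contour_integral (linepath (Complex 2 (-T)) (Complex 2 T)) (\<lambda>s. F s * perron_integrand X s)
     - 2 * pi * \<i> * (\<Sum>n=1..M. a n * of_real (max 0 (1 - real n / X))))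
     \<le> 32 * X\<^sup>2 / T * (\<Sum>n. norm (a (Suc n)) / real (Suc n) ^ 2)"
proof -
  define S where "S = closed_segment (Complex 2 (-T)) (Complex 2 T)"
  define f where "f = (\<lambda>n s. a (Suc n) * perron_integrand (X / real (Suc n)) s)"
  define I where "I = (\<lambda>f. contour_integral (linepath (Complex 2 (-T)) (Complex 2 T)) f)"
  have S: "Re s = 2" if "s \<in> S" for s
    using vertical_in_segment that unfolding S_def by blast
  have feq: "f n s = a (Suc n) / of_nat (Suc n) powr s * perron_integrand X s" for n s
  proof -
    have "of_real X powr s = (of_real (X / real (Suc n)) * of_real (real (Suc n))) powr s"
      by (simp del: of_nat_Suc flip: of_real_mult)
    also have "\<dots> = of_real (X / real (Suc n)) powr s * of_real (real (Suc n)) powr s"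
      by (rule powr_times_real) (use X in auto)
    finally have "of_real (X / real (Suc n)) powr s = of_real X powr s / of_nat (Suc n) powr s"
      by (simp del: of_nat_Suc)
    thus ?thesis by (simp add: f_def perron_integrand_def)
  qed
  have cont_p: "continuous_on S (perron_integrand y)" if "y > 0" for y
    unfolding perron_integrand_def using that S
    by (intro continuous_intros holomorphic_on_imp_continuous_on[OF holomorphic_of_real_powr])
       (force simp: add_eq_0_iff2)+
  have u: "uniform_limit S (\<lambda>N s. \<Sum>n<N. f n s) (\<lambda>s. \<Sum>n. f n s) sequentially"
  proof (rule Weierstrass_m_test)
    show "summable (\<lambda>n. X\<^sup>2 * (norm (a (Suc n)) / real (Suc n) ^ 2))"
      by (intro summable_mult a)
    fix n s assume s: "s \<in> S"
    have "1 \<le> norm s" "1 \<le> norm (s + 1)"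
      using S[OF s] abs_Re_le_cmod[of s] abs_Re_le_cmod[of "s + 1"] by auto
    hence "1 * 1 \<le> norm s * norm (s + 1)" by (intro mult_mono) auto
    moreover have "norm (of_real (X / real (Suc n)) powr s) = (X / real (Suc n))\<^sup>2"
      using S[OF s] X by (subst norm_powr_real_powr) (auto simp: powr_numeral)
    ultimately have "norm (f n s) \<le> norm (a (Suc n)) * (X / real (Suc n))\<^sup>2 / 1"
      unfolding f_def perron_integrand_def norm_mult norm_divide
      by (subst times_divide_eq_right) (intro frac_le mult_left_mono; simp)
    thus "norm (f n s) \<le> X\<^sup>2 * (norm (a (Suc n)) / real (Suc n) ^ 2)"
      by (simp add: power_divide field_simps)
  qed
  have cont: "continuous_on S (f n)" for n
    unfolding f_def using X by (intro continuous_intros cont_p) auto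
  obtain J where J: "((\<lambda>s. \<Sum>n. f n s) has_contour_integral J) (linepath (Complex 2 (-T)) (Complex 2 T))"
    "(\<lambda>n. I (f n)) sums J"
    using contour_integral_sums_linepath[OF u[unfolded S_def] cont[unfolded S_def]] unfolding I_def by blast
  have "((\<lambda>s. F s * perron_integrand X s) has_contour_integral J) (linepath (Complex 2 (-T)) (Complex 2 T))"
  proof (rule has_contour_integral_eq[OF J(1)])
    fix s assume "s \<in> path_image (linepath (Complex 2 (-T)) (Complex 2 T))"
    hence "Re s = 2" using S by (simp add: S_def)
    from sums_mult2[OF F[OF this], of "perron_integrand X s"]
    show "(\<Sum>n. f n s) = F s * perron_integrand X s"
      unfolding feq by (simp add: sums_iff)
  qed
  hence JF: "I (\<lambda>s. F s * perron_integrand X s) = J" by (simp add: I_def contour_integral_unique)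
  define w where "w = (\<lambda>n. a n * of_real (max 0 (1 - real n / X)))"
  have "(\<lambda>n. w (Suc n)) sums (\<Sum>n<M. w (Suc n))"
  proof (rule sums_finite)
    fix n assume "n \<notin> {..<M}"
    thus "w (Suc n) = 0" using X by (simp add: w_def)
  qed simp
  also have "(\<Sum>n<M. w (Suc n)) = (\<Sum>n=1..M. w n)"
    by (simp add: sum.atLeast1_atMost_eq)
  finally have "(\<lambda>n. I (f n) - 2 * pi * \<i> * w (Suc n)) sums (J - 2 * pi * \<i> * (\<Sum>n=1..M. w n))"
    by (intro sums_diff J sums_mult)
  hence "J - 2 * pi * \<i> * (\<Sum>n=1..M. w n) = (\<Sum>n. I (f n) - 2 * pi * \<i> * w (Suc n))"
    by (simp add: sums_iff)
  also have "norm \<dots> \<le> (\<Sum>n. 32 * X\<^sup>2 / T * (norm (a (Suc n)) / real (Suc n) ^ 2))"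
  proof (rule norm_suminf_le)
    show "summable (\<lambda>n. 32 * X\<^sup>2 / T * (norm (a (Suc n)) / real (Suc n) ^ 2))"
      by (intro summable_mult a)
    fix n
    have y: "X / real (Suc n) > 0" using X by simp
    have "perron_integrand (X / real (Suc n)) contour_integrable_on linepath (Complex 2 (-T)) (Complex 2 T)"
      by (intro contour_integrable_continuous_linepath) (use cont_p[OF y] in \<open>simp add: S_def\<close>)
    hence "I (f n) - 2 * pi * \<i> * w (Suc n) = a (Suc n) * (I (perron_integrand (X / real (Suc n)))
       - 2 * pi * \<i> * of_real (max 0 (1 - 1 / (X / real (Suc n)))))"
      unfolding I_def f_def w_def by (simp add: contour_integral_lmul algebra_simps)
    also have "norm \<dots> \<le> norm (a (Suc n)) * (32 * (X / real (Suc n))\<^sup>2 / T)"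
      unfolding norm_mult I_def by (intro mult_left_mono perron_kernel y T) auto
    finally show "norm (I (f n) - 2 * pi * \<i> * w (Suc n)) \<le> 32 * X\<^sup>2 / T * (norm (a (Suc n)) / real (Suc n) ^ 2)"
      by (simp add: power_divide mult_ac)
  qed
  also have "\<dots> = 32 * X\<^sup>2 / T * (\<Sum>n. norm (a (Suc n)) / real (Suc n) ^ 2)"
    by (rule suminf_mult[OF a])
  finally show ?thesis unfolding JF[symmetric] I_def w_def .
qed

section \<open>From bounds on a vertical line to bounds for sharp partial sums\<close>

lemma integral_japanese_bound:
  fixes \<eta> T :: real
  assumes \<eta>: "\<eta> > 0" and T: "T > 0"
  shows "(\<lambda>t. (1 + \<bar>t\<bar>) powr (-1 - \<eta>)) integrable_on {-T..T}"
    and "integral {-T..T} (\<lambda>t. (1 + \<bar>t\<bar>) powr (-1 - \<eta>)) \<le> 2 / \<eta>"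
proof -
  define f where "f = (\<lambda>t. (1 + \<bar>t\<bar>) powr (-1 - \<eta>))"
  have "continuous_on {-T..T} f" unfolding f_def
    by (intro continuous_intros) auto
  thus int: "f integrable_on {-T..T}" by (rule integrable_continuous_real)
  have 1: "(f has_integral (- ((1 + T) powr (-\<eta>) / \<eta>) - - ((1 + 0) powr (-\<eta>) / \<eta>))) {0..T}"
  proof (rule fundamental_theorem_of_calculus)
    fix t assume t: "t \<in> {0..T}"
    have "((\<lambda>t. (1 + t) powr (-\<eta>)) has_real_derivative (-\<eta> * (1 + t) powr (-\<eta> - 1)) * 1) (at t within {0..T})"
      using t by (intro DERIV_chain2[OF has_real_derivative_powr]) (auto intro!: derivative_eq_intros)
    from DERIV_cmult[OF this, of "-1 / \<eta>"]
    have "((\<lambda>t. - ((1 + t) powr (-\<eta>) / \<eta>)) has_real_derivative (1 + t) powr (-1 - \<eta>)) (at t within {0..T})"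
      using \<eta> by (simp add: add.commute minus_diff_commute)
    thus "((\<lambda>t. - ((1 + t) powr (-\<eta>) / \<eta>)) has_vector_derivative f t) (at t within {0..T})"
      using t by (simp add: f_def has_real_derivative_iff_has_vector_derivative)
  qed (use T in auto)
  have 2: "(f has_integral (- ((1 + T) powr (-\<eta>) / \<eta>) - - ((1 + 0) powr (-\<eta>) / \<eta>))) {-T..-0}"
    using has_integral_reflect_lemma_real[OF 1] by (simp add: f_def)
  have "(f has_integral (- ((1 + T) powr (-\<eta>) / \<eta>) - - ((1 + 0) powr (-\<eta>) / \<eta>)) +
      (- ((1 + T) powr (-\<eta>) / \<eta>) - - ((1 + 0) powr (-\<eta>) / \<eta>))) {-T..T}"
    by (rule has_integral_combine[OF _ _ 2[unfolded minus_zero] 1]) (use T in auto)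
  hence "integral {-T..T} f = 2 * (1 - (1 + T) powr (-\<eta>)) / \<eta>"
    by (simp add: has_integral_iff diff_divide_distrib)
  also have "\<dots> \<le> 2 * 1 / \<eta>" using \<eta> by (intro divide_right_mono mult_left_mono) auto
  finally show "integral {-T..T} f \<le> 2 / \<eta>" by simp
qed

lemma norm_powr_difference_le:
  fixes X Y :: real
  assumes "0 < X" "X \<le> Y" "Re s \<ge> 0"
  shows "norm (of_real Y powr (s + 1) - of_real X powr (s + 1)) \<le> norm (s + 1) * ((Y - X) * Y powr Re s)"
proof -
  have "norm (of_real Y powr (s + 1) - of_real X powr (s + 1)) \<le>
      norm (s + 1) * Y powr Re s * norm (of_real Y - of_real X :: complex)"
  proof (rule field_differentiable_bound[of "closed_segment (of_real X) (of_real Y)"])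
    fix z :: complex assume "z \<in> closed_segment (of_real X) (of_real Y)"
    then obtain x where x: "z = of_real x" "X \<le> x" "x \<le> Y"
      using assms by (auto simp: closed_segment_of_real closed_segment_eq_real_ivl)
    show "((\<lambda>t. t powr (s + 1)) has_field_derivative (s + 1) * z powr s) (at z within closed_segment (of_real X) (of_real Y))"
      using powr_complex_has_deriv[of z "s + 1"] x assms by (auto simp: complex_nonpos_Reals_iff)
    show "norm ((s + 1) * z powr s) \<le> norm (s + 1) * Y powr Re s"
      using x assms by (auto simp: norm_mult norm_powr_real_powr intro!: mult_left_mono powr_mono2)
  qed auto
  moreover have "norm (of_real Y - of_real X :: complex) = Y - X"
    using assms by (simp flip: of_real_diff)
  ultimately show ?thesis by (simp add: mult_ac)
qed

lemma contour_integral_shift: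
  assumes hol: "G holomorphic_on {s. Re s > c}" and \<sigma>: "c < \<sigma>" "\<sigma> \<le> b" and T: "T > 0"
    and B: "\<And>s. \<sigma> \<le> Re s \<Longrightarrow> Re s \<le> b \<Longrightarrow> \<bar>Im s\<bar> = T \<Longrightarrow> norm (G s) \<le> B" and B0: "B \<ge> 0"
  shows "norm (contour_integral (linepath (Complex b (-T)) (Complex b T)) G
      - contour_integral (linepath (Complex \<sigma> (-T)) (Complex \<sigma> T)) G) \<le> 2 * (b - \<sigma>) * B"
proof -
  define p where "p = rectpath (Complex \<sigma> (-T)) (Complex b T)"
  have img: "path_image p \<subseteq> {s. Re s > c}"
    unfolding p_def using path_image_rectpath_subset[of \<sigma> b "-T" T] T \<sigma> by force
  have int: "(G has_contour_integral 0) p"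
    by (rule Cauchy_theorem_convex_simple[OF hol convex_halfspace_Re_gt])
       (use img in \<open>auto simp: p_def\<close>)
  have cont: "continuous_on (path_image p) G"
    using hol img holomorphic_on_imp_continuous_on continuous_on_subset by blast
  have "norm (contour_integral (linepath (Complex b (-T)) (Complex b T)) G
      - contour_integral (linepath (Complex \<sigma> (-T)) (Complex \<sigma> T)) G - 0) \<le> 2 * (b - \<sigma>) * B"
    by (rule rectangle_integral_bound(1)[OF _ _ cont[unfolded p_def] int[unfolded p_def]])
       (use T \<sigma> B0 in \<open>auto intro!: B\<close>)
  thus ?thesis by simp
qed

lemma norm_ge_third:
  assumes "1 / 2 \<le> Re s"
  shows "(1 + \<bar>Im s\<bar>) / 3 \<le> norm s"
  using complex_Re_le_cmod[of s] abs_Im_le_cmod[of s] assms by (simp add: field_simps)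

text \<open>Interpolation between the bounds 1 and \<open>z\<close>: a small exponent keeps just
  enough of the decay of \<open>z\<close> for an integral to converge.\<close>

lemma min_le_powr:
  fixes z p :: real
  assumes "z \<ge> 0" "0 \<le> p" "p \<le> 1" "m \<le> 1" "m \<le> z"
  shows "m \<le> z powr p"
proof (cases "z \<le> 1 \<and> z > 0")
  case True
  have "z powr 1 \<le> z powr p" using True assms by (intro powr_mono') auto
  thus ?thesis using assms True by simp
next
  case False
  thus ?thesis using assms ge_one_powr_ge_zero[of z p] powr_ge_zero[of z p] by (cases "z = 0") auto
qed

text \<open>
  The weight \<open>1\<close> on \<open>[0, X]\<close> that decreases linearly to \<open>0\<close> on \<open>[X, X + h]\<close> corresponds to the kernel
  \<open>((X + h) powr (s + 1) - X powr (s + 1)) / (h s (s + 1))\<close>. Its size is at most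
  \<open>(X + h) powr Re s / |s| * min 1 (2 (X + h) / (h |s|))\<close>.
\<close>

lemma trapezoid_kernel_bound:
  fixes X h \<eta> :: real
  assumes X: "X > 0" and h: "0 < h" "h \<le> X" and \<eta>: "0 < \<eta>" "\<eta> \<le> 1 / 2" and s: "1 / 2 \<le> Re s"
  shows "norm ((of_real (X + h) powr (s + 1) - of_real X powr (s + 1)) / (of_real h * (s * (s + 1))))
    \<le> 3 * (2 * X) powr Re s * (12 * X / h) powr (2 * \<eta>) * (1 + \<bar>Im s\<bar>) powr (-1 - 2 * \<eta>)"
proof -
  define D where "D = norm (of_real (X + h) powr (s + 1) - of_real X powr (s + 1)) / norm (s + 1)"
  define Y where "Y = (2 * X) powr Re s"
  define t where "t = 1 + \<bar>Im s\<bar>"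
  have t: "t \<ge> 1" by (simp add: t_def)
  have Y: "Y > 0" using X by (simp add: Y_def)
  have s1: "norm (s + 1) > 0" using s by (auto simp: complex_eq_iff)
  have Yle: "(X + h) powr Re s \<le> Y" unfolding Y_def using X h s by (intro powr_mono2) auto
  have ns: "norm s \<le> norm (s + 1)" unfolding cmod_def using s by (intro real_sqrt_le_mono) (auto simp: power2_eq_square algebra_simps)
  have n3: "t / 3 \<le> norm s" unfolding t_def by (rule norm_ge_third[OF s])
  have D1: "D \<le> h * Y"
  proof -
    have "norm (of_real (X + h) powr (s + 1) - of_real X powr (s + 1)) \<le> norm (s + 1) * ((X + h - X) * (X + h) powr Re s)"
      by (rule norm_powr_difference_le) (use X h s in auto)
    also have "\<dots> \<le> norm (s + 1) * (h * Y)" using Yle h by (intro mult_left_mono) auto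
    finally show ?thesis using s1 by (simp add: D_def field_simps)
  qed
  have D2: "D \<le> h * Y * (12 * X / h / t)"
  proof -
    have "norm (of_real (X + h) powr (s + 1) - of_real X powr (s + 1)) \<le> (2 * X) powr (Re s + 1) + (2 * X) powr (Re s + 1)"
      by (rule norm_triangle_le_diff, rule add_mono)
         (use X h s in \<open>auto simp: norm_powr_real_powr simp del: of_real_add intro!: powr_mono2\<close>)
    also have "\<dots> = Y * (4 * X)" using X by (simp add: Y_def powr_add)
    finally have "D \<le> Y * (4 * X) / norm (s + 1)" unfolding D_def by (rule divide_right_mono) simp
    also have "\<dots> \<le> Y * (4 * X) / (t / 3)" using ns n3 t Y X by (intro divide_left_mono) (auto intro!: mult_pos_pos)
    finally show ?thesis using h by (simp add: field_simps)
  qed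
  \<comment> \<open>\<open>D1\<close> is the mean value bound and \<open>D2\<close> the triangle
    inequality. Interpolating with exponent \<open>2 * \<eta>\<close> costs only a small power of
    \<open>X / h\<close> and gains the decay beyond \<open>1 / \<bar>Im s\<bar>\<close> that leaves
    room for the growth of \<open>F\<close>.\<close>
  have "D / (h * Y) \<le> (12 * X / h / t) powr (2 * \<eta>)"
    using D1 D2 X Y h t \<eta> by (intro min_le_powr) (auto simp: field_simps)
  also have "\<dots> = (12 * X / h) powr (2 * \<eta>) * t powr (- 2 * \<eta>)"
    using X h t by (subst powr_divide) (auto simp: powr_minus divide_inverse)
  finally have D: "D \<le> h * Y * ((12 * X / h) powr (2 * \<eta>) * t powr (- 2 * \<eta>))"
    using h Y by (simp add: field_simps)
  have "norm ((of_real (X + h) powr (s + 1) - of_real X powr (s + 1)) / (of_real h * (s * (s + 1)))) = D / (h * norm s)"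
    using h by (simp add: D_def norm_divide norm_mult)
  also have "\<dots> \<le> h * Y * ((12 * X / h) powr (2 * \<eta>) * t powr (- 2 * \<eta>)) / (h * (t / 3))"
    using D n3 h t Y X by (intro frac_le mult_left_mono) auto
  also have "\<dots> = 3 * Y * (12 * X / h) powr (2 * \<eta>) * (t powr (- 2 * \<eta>) / t)"
    using h by simp
  also have "t powr (- 2 * \<eta>) / t = t powr (-1 - 2 * \<eta>)"
    using t by (simp add: powr_diff powr_minus field_simps)
  finally show ?thesis by (simp add: Y_def t_def)
qed

lemma vertical_integral_bound:
  assumes \<eta>: "0 < \<eta>" and T: "T > 0" and C: "C \<ge> 0"
    and cont: "continuous_on {s. Re s = \<sigma>} G"
    and G: "\<And>s. Re s = \<sigma> \<Longrightarrow> norm (G s) \<le> C * (1 + \<bar>Im s\<bar>) powr (-1 - \<eta>)"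
  shows "norm (contour_integral (linepath (Complex \<sigma> (-T)) (Complex \<sigma> T)) G) \<le> C * (2 / \<eta>)"
proof -
  have "contour_integral (linepath (Complex \<sigma> (-T)) (Complex \<sigma> T)) G = \<i> * integral {-T..T} (\<lambda>x. G (Complex \<sigma> x))"
    by (rule contour_integral_linepath_same_Re) (use T in auto)
  also have "norm \<dots> = norm (integral {-T..T} (\<lambda>x. G (Complex \<sigma> x)))" by (simp add: norm_mult)
  also have "\<dots> \<le> integral {-T..T} (\<lambda>t. C * (1 + \<bar>t\<bar>) powr (-1 - \<eta>))"
  proof (rule integral_norm_bound_integral)
    show "(\<lambda>x. G (Complex \<sigma> x)) integrable_on {-T..T}"
      by (intro integrable_continuous_real continuous_on_compose2[OF cont])
         (auto simp: Complex_eq intro!: continuous_intros)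
    show "(\<lambda>t. C * (1 + \<bar>t\<bar>) powr (-1 - \<eta>)) integrable_on {-T..T}"
      using integrable_on_cmult_left[OF integral_japanese_bound(1)[OF \<eta> T], of C] by simp
    show "norm (G (Complex \<sigma> x)) \<le> C * (1 + \<bar>x\<bar>) powr (-1 - \<eta>)" for x
      using G[of "Complex \<sigma> x"] by simp
  qed
  also have "\<dots> = C * integral {-T..T} (\<lambda>t. (1 + \<bar>t\<bar>) powr (-1 - \<eta>))" by simp
  also have "\<dots> \<le> C * (2 / \<eta>)" by (intro mult_left_mono integral_japanese_bound \<eta> T C)
  finally show ?thesis .
qed

text \<open>On the line \<open>Re s = 1 / 2 + \<eta>\<close> the trapezoid kernel contributes
  \<open>X powr (1 / 2 + \<eta>)\<close> times \<open>(X / h) powr (2 * \<eta>)\<close>. With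
  \<open>h = sqrt X\<close> this is \<open>X powr (1 / 2 + 2 * \<eta>)\<close>, while the at most
  \<open>h\<close> terms on the slope, each of size about \<open>X powr \<eta>\<close>, cost no
  more. The sharp sum therefore inherits the bound of the weighted one.\<close>

theorem summatory_function_bound:
  fixes a :: "nat \<Rightarrow> complex" and F :: "complex \<Rightarrow> complex" and \<eta> K B :: real
  assumes \<eta>: "0 < \<eta>" "\<eta> \<le> 1 / 4" and K: "K \<ge> 0" and x: "x \<ge> 1"
    and a: "\<And>n. n \<ge> 1 \<Longrightarrow> norm (a n) \<le> B * real n powr \<eta>"
    and hol: "F holomorphic_on {s. Re s > 1 / 2}"
    and F: "\<And>s. Re s = 2 \<Longrightarrow> (\<lambda>n. a (Suc n) / of_nat (Suc n) powr s) sums F s"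
    and bnd: "\<And>s. 1 / 2 + \<eta> \<le> Re s \<Longrightarrow> Re s \<le> 2 \<Longrightarrow> norm (F s) \<le> K * (1 + \<bar>Im s\<bar>) powr \<eta>"
  shows "norm (\<Sum>n=1..x. a n) \<le> 24 / \<eta> * (K + B) * real x powr (1 / 2 + 2 * \<eta>)"
proof -
  define X where "X = real x"
  define h where "h = sqrt X"
  \<comment> \<open>Since \<open>h \<le> X\<close>, both triangular weights, with ends at
    \<open>X\<close> and \<open>X + h\<close>, vanish beyond \<open>M\<close>, so one finite range
    serves both.\<close>
  define M where "M = 2 * x"
  define \<sigma> where "\<sigma> = 1 / 2 + \<eta>"
  have X: "X \<ge> 1" using x by (simp add: X_def)
  have h: "1 \<le> h" "h \<le> X" "h * h = X" using X by (auto simp: h_def real_le_lsqrt power2_eq_square)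
  have B: "B \<ge> 0" using order.trans[OF norm_ge_zero a[of 1]] by simp
  have XM: "X + h \<le> real M" "X \<le> real M" using h X by (auto simp: M_def X_def)
  have \<sigma>: "1 / 2 < \<sigma>" "\<sigma> \<le> 2" "\<sigma> \<le> 1" using \<eta> by (auto simp: \<sigma>_def)
  have sa: "summable (\<lambda>n. norm (a (Suc n)) / real (Suc n) ^ 2)"
  proof (rule summable_comparison_test)
    show "summable (\<lambda>n. B * (1 + real n * 1) powr (- (3 / 2)))"
      by (intro summable_mult summable_arith_powr) auto
    have "norm (a (Suc n)) / real (Suc n) ^ 2 \<le> B * (1 + real n * 1) powr (- (3 / 2))" for n
    proof -
      have "norm (a (Suc n)) / real (Suc n) ^ 2 \<le> B * real (Suc n) powr \<eta> / real (Suc n) powr 2"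
        using a[of "Suc n"] by (subst powr_numeral) (auto intro!: divide_right_mono)
      also have "\<dots> = B * real (Suc n) powr (\<eta> - 2)" by (simp add: powr_diff)
      also have "\<dots> \<le> B * real (Suc n) powr (- (3 / 2))"
        using \<eta> B by (intro mult_left_mono powr_mono) auto
      finally show ?thesis by (simp add: add_ac)
    qed
    thus "\<exists>N. \<forall>n\<ge>N. norm (norm (a (Suc n)) / real (Suc n) ^ 2) \<le> B * (1 + real n * 1) powr (- (3 / 2))"
      by (intro exI[of _ 0]) auto
  qed
  define S2 where "S2 = (\<Sum>n. norm (a (Suc n)) / real (Suc n) ^ 2)"
  define wt where "wt = (\<lambda>Z n. max 0 (1 - real n / Z))"
  \<comment> \<open>The difference of two triangles with the same slope is a trapezoid. This is how
    the kernel \<open>ker\<close> arises from two copies of \<open>perron_integrand\<close>.\<close>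
  define W where "W = (\<lambda>n. ((X + h) * wt (X + h) n - X * wt X n) / h)"
  define S where "S = (\<Sum>n=1..M. a n * of_real (W n))"
  define ker where "ker = (\<lambda>s::complex. (of_real (X + h) powr (s + 1) - of_real X powr (s + 1)) / (of_real h * (s * (s + 1))))"
  define G where "G = (\<lambda>s. F s * ker s)"
  define I where "I = (\<lambda>\<sigma> T f. contour_integral (linepath (Complex \<sigma> (-T)) (Complex \<sigma> T)) f)"
  have kereq: "ker s = (of_real (X + h) * perron_integrand (X + h) s - of_real X * perron_integrand X s) / of_real h" for s
  proof -
    have "(of_real Y :: complex) powr (s + 1) = of_real Y * of_real Y powr s" if "Y > 0" for Y :: real
      using that by (simp add: powr_add)
    from this[of X] this[of "X + h"] show ?thesis
      using X h unfolding ker_def perron_integrand_def by (simp add: divide_inverse right_diff_distrib mult_ac)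
  qed
  have holG: "G holomorphic_on {s. Re s > 1 / 2}"
    unfolding G_def ker_def using X h
    by (intro holomorphic_intros hol holomorphic_of_real_powr) (auto simp: add_eq_0_iff2)
  have contp: "continuous_on {s. Re s > 1 / 2} (\<lambda>s. F s * perron_integrand Y s)" if "Y > 0" for Y
    unfolding perron_integrand_def using that
    by (intro holomorphic_on_imp_continuous_on holomorphic_intros hol holomorphic_of_real_powr) (auto simp: add_eq_0_iff2)
  have segH: "closed_segment (Complex 2 (-T)) (Complex 2 T) \<subseteq> {s. Re s > 1 / 2}" for T
    by (auto dest!: vertical_in_segment)
  have ker: "norm (ker s) \<le> 3 * (2 * X) powr Re s * (12 * X / h) powr (2 * \<eta>) * (1 + \<bar>Im s\<bar>) powr (-1 - 2 * \<eta>)"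
    if "1 / 2 \<le> Re s" for s
    unfolding ker_def by (rule trapezoid_kernel_bound) (use that X h \<eta> in auto)
  have Gb: "norm (G s) \<le> K * 3 * (2 * X) powr Re s * (12 * X / h) powr (2 * \<eta>) * (1 + \<bar>Im s\<bar>) powr (-1 - \<eta>)"
    if "\<sigma> \<le> Re s" "Re s \<le> 2" for s
  proof -
    have "norm (G s) \<le> (K * (1 + \<bar>Im s\<bar>) powr \<eta>) * (3 * (2 * X) powr Re s * (12 * X / h) powr (2 * \<eta>) * (1 + \<bar>Im s\<bar>) powr (-1 - 2 * \<eta>))"
      unfolding G_def norm_mult using that \<sigma>
      by (intro mult_mono bnd ker) (auto simp: \<sigma>_def K)
    also have "\<dots> = K * 3 * (2 * X) powr Re s * (12 * X / h) powr (2 * \<eta>) * ((1 + \<bar>Im s\<bar>) powr \<eta> * (1 + \<bar>Im s\<bar>) powr (-1 - 2 * \<eta>))"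
      by (simp add: mult_ac)
    also have "(1 + \<bar>Im s\<bar>) powr \<eta> * (1 + \<bar>Im s\<bar>) powr (-1 - 2 * \<eta>) = (1 + \<bar>Im s\<bar>) powr (-1 - \<eta>)"
      by (simp flip: powr_add add: algebra_simps)
    finally show ?thesis .
  qed
  define C1 where "C1 = ((X + h) * (32 * (X + h)\<^sup>2) + X * (32 * X\<^sup>2)) / h * S2"
  define C2 where "C2 = K * 3 * (2 * X) powr 2 * (12 * X / h) powr (2 * \<eta>)"
  define C3 where "C3 = K * 3 * (2 * X) powr \<sigma> * (12 * X / h) powr (2 * \<eta>)"
  have S2: "S2 \<ge> 0" unfolding S2_def by (intro suminf_nonneg sa) auto
  have I1: "norm (I 2 T G - 2 * pi * \<i> * S) \<le> C1 / T" if T: "T \<ge> 6" for T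
  proof -
    define E where "E = (\<lambda>Z. I 2 T (\<lambda>s. F s * perron_integrand Z s) - 2 * pi * \<i> * (\<Sum>n=1..M. a n * of_real (wt Z n)))"
    have E: "norm (E Z) \<le> 32 * Z\<^sup>2 / T * S2" if "0 < Z" "Z \<le> real M" for Z
      unfolding E_def I_def wt_def S2_def by (rule perron_formula_truncated[OF sa F that T])
    have int: "(\<lambda>s. F s * perron_integrand Z s) contour_integrable_on linepath (Complex 2 (-T)) (Complex 2 T)" if "Z > 0" for Z
      by (intro contour_integrable_continuous_linepath continuous_on_subset[OF contp[OF that] segH])
    have "((\<lambda>s. (of_real (X + h) / of_real h) * (F s * perron_integrand (X + h) s) - (of_real X / of_real h) * (F s * perron_integrand X s))
       has_contour_integral ((of_real (X + h) / of_real h) * I 2 T (\<lambda>s. F s * perron_integrand (X + h) s)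
         - (of_real X / of_real h) * I 2 T (\<lambda>s. F s * perron_integrand X s))) (linepath (Complex 2 (-T)) (Complex 2 T))"
      unfolding I_def using X h
      by (intro has_contour_integral_diff has_contour_integral_lmul has_contour_integral_integral int) auto
    also have "(\<lambda>s. (of_real (X + h) / of_real h) * (F s * perron_integrand (X + h) s) - (of_real X / of_real h) * (F s * perron_integrand X s)) = G"
      unfolding G_def kereq by (simp add: fun_eq_iff diff_divide_distrib algebra_simps)
    finally have IG: "I 2 T G = (of_real (X + h) / of_real h) * I 2 T (\<lambda>s. F s * perron_integrand (X + h) s)
         - (of_real X / of_real h) * I 2 T (\<lambda>s. F s * perron_integrand X s)"
      unfolding I_def by (rule contour_integral_unique)
    have SS: "S = (of_real (X + h) / of_real h) * (\<Sum>n=1..M. a n * of_real (wt (X + h) n))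
         - (of_real X / of_real h) * (\<Sum>n=1..M. a n * of_real (wt X n))"
      unfolding S_def W_def sum_distrib_left sum_subtractf[symmetric]
      by (intro sum.cong refl) (simp add: diff_divide_distrib algebra_simps)
    have "I 2 T G - 2 * pi * \<i> * S = (of_real (X + h) / of_real h) * E (X + h) - (of_real X / of_real h) * E X"
      unfolding IG SS E_def by (simp add: algebra_simps)
    also have "norm \<dots> \<le> norm ((of_real (X + h) / of_real h) * E (X + h)) + norm ((of_real X / of_real h) * E X)"
      by (rule norm_triangle_ineq4)
    also have "\<dots> = (X + h) / h * norm (E (X + h)) + X / h * norm (E X)"
      using X h by (simp add: norm_mult norm_divide del: of_real_add)
    also have "\<dots> \<le> (X + h) / h * (32 * (X + h)\<^sup>2 / T * S2) + X / h * (32 * X\<^sup>2 / T * S2)"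
      using X h XM by (intro add_mono mult_left_mono E) auto
    also have "\<dots> = C1 / T" using T h by (simp add: C1_def field_simps)
    finally show ?thesis .
  qed
  have C2: "C2 \<ge> 0" using K by (simp add: C2_def)
  have C3: "C3 \<ge> 0" using K by (simp add: C3_def)
  have I2: "norm (I 2 T G - I \<sigma> T G) \<le> 4 * C2 / T" if T: "T \<ge> 6" for T
  proof -
    have "norm (I 2 T G - I \<sigma> T G) \<le> 2 * (2 - \<sigma>) * (C2 / T)"
      unfolding I_def
    proof (rule contour_integral_shift[OF holG])
      fix s assume s: "\<sigma> \<le> Re s" "Re s \<le> 2" "\<bar>Im s\<bar> = T"
      have "norm (G s) \<le> K * 3 * (2 * X) powr Re s * (12 * X / h) powr (2 * \<eta>) * (1 + \<bar>Im s\<bar>) powr (-1 - \<eta>)"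
        by (rule Gb[OF s(1,2)])
      also have "\<dots> \<le> C2 * T powr (-1)"
      proof -
        have "(1 + \<bar>Im s\<bar>) powr (-1 - \<eta>) \<le> (1 + \<bar>Im s\<bar>) powr (-1)"
          using s T \<eta> by (intro powr_mono) auto
        also have "\<dots> \<le> T powr (-1)" using s T by (intro powr_mono2') auto
        finally have 1: "(1 + \<bar>Im s\<bar>) powr (-1 - \<eta>) \<le> T powr (-1)" .
        have "(2 * X) powr Re s \<le> (2 * X) powr 2" using s X by (intro powr_mono) auto
        with 1 show ?thesis unfolding C2_def using K
          by (intro mult_mono[OF mult_right_mono[OF mult_left_mono]]) auto
      qed
      finally show "norm (G s) \<le> C2 / T" using T by (simp add: powr_minus divide_inverse)
    qed (use \<sigma> T C2 in auto)
    also have "\<dots> \<le> 4 * (C2 / T)" using \<sigma> C2 T by (intro mult_right_mono) auto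
    finally show ?thesis by simp
  qed
  have I3: "norm (I \<sigma> T G) \<le> C3 * (2 / \<eta>)" if T: "T \<ge> 6" for T
    unfolding I_def
  proof (rule vertical_integral_bound)
    show "continuous_on {s. Re s = \<sigma>} G"
      by (rule continuous_on_subset[OF holomorphic_on_imp_continuous_on[OF holG]]) (use \<sigma> in auto)
    show "norm (G s) \<le> C3 * (1 + \<bar>Im s\<bar>) powr (-1 - \<eta>)" if "Re s = \<sigma>" for s
      using Gb[of s] that \<sigma> by (simp add: C3_def)
  qed (use \<eta> T C3 in auto)
  have "norm (2 * pi * \<i> * S) \<le> C3 * (2 / \<eta>) + (C1 + 4 * C2) / T" if T: "T \<ge> 6" for T
  proof -
    have "2 * pi * \<i> * S = I \<sigma> T G + ((I 2 T G - I \<sigma> T G) - (I 2 T G - 2 * pi * \<i> * S))" by simp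
    also have "norm \<dots> \<le> C3 * (2 / \<eta>) + (4 * C2 / T + C1 / T)"
      by (intro order.trans[OF norm_triangle_ineq] add_mono I3 order.trans[OF norm_triangle_ineq4] I1 I2 T)
    finally show ?thesis by (simp add: add_divide_distrib algebra_simps)
  qed
  \<comment> \<open>\<open>C1\<close> and \<open>C2\<close> are large in terms of \<open>X\<close>
    but independent of \<open>T\<close>. Letting \<open>T\<close> tend to infinity removes the
    truncation error and the horizontal sides, and only the integral on the line
    \<open>Re s = \<sigma>\<close> survives.\<close>
  hence "eventually (\<lambda>T. norm (2 * pi * \<i> * S) \<le> C3 * (2 / \<eta>) + (C1 + 4 * C2) / T) at_top"
    by (auto intro: eventually_at_top_linorderI[of 6])
  moreover have "((\<lambda>T. C3 * (2 / \<eta>) + (C1 + 4 * C2) / T) \<longlongrightarrow> C3 * (2 / \<eta>) + 0) at_top"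
    by (intro tendsto_add tendsto_const tendsto_divide_0[OF tendsto_const] filterlim_at_top_imp_at_infinity filterlim_ident)
  ultimately have "norm (2 * pi * \<i> * S) \<le> C3 * (2 / \<eta>) + 0"
    by (intro tendsto_lowerbound) auto
  hence "2 * pi * norm S \<le> C3 * (2 / \<eta>)" by (simp add: norm_mult)
  moreover have "6 * norm S \<le> 2 * pi * norm S" using pi_gt3 by (intro mult_right_mono) auto
  moreover have "C3 \<le> 72 * K * X powr (1 / 2 + 2 * \<eta>)"
  proof -
    have "(2 * X) powr \<sigma> \<le> 2 powr 1 * X powr \<sigma>"
      using X \<sigma> powr_mono[of \<sigma> 1 2] by (subst powr_mult) (auto intro!: mult_right_mono)
    moreover have "(12 * X / h) powr (2 * \<eta>) \<le> 12 powr 1 * X powr \<eta>"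
    proof -
      have "X / h = X powr (1 / 2)" using h X by (simp add: h_def powr_half_sqrt real_div_sqrt)
      hence "(12 * X / h) powr (2 * \<eta>) = 12 powr (2 * \<eta>) * (X powr (1 / 2)) powr (2 * \<eta>)"
        using X h by (metis powr_mult times_divide_eq_right)
      also have "(X powr (1 / 2)) powr (2 * \<eta>) = X powr \<eta>" by (simp add: powr_powr)
      also have "12 powr (2 * \<eta>) * X powr \<eta> \<le> 12 powr 1 * X powr \<eta>"
        using \<eta> by (intro mult_right_mono powr_mono) auto
      finally show ?thesis .
    qed
    ultimately have "C3 \<le> K * 3 * (2 powr 1 * X powr \<sigma>) * (12 powr 1 * X powr \<eta>)"
      unfolding C3_def using K by (intro mult_mono) auto
    also have "\<dots> = 72 * K * (X powr \<sigma> * X powr \<eta>)" by simp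
    also have "X powr \<sigma> * X powr \<eta> = X powr (1 / 2 + 2 * \<eta>)"
      by (simp add: \<sigma>_def add_ac flip: powr_add)
    finally show ?thesis .
  qed
  ultimately have "6 * norm S \<le> 72 * K * X powr (1 / 2 + 2 * \<eta>) * (2 / \<eta>)"
    using \<eta> by (smt (verit) mult_right_mono divide_nonneg_pos)
  hence normS: "norm S \<le> 24 / \<eta> * K * X powr (1 / 2 + 2 * \<eta>)" using \<eta> by (simp add: field_simps)
  have "Y * wt Y n = max 0 (Y - real n)" if "Y > 0" for Y n
    using that by (simp add: wt_def max_def field_simps)
  hence W: "W n = (max 0 (X + h - real n) - max 0 (X - real n)) / h" for n
    using X h by (simp add: W_def)
  have W1: "W n = 1" if "n \<le> x" for n
    using that h unfolding W by (simp add: X_def)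
  have W2: "0 \<le> W n \<and> W n \<le> 1" if "n > x" for n
    using that h unfolding W by (simp add: X_def)
  have W3: "W n = 0" if "real n \<ge> X + h" for n
    using that h unfolding W by simp
  \<comment> \<open>After \<open>x\<close> only the next \<open>H\<close> integers can carry a
    nonzero weight: any later integer is at least \<open>X + h\<close>.\<close>
  define H where "H = nat \<lfloor>h\<rfloor>"
  have H: "real H \<le> h" "h < real H + 1" using h by (auto simp: H_def; linarith)+
  have HM: "x + H \<le> M" using H XM unfolding X_def by linarith
  have "S = (\<Sum>n=1..x. a n * of_real (W n)) + (\<Sum>n=x+1..M. a n * of_real (W n))"
    unfolding S_def by (rule sum.ub_add_nat[of 1 x _ x, folded mult_2, folded M_def]) simp
  also have "(\<Sum>n=1..x. a n * of_real (W n)) = (\<Sum>n=1..x. a n)" by (intro sum.cong) (auto simp: W1)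
  also have "(\<Sum>n=x+1..M. a n * of_real (W n)) = (\<Sum>n=x+1..x+H. a n * of_real (W n))"
  proof (rule sum.mono_neutral_right)
    show "\<forall>n\<in>{x + 1..M} - {x + 1..x + H}. a n * of_real (W n) = 0"
    proof
      fix n assume "n \<in> {x + 1..M} - {x + 1..x + H}"
      hence "n \<ge> x + H + 1" by auto
      hence "real n \<ge> X + h" using H unfolding X_def by linarith
      thus "a n * of_real (W n) = 0" by (simp add: W3)
    qed
  qed (use HM in auto)
  finally have "(\<Sum>n=1..x. a n) = S - (\<Sum>n=x+1..x+H. a n * of_real (W n))" by simp
  also have "norm \<dots> \<le> norm S + norm (\<Sum>n=x+1..x+H. a n * of_real (W n))" by (rule norm_triangle_ineq4)
  also have "norm (\<Sum>n=x+1..x+H. a n * of_real (W n)) \<le> (\<Sum>n=x+1..x+H. B * (2 * X) powr \<eta> * 1)"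
  proof (rule sum_norm_le)
    fix n assume n: "n \<in> {x+1..x+H}"
    hence "n \<le> M" using HM by simp
    have "norm (a n) \<le> B * real n powr \<eta>" by (rule a) (use n x in auto)
    also have "\<dots> \<le> B * (2 * X) powr \<eta>" using \<open>n \<le> M\<close> B \<eta>
      by (intro mult_left_mono powr_mono2) (auto simp: M_def X_def)
    finally have *: "norm (a n) \<le> B * (2 * X) powr \<eta>" .
    have "0 \<le> W n" "W n \<le> 1" using W2[of n] n by auto
    thus "norm (a n * of_real (W n)) \<le> B * (2 * X) powr \<eta> * 1"
      unfolding norm_mult using B * by (intro mult_mono) auto
  qed
  also have "\<dots> = real H * (B * (2 * X) powr \<eta>)" by simp
  also have "\<dots> \<le> X powr (1 / 2) * (B * (2 * X powr \<eta>))"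
  proof (intro mult_mono)
    show "real H \<le> X powr (1 / 2)" using H X by (simp add: h_def powr_half_sqrt)
    have "(2 * X) powr \<eta> = 2 powr \<eta> * X powr \<eta>" using X by (subst powr_mult) auto
    also have "\<dots> \<le> 2 powr 1 * X powr \<eta>" using \<eta> by (intro mult_right_mono powr_mono) auto
    finally show "(2 * X) powr \<eta> \<le> 2 * X powr \<eta>" by simp
  qed (use B in auto)
  also have "\<dots> = 2 * B * X powr (1 / 2 + \<eta>)" by (simp add: powr_add)
  also have "\<dots> \<le> 2 * B * X powr (1 / 2 + 2 * \<eta>)" using B X \<eta> by (intro mult_left_mono powr_mono) auto
  also have "\<dots> \<le> 24 / \<eta> * B * X powr (1 / 2 + 2 * \<eta>)"
    using B \<eta> by (intro mult_right_mono) (auto simp: field_simps)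
  finally have "norm (\<Sum>n=1..x. a n) \<le> 24 / \<eta> * K * X powr (1 / 2 + 2 * \<eta>) + 24 / \<eta> * B * X powr (1 / 2 + 2 * \<eta>)"
    using normS by linarith
  also have "\<dots> = 24 / \<eta> * (K + B) * X powr (1 / 2 + 2 * \<eta>)" by (simp add: algebra_simps add_divide_distrib)
  finally show ?thesis by (simp add: X_def)
qed

section \<open>Dirichlet series\<close>

lemma norm_of_nat_powr: "n > 0 \<Longrightarrow> norm (of_nat n powr s) = real n powr Re s"
  by (subst norm_powr_real_powr) auto

lemma summable_dirichlet_series:
  assumes a: "\<And>n. n \<ge> 1 \<Longrightarrow> norm (a n) \<le> B * real n powr \<eta>" and s: "Re s > 1 + \<eta>"
  shows "summable (\<lambda>n. norm (a (Suc n) / of_nat (Suc n) powr s))"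
proof (rule summable_comparison_test)
  show "summable (\<lambda>n. B * (1 + real n * 1) powr (- (Re s - \<eta>)))"
    by (intro summable_mult summable_arith_powr) (use s in auto)
  have "norm (a (Suc n) / of_nat (Suc n) powr s) \<le> B * (1 + real n * 1) powr (- (Re s - \<eta>))" for n
  proof -
    have "norm (a (Suc n) / of_nat (Suc n) powr s) = norm (a (Suc n)) / real (Suc n) powr Re s"
      by (simp only: norm_divide norm_of_nat_powr[of "Suc n"])
    also have "\<dots> \<le> B * real (Suc n) powr \<eta> / real (Suc n) powr Re s"
      by (intro divide_right_mono a) auto
    also have "\<dots> = B * (1 + real n * 1) powr (- (Re s - \<eta>))"
      by (simp add: powr_diff add_ac)
    finally show ?thesis .
  qed
  thus "\<exists>N. \<forall>n\<ge>N. norm (norm (a (Suc n) / of_nat (Suc n) powr s)) \<le> B * (1 + real n * 1) powr (- (Re s - \<eta>))"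
    by auto
qed

lemma has_sum_times_Sigma:
  fixes x y :: "nat \<Rightarrow> complex"
  assumes "(\<lambda>d. norm (x d)) summable_on A" "(\<lambda>e. norm (y e)) summable_on B" "(x has_sum X) A" "(y has_sum Y) B"
  shows "((\<lambda>(d, e). x d * y e) has_sum (X * Y)) (A \<times> B)"
proof -
  have "(\<lambda>p. norm (case p of (d, e) \<Rightarrow> x d * y e)) summable_on A \<times> B"
    unfolding Infinite_Sum.abs_summable_on_Sigma_iff
  proof (intro conjI ballI)
    show "(\<lambda>e. norm (case (d, e) of (d, e) \<Rightarrow> x d * y e)) summable_on B" for d
      using summable_on_cmult_right[OF assms(2), of "norm (x d)"] by (simp add: norm_mult)
    have eq: "infsum (\<lambda>e. norm (case (d, e) of (d, e) \<Rightarrow> x d * y e)) B = norm (x d) * infsum (\<lambda>e. norm (y e)) B" for d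
      by (simp add: norm_mult infsum_cmult_right')
    have "(\<lambda>d. norm (norm (x d) * infsum (\<lambda>e. norm (y e)) B)) summable_on A"
      using summable_on_cmult_left[OF assms(1)] by (simp add: abs_mult infsum_nonneg)
    thus "(\<lambda>d. norm (infsum (\<lambda>e. norm (case (d, e) of (d, e) \<Rightarrow> x d * y e)) B)) summable_on A"
      unfolding eq .
  qed
  hence "(\<lambda>(d, e). x d * y e) summable_on A \<times> B" by (rule Infinite_Sum.abs_summable_summable)
  then obtain S where S: "((\<lambda>(d, e). x d * y e) has_sum S) (A \<times> B)" by (auto simp: summable_on_def)
  have "((\<lambda>d. x d * Y) has_sum S) A"
    by (rule has_sum_SigmaD[OF S]) (use has_sum_cmult_right[OF assms(4)] in auto)
  moreover have "((\<lambda>d. x d * Y) has_sum (X * Y)) A" by (rule has_sum_cmult_left[OF assms(3)])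
  ultimately have "S = X * Y" using has_sum_unique by blast
  thus ?thesis using S by simp
qed

text \<open>Absolute convergence allows the double series over pairs \<open>(d, e)\<close> to be
  regrouped by the product \<open>n = d * e\<close>, recorded as pairs of \<open>n\<close> and a
  divisor \<open>d\<close>.\<close>

lemma dirichlet_product:
  fixes a b :: "nat \<Rightarrow> complex"
  assumes a: "summable (\<lambda>n. norm (a (Suc n) / of_nat (Suc n) powr s))" "(\<lambda>n. a (Suc n) / of_nat (Suc n) powr s) sums A"
    and b: "summable (\<lambda>n. norm (b (Suc n) / of_nat (Suc n) powr s))" "(\<lambda>n. b (Suc n) / of_nat (Suc n) powr s) sums B"
  shows "(\<lambda>n. (\<Sum>d | d dvd Suc n. a d * b (Suc n div d)) / of_nat (Suc n) powr s) sums (A * B)"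
proof -
  define N where "N = range Suc"
  have N: "n \<in> N \<longleftrightarrow> n > 0" for n by (auto simp: N_def gr0_conv_Suc)
  have reindex: "(g has_sum c) N \<longleftrightarrow> ((\<lambda>n. g (Suc n)) has_sum c) UNIV" for g :: "nat \<Rightarrow> 'b :: {comm_monoid_add,topological_space}" and c
    unfolding N_def by (subst has_sum_reindex) (auto simp: o_def)
  define x y where "x = (\<lambda>n. a n / of_nat n powr s)" and "y = (\<lambda>n. b n / of_nat n powr s)"
  have abs: "(\<lambda>n. norm (g n)) summable_on N" if "summable (\<lambda>n. norm (g (Suc n)))" for g :: "nat \<Rightarrow> complex"
  proof -
    have "(\<lambda>n. norm (g (Suc n))) summable_on UNIV"
      by (rule norm_summable_imp_summable_on) (use that in simp)
    thus ?thesis using reindex[of "\<lambda>n. norm (g n)"] by (simp add: summable_on_def)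
  qed
  have x: "(\<lambda>n. norm (x n)) summable_on N" "(x has_sum A) N"
    using abs[of x] a norm_summable_imp_has_sum[OF a] by (simp_all add: x_def reindex del: of_nat_Suc)
  have y: "(\<lambda>n. norm (y n)) summable_on N" "(y has_sum B) N"
    using abs[of y] b norm_summable_imp_has_sum[OF b] by (simp_all add: y_def reindex del: of_nat_Suc)
  have "((\<lambda>(d, e). x d * y e) has_sum (A * B)) (N \<times> N)"
    by (rule has_sum_times_Sigma[OF x(1) y(1) x(2) y(2)])
  also have "((\<lambda>(d, e). x d * y e) has_sum (A * B)) (N \<times> N) \<longleftrightarrow>
      ((\<lambda>(n, d). x d * y (n div d)) has_sum (A * B)) (Sigma N (\<lambda>n. {d. d dvd n}))"
    by (rule has_sum_reindex_bij_witness[where j = "\<lambda>(d, e). (d * e, d)" and i = "\<lambda>(n, d). (d, n div d)"])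
       (auto simp: N elim!: dvdE)
  finally have "((\<lambda>n. \<Sum>d | d dvd n. x d * y (n div d)) has_sum (A * B)) N"
    by (rule has_sum_SigmaD) (auto simp: N intro!: has_sum_finiteI)
  hence "(\<lambda>n. \<Sum>d | d dvd Suc n. x d * y (Suc n div d)) sums (A * B)"
    unfolding reindex by (rule has_sum_imp_sums)
  also have "(\<lambda>n. \<Sum>d | d dvd Suc n. x d * y (Suc n div d)) =
      (\<lambda>n. (\<Sum>d | d dvd Suc n. a d * b (Suc n div d)) / of_nat (Suc n) powr s)"
  proof
    fix n
    have "x d * y (Suc n div d) = a d * b (Suc n div d) / of_nat (Suc n) powr s" if "d dvd Suc n" for d
    proof -
      from that obtain e where e: "Suc n = d * e" by blast
      have "d > 0" using e by (cases d) auto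
      have "(of_nat (Suc n) :: complex) powr s = of_nat d powr s * of_nat e powr s"
        unfolding e of_nat_mult by (rule powr_times_real) auto
      thus ?thesis using \<open>d > 0\<close> unfolding x_def y_def e by simp
    qed
    thus "(\<Sum>d | d dvd Suc n. x d * y (Suc n div d)) = (\<Sum>d | d dvd Suc n. a d * b (Suc n div d)) / of_nat (Suc n) powr s"
      unfolding sum_divide_distrib by (intro sum.cong) auto
  qed
  finally show ?thesis .
qed

section \<open>The von Mangoldt function and logarithmic derivatives\<close>

lemma norm_mangoldt_le_powr:
  assumes "n \<ge> 1" "\<eta> > 0"
  shows "norm (mangoldt n :: complex) \<le> 1 / \<eta> * real n powr \<eta>"
  using mangoldt_le[of n] ln_powr_bound[of "real n" \<eta>] assms by simp

lemma norm_mangoldt_times_le: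
  assumes "n \<ge> 1" "\<eta> > 0" "norm z \<le> 1"
  shows "norm (mangoldt n * z :: complex) \<le> 1 / \<eta> * real n powr \<eta>"
proof -
  have "norm (mangoldt n * z) \<le> norm (mangoldt n :: complex) * 1"
    unfolding norm_mult using assms(3) by (intro mult_left_mono) (auto simp: mangoldt_nonneg)
  thus ?thesis using norm_mangoldt_le_powr[OF assms(1,2)] by simp
qed

lemma has_field_derivative_of_nat_Suc_powr:
  "((\<lambda>s. of_nat (Suc n) powr (-s) :: complex) has_field_derivative - (of_real (ln (real (Suc n))) * of_nat (Suc n) powr (-s))) (at s)"
proof -
  have "((\<lambda>s. of_nat (Suc n) powr (-s) :: complex) has_field_derivative (Ln (of_nat (Suc n)) * of_nat (Suc n) powr (-s)) * (-1)) (at s)"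
    by (rule DERIV_chain2[OF has_field_derivative_powr_right]) (auto intro!: derivative_eq_intros simp del: of_nat_Suc)
  thus ?thesis using Ln_of_real[of "real (Suc n)"] by (simp del: of_nat_Suc)
qed

lemma sums_dirichlet_series_deriv:
  fixes a :: "nat \<Rightarrow> complex"
  assumes bdd: "\<And>n. norm (a n) \<le> 1" and s: "Re s > 1"
    and A: "\<And>s. Re s > 1 \<Longrightarrow> (\<lambda>n. a (Suc n) / of_nat (Suc n) powr s) sums A s"
  shows "\<exists>D. (\<lambda>n. a (Suc n) * ln (real (Suc n)) / of_nat (Suc n) powr s) sums D \<and> (A has_field_derivative - D) (at s)"
proof -
  define H where "H = {s. Re s > (1::real)}"
  have opH: "open H" unfolding H_def by (rule open_halfspace_Re_gt)
  define f where "f = (\<lambda>n s. a (Suc n) / of_nat (Suc n) powr s)"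
  define f' where "f' = (\<lambda>n s. - (a (Suc n) * ln (real (Suc n)) / of_nat (Suc n) powr s))"
  have "\<exists>g g'. \<forall>x\<in>H. ((\<lambda>n. f n x) sums g x) \<and> ((\<lambda>n. f' n x) sums g' x) \<and> (g has_field_derivative g' x) (at x)"
  proof (rule series_and_derivative_comparison_complex[OF opH])
    fix n x
    have "((\<lambda>s. a (Suc n) * of_nat (Suc n) powr (-s)) has_field_derivative f' n x) (at x)"
      by (rule DERIV_cong[OF DERIV_cmult[OF has_field_derivative_of_nat_Suc_powr]])
         (simp add: f'_def powr_minus divide_inverse mult_ac del: of_nat_Suc)
    also have "(\<lambda>s. a (Suc n) * of_nat (Suc n) powr (-s)) = f n"
      by (simp add: f_def powr_minus divide_inverse fun_eq_iff)
    finally show "(f n has_field_derivative f' n x) (at x)" .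
  next
    fix x assume x: "x \<in> H"
    \<comment> \<open>Half of the distance to the line \<open>Re s = 1\<close>: on the ball of this
      radius the real part stays at least \<open>1 + d\<close>, and the series is dominated by a
      convergent one.\<close>
    define d where "d = (Re x - 1) / 2"
    have d: "d > 0" "1 + d = Re x - d" using x by (auto simp: H_def d_def field_simps)
    define h where "h = (\<lambda>n. complex_of_real ((1 + real n * 1) powr (- (1 + d))))"
    have "summable h" unfolding h_def
      by (intro summable_of_real summable_arith_powr) (use d in auto)
    moreover have "range h \<subseteq> \<real>\<^sub>\<ge>\<^sub>0" by (auto simp: h_def)
    moreover have "norm (f n y) \<le> norm (h n)" if "y \<in> ball x d \<inter> H" for n y
    proof -
      have "\<bar>Re x - Re y\<bar> \<le> norm (x - y)" using abs_Re_le_cmod[of "x - y"] by simp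
      hence Re: "Re y \<ge> 1 + d" using that d by (auto simp: dist_norm)
      have "norm (f n y) = norm (a (Suc n)) * real (Suc n) powr (- Re y)"
        unfolding f_def norm_divide norm_of_nat_powr[OF zero_less_Suc] by (simp add: powr_minus divide_inverse)
      also have "\<dots> \<le> 1 * real (Suc n) powr (- (1 + d))"
        using Re bdd by (intro mult_mono powr_mono) auto
      also have "\<dots> = norm (h n)" by (simp add: h_def add_ac)
      finally show ?thesis .
    qed
    ultimately show "\<exists>d h. 0 < d \<and> summable h \<and> range h \<subseteq> \<real>\<^sub>\<ge>\<^sub>0 \<and> (\<forall>\<^sub>F n in sequentially. \<forall>y\<in>ball x d \<inter> H. cmod (f n y) \<le> cmod (h n))"
      using d by (intro exI[of _ d] exI[of _ h]) auto
  qed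
  then obtain g g' where g: "\<And>x. x \<in> H \<Longrightarrow> (\<lambda>n. f n x) sums g x" "\<And>x. x \<in> H \<Longrightarrow> (\<lambda>n. f' n x) sums g' x"
    "\<And>x. x \<in> H \<Longrightarrow> (g has_field_derivative g' x) (at x)" by blast
  have gA: "g x = A x" if "x \<in> H" for x
    using g(1)[OF that] A[of x] that sums_unique2 unfolding f_def H_def by blast
  have sH: "s \<in> H" using s by (simp add: H_def)
  have "(A has_field_derivative g' s) (at s)"
    by (rule has_field_derivative_transform_within_open[OF g(3)[OF sH] opH sH gA])
  moreover have "(\<lambda>n. a (Suc n) * ln (real (Suc n)) / of_nat (Suc n) powr s) sums (- g' s)"
    using sums_minus[OF g(2)[OF sH]] by (simp add: f'_def)
  ultimately show ?thesis by force
qed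

text \<open>Differentiation multiplies the coefficients by minus \<open>ln n\<close>, which is the
  sum of the von Mangoldt function over the divisors of \<open>n\<close>. By complete
  multiplicativity the resulting series is the Dirichlet product of \<open>W\<close> and
  \<open>A s\<close>.\<close>

lemma dirichlet_log_derivative:
  fixes a :: "nat \<Rightarrow> complex"
  assumes mult: "\<And>m n. a (m * n) = a m * a n" and bdd: "\<And>n. norm (a n) \<le> 1" and s: "Re s > 1"
    and A: "\<And>s. Re s > 1 \<Longrightarrow> (\<lambda>n. a (Suc n) / of_nat (Suc n) powr s) sums A s"
  shows "\<exists>W. (\<lambda>n. mangoldt (Suc n) * a (Suc n) / of_nat (Suc n) powr s) sums W \<and> (A has_field_derivative - (A s * W)) (at s)"
proof -
  obtain D where D: "(\<lambda>n. a (Suc n) * ln (real (Suc n)) / of_nat (Suc n) powr s) sums D" "(A has_field_derivative - D) (at s)"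
    using sums_dirichlet_series_deriv[OF bdd s A] by blast
  define \<eta> where "\<eta> = (Re s - 1) / 2"
  have \<eta>: "\<eta> > 0" "Re s > 1 + \<eta>" using s by (auto simp: \<eta>_def field_simps)
  have sm: "summable (\<lambda>n. norm (mangoldt (Suc n) * a (Suc n) / of_nat (Suc n) powr s))"
  proof (rule summable_dirichlet_series[where a = "\<lambda>n. mangoldt n * a n" and B = "1 / \<eta>" and \<eta> = \<eta>])
    show "norm (mangoldt n * a n) \<le> 1 / \<eta> * real n powr \<eta>" if "n \<ge> 1" for n
      by (rule norm_mangoldt_times_le[OF that \<eta>(1) bdd])
  qed (use \<eta> in auto)
  have sa: "summable (\<lambda>n. norm (a (Suc n) / of_nat (Suc n) powr s))"
    by (rule summable_dirichlet_series[where B = 1 and \<eta> = 0]) (use bdd s in auto)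
  define W where "W = (\<Sum>n. mangoldt (Suc n) * a (Suc n) / of_nat (Suc n) powr s)"
  have W: "(\<lambda>n. mangoldt (Suc n) * a (Suc n) / of_nat (Suc n) powr s) sums W"
    unfolding W_def by (rule summable_sums[OF summable_norm_cancel[OF sm]])
  have "(\<lambda>n. (\<Sum>d | d dvd Suc n. mangoldt d * a d * a (Suc n div d)) / of_nat (Suc n) powr s) sums (W * A s)"
    by (rule dirichlet_product[OF sm W sa A[OF s]])
  also have "(\<lambda>n. (\<Sum>d | d dvd Suc n. mangoldt d * a d * a (Suc n div d)) / of_nat (Suc n) powr s) =
     (\<lambda>n. a (Suc n) * ln (real (Suc n)) / of_nat (Suc n) powr s)"
  proof
    fix n
    have "(\<Sum>d | d dvd Suc n. mangoldt d * a d * a (Suc n div d)) = (\<Sum>d | d dvd Suc n. mangoldt d) * a (Suc n)"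
      unfolding sum_distrib_right
    proof (rule sum.cong[OF refl])
      fix d assume "d \<in> {d. d dvd Suc n}"
      hence "a d * a (Suc n div d) = a (Suc n)" by (simp flip: mult)
      thus "mangoldt d * a d * a (Suc n div d) = mangoldt d * a (Suc n)" by (simp add: mult.assoc)
    qed
    thus "(\<Sum>d | d dvd Suc n. mangoldt d * a d * a (Suc n div d)) / of_nat (Suc n) powr s = a (Suc n) * ln (real (Suc n)) / of_nat (Suc n) powr s"
      by (simp add: mangoldt_sum mult.commute del: of_nat_Suc)
  qed
  finally have "D = A s * W" using D(1) sums_unique2 by (simp add: mult.commute)
  thus ?thesis using W D(2) by blast
qed

section \<open>Moebius inversion\<close>

lemma moebius_mu_mult_prime:
  assumes "prime p" "\<not> p dvd d" "squarefree d"
  shows "moebius_mu (p * d) = - moebius_mu d"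
proof -
  have "d \<noteq> 0" using assms(2) by (cases "d = 0") auto
  have cop: "coprime p d" using assms prime_imp_coprime by blast
  have "squarefree (p * d)" by (rule squarefree_mult_coprime[OF cop squarefree_prime[OF assms(1)] assms(3)])
  moreover have "prime_factors (p * d) = insert p (prime_factors d)"
    using \<open>d \<noteq> 0\<close> assms(1) by (subst prime_factors_product) (auto simp: prime_prime_factors)
  moreover have "p \<notin> prime_factors d" using assms(2) by (auto simp: prime_factors_dvd)
  ultimately show ?thesis using assms(3) by (simp add: moebius_mu_def)
qed

text \<open>For a prime \<open>p\<close> dividing \<open>n\<close>, the squarefree divisors come in
  pairs \<open>d\<close>, \<open>p * d\<close> with \<open>p\<close> not dividing \<open>d\<close>,
  and the two values in a pair cancel.\<close>

lemma sum_moebius_mu_dvd: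
  assumes "n > 0"
  shows "(\<Sum>d | d dvd n. moebius_mu d) = (if n = 1 then 1 else 0)"
proof (cases "n = 1")
  case True
  thus ?thesis by (simp add: moebius_mu_def)
next
  case False
  then obtain p where p: "prime p" "p dvd n" using prime_factor_nat by blast
  define D where "D = {d. d dvd n \<and> squarefree d}"
  define D0 where "D0 = {d \<in> D. \<not> p dvd d}"
  have fin: "finite {d. d dvd n}" using assms by simp
  hence fD: "finite D" "finite D0" unfolding D_def D0_def by auto
  have p0: "p > 0" using p(1) by (simp add: prime_gt_0_nat)
  have Dp: "{d \<in> D. p dvd d} = (*) p ` D0"
  proof (intro equalityI subsetI)
    fix d assume "d \<in> {d \<in> D. p dvd d}"
    then obtain e where e: "d = p * e" "d dvd n" "squarefree d" by (auto simp: D_def)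
    have "\<not> p dvd e"
    proof
      assume "p dvd e"
      hence "p ^ 2 dvd d" unfolding e(1) power2_eq_square by (rule mult_dvd_mono[OF dvd_refl])
      hence "p dvd 1" using e(3) squarefreeD by blast
      thus False using p(1) by simp
    qed
    moreover have "e dvd n" "squarefree e" using e by (auto intro: dvd_trans[of e d] squarefree_mono[of e d])
    ultimately show "d \<in> (*) p ` D0" using e(1) by (auto simp: D0_def D_def)
  next
    fix d assume "d \<in> (*) p ` D0"
    then obtain e where e: "d = p * e" "e dvd n" "squarefree e" "\<not> p dvd e" by (auto simp: D0_def D_def)
    have cop: "coprime p e" using e(4) p(1) prime_imp_coprime by blast
    have "d dvd n" using divides_mult[OF p(2) e(2) cop] e(1) by simp
    moreover have "squarefree d" unfolding e(1) by (rule squarefree_mult_coprime[OF cop squarefree_prime[OF p(1)] e(3)])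
    ultimately show "d \<in> {d \<in> D. p dvd d}" by (simp add: D_def e(1))
  qed
  have "(\<Sum>d | d dvd n. moebius_mu d) = (\<Sum>d\<in>D. moebius_mu d)"
    using fin by (intro sum.mono_neutral_right) (auto simp: D_def moebius_mu_def)
  also have "\<dots> = (\<Sum>d\<in>D0. moebius_mu d) + (\<Sum>d\<in>{d \<in> D. p dvd d}. moebius_mu d)"
    using fD by (subst sum.union_disjoint[symmetric]) (auto simp: D0_def intro!: sum.cong)
  also have "(\<Sum>d\<in>{d \<in> D. p dvd d}. moebius_mu d) = (\<Sum>d\<in>D0. moebius_mu (p * d))"
    unfolding Dp using p0 by (subst sum.reindex) (auto simp: inj_on_def)
  also have "\<dots> = (\<Sum>d\<in>D0. - moebius_mu d)"
    by (intro sum.cong refl moebius_mu_mult_prime p) (auto simp: D0_def D_def)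
  finally show ?thesis using False by (simp add: sum_negf)
qed

lemma norm_moebius_mu_le: "norm (of_int (moebius_mu n) :: complex) \<le> 1"
  by (simp add: moebius_mu_def norm_power)

section \<open>Dirichlet characters and their L-functions for \<open>Re s > 0\<close>\<close>

lemma dirichlet_character_1: "dirichlet_character q \<xi> \<Longrightarrow> \<xi> 1 = 1"
  unfolding dirichlet_character_def by (metis coprime_1_left mult_cancel_left1 mult_1)

lemma norm_dirichlet_character:
  assumes "dirichlet_character q \<xi>"
  shows "norm (\<xi> a) = (if coprime a q then 1 else 0)"
proof (cases "coprime a q")
  case True
  have mult: "\<And>a b. \<xi> (a * b) = \<xi> a * \<xi> b" and q: "q > 0" using assms by (auto simp: dirichlet_character_def)
  have "\<xi> (a ^ n) = \<xi> a ^ n" for n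
    by (induction n) (use mult dirichlet_character_1[OF assms] in auto)
  hence "\<xi> a ^ totient q = \<xi> (a ^ totient q)" by simp
  also have "\<dots> = \<xi> 1"
    by (rule dirichlet_character_cong[OF assms]) (use True in \<open>rule euler_theorem\<close>)
  finally have "norm (\<xi> a) ^ totient q = 1"
    using dirichlet_character_1[OF assms] by (metis norm_one norm_power)
  thus ?thesis using power_eq_imp_eq_base[of "norm (\<xi> a)" "totient q" 1] True q by simp
qed (use assms in \<open>auto simp: dirichlet_character_def\<close>)

lemma norm_dirichlet_character_le_1: "dirichlet_character q \<xi> \<Longrightarrow> norm (\<xi> a) \<le> 1"
  by (simp add: norm_dirichlet_character)

text \<open>Multiplication by the unit \<open>b\<close> permutes the reduced residues, so the sum
  equals \<open>z\<close> times itself.\<close>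

lemma sum_dirichlet_character_multiplier:
  assumes mult: "\<And>a. coprime a q \<Longrightarrow> f (b * a mod q) = z * f (a::nat)" and b: "coprime b q" and q: "q > 0"
    and z: "z \<noteq> (1::complex)" and 0: "\<And>a. \<not> coprime a q \<Longrightarrow> f a = 0"
  shows "(\<Sum>a<q. f a) = 0"
proof -
  define R where "R = {a \<in> {..<q}. coprime a q}"
  have cop: "coprime (b * a mod q) q" if "a \<in> R" for a
    using that b by (simp add: R_def coprime_mod_left_iff q)
  have inj: "inj_on (\<lambda>a. b * a mod q) R"
  proof (rule inj_onI)
    fix x y assume "x \<in> R" "y \<in> R" "b * x mod q = b * y mod q"
    moreover from this have "[x = y] (mod q)"
      using b cong_mult_lcancel_nat[of b q x y] by (simp add: cong_def coprime_commute)
    ultimately show "x = y" by (simp add: R_def cong_def)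
  qed
  have "(\<lambda>a. b * a mod q) ` R \<subseteq> R" using cop q by (auto simp: R_def)
  hence img: "(\<lambda>a. b * a mod q) ` R = R"
    using inj by (intro endo_inj_surj) (auto simp: R_def)
  have S: "(\<Sum>a<q. f a) = (\<Sum>a\<in>R. f a)"
    by (rule sum.mono_neutral_right) (auto simp: R_def 0)
  have "(\<Sum>a\<in>R. f a) = (\<Sum>a\<in>(\<lambda>a. b * a mod q) ` R. f a)" by (simp only: img)
  also have "\<dots> = (\<Sum>a\<in>R. f (b * a mod q))" by (subst sum.reindex[OF inj]) simp
  also have "\<dots> = z * (\<Sum>a\<in>R. f a)"
    unfolding sum_distrib_left by (intro sum.cong refl mult) (auto simp: R_def)
  finally show ?thesis using z S by (simp add: algebra_simps)
qed

lemma dirichlet_character_mod: "dirichlet_character q \<xi> \<Longrightarrow> \<xi> (a mod q) = \<xi> a"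
  by (rule dirichlet_character_cong) (auto simp: cong_def)

lemma dirichlet_character_orthogonal:
  assumes "dirichlet_character q \<xi>" "dirichlet_character q \<psi>" "\<xi> \<noteq> \<psi>"
  shows "(\<Sum>a<q. \<xi> a * cnj (\<psi> a)) = 0"
proof -
  have q: "q > 0" using assms(1) by (simp add: dirichlet_character_def)
  obtain b where b: "\<xi> b \<noteq> \<psi> b" using assms(3) by blast
  have cb: "coprime b q" using b assms by (auto simp: dirichlet_character_def)
  have one: "\<psi> b * cnj (\<psi> b) = 1"
    using norm_dirichlet_character[OF assms(2), of b] cb by (simp add: complex_norm_square[symmetric])
  have ne: "\<xi> b * cnj (\<psi> b) \<noteq> 1"
  proof
    assume "\<xi> b * cnj (\<psi> b) = 1"
    hence "\<xi> b * cnj (\<psi> b) = \<psi> b * cnj (\<psi> b)" using one by simp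
    moreover have "cnj (\<psi> b) \<noteq> 0" using one by auto
    ultimately show False using b by simp
  qed
  show ?thesis
  proof (rule sum_dirichlet_character_multiplier[OF _ cb q ne])
    show "\<xi> (b * a mod q) * cnj (\<psi> (b * a mod q)) = \<xi> b * cnj (\<psi> b) * (\<xi> a * cnj (\<psi> a))" for a
      using assms by (simp add: dirichlet_character_mod) (simp add: dirichlet_character_def)
    show "\<xi> a * cnj (\<psi> a) = 0" if "\<not> coprime a q" for a
      using that assms by (auto simp: dirichlet_character_def)
  qed
qed

lemma dirichlet_character_principal:
  assumes "q > 0"
  shows "dirichlet_character q (principal_character q)"
proof -
  have "coprime (a + q) q \<longleftrightarrow> coprime a q" for a by (simp add: coprime_iff_gcd_eq_1)
  thus ?thesis using assms by (simp add: dirichlet_character_def principal_character_def)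
qed

lemma sum_nonprincipal_character:
  assumes "\<xi> \<in> nonprincipal_characters q"
  shows "(\<Sum>a<q. \<xi> a) = 0"
proof -
  have \<xi>: "dirichlet_character q \<xi>" "\<xi> \<noteq> principal_character q" using assms by (auto simp: nonprincipal_characters_def)
  hence "q > 0" by (simp add: dirichlet_character_def)
  have "(\<Sum>a<q. \<xi> a * cnj (principal_character q a)) = 0"
    by (rule dirichlet_character_orthogonal) (use \<xi> dirichlet_character_principal[OF \<open>q > 0\<close>] in auto)
  also have "(\<Sum>a<q. \<xi> a * cnj (principal_character q a)) = (\<Sum>a<q. \<xi> a)"
    using \<xi>(1) by (intro sum.cong) (auto simp: principal_character_def dirichlet_character_def)
  finally show ?thesis .
qed

text \<open>
  The sum of \<open>|\<Sum>\<xi>\<in>X. \<xi> a|\<^sup>2\<close> over the residues \<open>a\<close> is \<open>card X * totient q\<close> by orthogonality,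
  and its term for \<open>a = 1\<close> is already \<open>(card X)\<^sup>2\<close>.
\<close>

lemma card_dirichlet_characters_le:
  assumes q: "q > 0" and X: "X \<subseteq> {\<xi>. dirichlet_character q \<xi>}"
  shows "card X \<le> totient q"
proof -
  have fin: "finite X" using X finite_dirichlet_characters finite_subset by blast
  define T where "T = (\<Sum>a<q. (\<Sum>\<xi>\<in>X. \<xi> a) * cnj (\<Sum>\<xi>\<in>X. \<xi> a))"
  have tot: "(\<Sum>a<q. \<xi> a * cnj (\<xi> a)) = of_nat (totient q)" if "\<xi> \<in> X" for \<xi>
  proof -
    have \<xi>: "dirichlet_character q \<xi>" using that X by blast
    have "(\<Sum>a<q. \<xi> a * cnj (\<xi> a)) = (\<Sum>a<q. if coprime a q then 1 else 0)"
      using norm_dirichlet_character[OF \<xi>] by (intro sum.cong) (auto simp: complex_norm_square[symmetric])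
    also have "\<dots> = of_nat (card {a \<in> {..<q}. coprime a q})" by (simp add: sum.If_cases Int_def)
    also have "card {a \<in> {..<q}. coprime a q} = totient q"
    \<comment> \<open>The set \<open>totatives 1\<close> is \<open>{1}\<close>, whereas the only
      residue below 1 is 0, so this modulus has to be treated apart.\<close>
    proof (cases "q = 1")
      case True
      hence "{a \<in> {..<q}. coprime a q} = {0}" by auto
      thus ?thesis using True by simp
    next
      case False
      have "{a \<in> {..<q}. coprime a q} = totatives q"
        using False q by (auto simp: totatives_def intro!: gr0I le_neq_implies_less)
      thus ?thesis by (simp add: totient_def)
    qed
    finally show ?thesis .
  qed
  have "T = (\<Sum>a<q. \<Sum>\<xi>\<in>X. \<Sum>\<psi>\<in>X. \<xi> a * cnj (\<psi> a))"
    unfolding T_def by (simp add: sum_product)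
  also have "\<dots> = (\<Sum>\<xi>\<in>X. \<Sum>a<q. \<Sum>\<psi>\<in>X. \<xi> a * cnj (\<psi> a))" by (rule sum.swap)
  also have "\<dots> = (\<Sum>\<xi>\<in>X. \<Sum>\<psi>\<in>X. \<Sum>a<q. \<xi> a * cnj (\<psi> a))" by (rule sum.cong[OF refl sum.swap])
  also have "\<dots> = (\<Sum>\<xi>\<in>X. \<Sum>\<psi>\<in>X. if \<xi> = \<psi> then of_nat (totient q) else 0)"
  proof (intro sum.cong refl)
    fix \<xi> \<psi> assume "\<xi> \<in> X" "\<psi> \<in> X"
    thus "(\<Sum>a<q. \<xi> a * cnj (\<psi> a)) = (if \<xi> = \<psi> then of_nat (totient q) else 0)"
      using X tot[of \<xi>] dirichlet_character_orthogonal[of q \<xi> \<psi>] by auto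
  qed
  also have "\<dots> = of_nat (card X * totient q)" using fin by simp
  finally have T: "T = of_nat (card X * totient q)" .
  define t where "t = (\<lambda>a. (norm (\<Sum>\<xi>\<in>X. \<xi> a))\<^sup>2)"
  have "T = of_real (\<Sum>a<q. t a)" unfolding T_def t_def of_real_sum complex_norm_square ..
  hence t: "(\<Sum>a<q. t a) = real (card X * totient q)"
    using T by (metis of_real_eq_iff of_real_of_nat_eq)
  \<comment> \<open>Writing \<open>1 mod q\<close> covers \<open>q = 1\<close>, where the residue of
    1 is 0.\<close>
  have "t (1 mod q) = real (card X) ^ 2"
  proof -
    have "(\<Sum>\<xi>\<in>X. \<xi> (1 mod q)) = (\<Sum>\<xi>\<in>X. 1)"
    proof (rule sum.cong[OF refl])
      fix \<xi> assume "\<xi> \<in> X"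
      hence "dirichlet_character q \<xi>" using X by blast
      thus "\<xi> (1 mod q) = 1" by (simp only: dirichlet_character_mod dirichlet_character_1)
    qed
    thus ?thesis by (simp add: t_def)
  qed
  moreover have "t (1 mod q) \<le> (\<Sum>a<q. t a)"
    by (rule member_le_sum) (use q in \<open>auto simp: t_def\<close>)
  ultimately have "real (card X * card X) \<le> real (card X * totient q)"
    unfolding t by (simp add: power2_eq_square)
  hence "card X * card X \<le> card X * totient q" by (simp only: of_nat_le_iff)
  thus ?thesis by (cases "card X = 0") auto
qed

section \<open>Continuation to Re s > 0 with explicit bounds\<close>

lemma is_dirichlet_L_dirichlet_L:
  assumes "q > 0" "\<And>n. a (n + q) = a n"
  shows "is_dirichlet_L a (dirichlet_L a)"
  unfolding dirichlet_L_def using theI'[OF ex1_dirichlet_L[of q a, OF assms]] .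

text \<open>Comparison with the integral of \<open>x powr (- (\<sigma> + 1))\<close> over the
  half-line from 1, carried out by the mean value theorem and telescoping.\<close>

lemma sums_powr_le:
  assumes \<sigma>: "\<sigma> > (0::real)"
  shows "(\<Sum>n. real (Suc n) powr (- (\<sigma> + 1))) \<le> 1 + 1 / \<sigma>"
    and "summable (\<lambda>n. real (Suc n) powr (- (\<sigma> + 1)))"
proof -
  define f where "f = (\<lambda>n. real (Suc n) powr (- (\<sigma> + 1)))"
  show sm: "summable f" unfolding f_def
    using summable_arith_powr[of 1 1 "\<sigma> + 1"] \<sigma> by (simp add: add_ac)
  have step: "f (Suc n) \<le> 1 / \<sigma> * (real (Suc n) powr (-\<sigma>) - real (Suc (Suc n)) powr (-\<sigma>))" for n
  proof -
    have "\<exists>z. real (Suc n) < z \<and> z < real (Suc (Suc n)) \<and>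
      real (Suc (Suc n)) powr (-\<sigma>) - real (Suc n) powr (-\<sigma>) = (real (Suc (Suc n)) - real (Suc n)) * (-\<sigma> * z powr (-\<sigma> - 1))"
    proof (rule MVT2)
      fix x assume "real (Suc n) \<le> x"
      thus "((\<lambda>x. x powr (-\<sigma>)) has_real_derivative -\<sigma> * x powr (-\<sigma> - 1)) (at x)"
        by (intro has_real_derivative_powr) simp
    qed simp
    then obtain z where z: "real (Suc n) < z" "z < real (Suc (Suc n))"
      "real (Suc n) powr (-\<sigma>) - real (Suc (Suc n)) powr (-\<sigma>) = \<sigma> * z powr (-\<sigma> - 1)" by (auto simp: algebra_simps)
    have "real (Suc (Suc n)) powr (- (\<sigma> + 1)) \<le> z powr (- (\<sigma> + 1))"
      using z \<sigma> by (intro powr_mono2') auto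
    thus ?thesis using z(3) \<sigma> by (simp add: f_def)
  qed
  have "(\<Sum>n<N. f n) \<le> 1 + 1 / \<sigma>" for N
  proof -
    have "(\<Sum>n<N. f n) \<le> (\<Sum>n<Suc N. f n)" by (simp add: f_def)
    also have "\<dots> = f 0 + (\<Sum>n<N. f (Suc n))" by (rule sum.lessThan_Suc_shift)
    also have "\<dots> \<le> f 0 + (\<Sum>n<N. 1 / \<sigma> * (real (Suc n) powr (-\<sigma>) - real (Suc (Suc n)) powr (-\<sigma>)))"
      by (intro add_left_mono sum_mono step)
    also have "\<dots> = 1 + 1 / \<sigma> * (1 - real (Suc N) powr (-\<sigma>))"
      using sum_lessThan_telescope'[of "\<lambda>n. real (Suc n) powr (-\<sigma>)" N]
      unfolding sum_distrib_left[symmetric] by (simp add: f_def)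
    also have "\<dots> \<le> 1 + 1 / \<sigma> * 1" using \<sigma> by (intro add_left_mono mult_left_mono) auto
    finally show ?thesis by simp
  qed
  thus "(\<Sum>n. f n) \<le> 1 + 1 / \<sigma>" by (intro suminf_le_const sm)
qed

lemma norm_powr_diff_Suc_le:
  assumes "Re s > 0"
  shows "norm ((of_nat (Suc n) :: complex) powr (-s) - of_nat (Suc (Suc n)) powr (-s)) \<le> norm s * real (Suc n) powr (- (Re s + 1))"
proof -
  define u v where "u = real (Suc n)" and "v = real (Suc (Suc n))"
  have uv: "u > 0" "v - u = 1" by (auto simp: u_def v_def)
  have "norm (of_real v powr (-s) - of_real u powr (-s)) \<le> norm s * u powr (- (Re s + 1)) * norm (of_real v - of_real u :: complex)"
  proof (rule field_differentiable_bound[of "closed_segment (of_real u) (of_real v)"])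
    fix z :: complex assume "z \<in> closed_segment (of_real u) (of_real v)"
    then obtain x where x: "z = of_real x" "u \<le> x"
      using uv by (auto simp: closed_segment_of_real closed_segment_eq_real_ivl)
    show "((\<lambda>t. t powr (-s)) has_field_derivative (-s) * z powr (-s - 1)) (at z within closed_segment (of_real u) (of_real v))"
      using powr_complex_has_deriv[of z "-s"] x uv by (auto simp: complex_nonpos_Reals_iff)
    show "norm ((-s) * z powr (-s - 1)) \<le> norm s * u powr (- (Re s + 1))"
      using x uv assms by (auto simp: norm_mult norm_powr_real_powr intro!: mult_left_mono powr_mono2')
  qed auto
  moreover have "norm (of_real v - of_real u :: complex) = 1" using uv by (simp flip: of_real_diff)
  ultimately show ?thesis
    unfolding u_def v_def of_real_of_nat_eq by (simp add: norm_minus_commute)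
qed

text \<open>The L-functions are specified only as the unique nicely meromorphic continuation to the
  whole plane. This identifies an explicit formula on a smaller domain with them, also pointwise, so
  that bounds for the formula become bounds for \<open>dirichlet_L\<close> and
  \<open>zeta\<close>.\<close>

lemma nicely_meromorphic_imp_eq_holomorphic:
  assumes F: "F nicely_meromorphic_on UNIV" and G: "G holomorphic_on A" and A: "open A" "connected A"
    and B: "open B" "B \<subseteq> A" "B \<noteq> {}" and eq: "\<And>z. z \<in> B \<Longrightarrow> F z = G z" and z: "z \<in> A"
  shows "F z = G z"
proof (rule nicely_meromorphic_identity[OF _ _ A B eq z])
  show "F nicely_meromorphic_on A" using F by (rule nicely_meromorphic_on_subset) auto
  show "G nicely_meromorphic_on A"
    using G A by (intro analytic_on_imp_nicely_meromorphic_on) (simp add: analytic_on_open)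
qed

text \<open>With mean zero the partial sums \<open>S\<close> are periodic and hence bounded by
  \<open>q\<close>. Abel summation then replaces the coefficients by \<open>S\<close> and the powers
  by their unit differences, of size \<open>norm s * real n powr (- (Re s + 1))\<close>, which
  converges for \<open>Re s > 0\<close>.\<close>

lemma dirichlet_L_mean_zero:
  fixes a :: "nat \<Rightarrow> complex"
  assumes q: "q > 0" and per: "\<And>n. a (n + q) = a n" and mean: "(\<Sum>n<q. a n) = 0" and bdd: "\<And>n. norm (a n) \<le> 1"
  shows "dirichlet_L a holomorphic_on {s. Re s > 0}"
    and "Re s > 0 \<Longrightarrow> norm (dirichlet_L a s) \<le> real q * norm s * (1 + 1 / Re s)"
proof -
  define S where "S = (\<lambda>n. \<Sum>k<n. a (Suc k))"
  \<comment> \<open>The assumption sums over the residues \<open>0, \<dots>, q - 1\<close>, but the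
    Dirichlet series starts at 1; periodicity shifts the cycle by one.\<close>
  have cyc: "(\<Sum>k<q. a (Suc k)) = 0"
  proof -
    have "a 0 + (\<Sum>k<q. a (Suc k)) = (\<Sum>k<Suc q. a k)" by (rule sum.lessThan_Suc_shift[symmetric])
    also have "\<dots> = a q" using mean by simp
    also have "a q = a 0" using per[of 0] by simp
    finally show ?thesis by simp
  qed
  have Sper: "S (n * q + r) = S r" for n r
  proof (induction n)
    case (Suc n)
    have "S (m + q) = S m" for m
    proof (induction m)
      case 0 show ?case using cyc by (simp add: S_def)
    next
      case (Suc m)
      have "S (Suc m + q) = S (m + q) + a (Suc m + q)" by (simp add: S_def)
      also have "\<dots> = S m + a (Suc m)" using Suc per[of "Suc m"] by simp
      finally show ?case by (simp add: S_def)
    qed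
    from this[of "n * q + r"] Suc show ?case by (simp add: add_ac)
  qed simp
  have Sb: "norm (S n) \<le> real q" for n
  proof -
    have "S n = S (n mod q)" using Sper[of "n div q" "n mod q"] by simp
    also have "norm \<dots> \<le> (\<Sum>k<n mod q. 1)" unfolding S_def by (intro sum_norm_le bdd)
    also have "\<dots> \<le> real q" using mod_less_divisor[OF q, of n] by simp
    finally show ?thesis .
  qed
  define g where "g = (\<lambda>n s. S (Suc n) * ((of_nat (Suc n) :: complex) powr (-s) - of_nat (Suc (Suc n)) powr (-s)))"
  have gh: "g n holomorphic_on {s. Re s > 0}" for n
    unfolding g_def by (intro holomorphic_intros) (auto simp del: of_nat_Suc)
  have gb: "norm (g n s) \<le> (real q * norm s) * (1 + real n * 1) powr (- (Re s - 0 + 1))" if "Re s > 0" for n s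
  proof -
    have "norm (g n s) \<le> real q * (norm s * real (Suc n) powr (- (Re s + 1)))"
      unfolding g_def norm_mult by (intro mult_mono Sb norm_powr_diff_Suc_le that) auto
    thus ?thesis by (simp add: add_ac)
  qed
  define G where "G = (\<lambda>s. \<Sum>n. g n s)"
  have Gh: "G holomorphic_on {s. Re s > 0}" and Gs: "Re s > 0 \<Longrightarrow> summable (\<lambda>n. g n s)" for s
    unfolding G_def by (rule holomorphic_suminf_halfplane[OF gh gb]; auto intro!: continuous_intros)+
  have L: "is_dirichlet_L a (dirichlet_L a)" using is_dirichlet_L_dirichlet_L[of q a] q per by blast
  have LG: "dirichlet_L a s = G s" if s: "Re s > 1" for s
  proof -
    have "(\<Sum>n<N. a (Suc n) * of_nat (Suc n) powr (-s)) = (\<Sum>n<N. g n s) + S N * of_nat (Suc N) powr (-s)" for N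
      by (induction N) (simp_all add: g_def S_def algebra_simps del: of_nat_Suc)
    hence eq: "(\<Sum>n<N. a (Suc n) / of_nat (Suc n) powr s) = (\<Sum>n<N. g n s) + S N * of_nat (Suc N) powr (-s)" for N
      by (simp add: powr_minus divide_inverse)
    have "(\<lambda>N. S N * of_nat (Suc N) powr (-s)) \<longlonglongrightarrow> 0"
    proof (rule Lim_null_comparison)
      have "((\<lambda>N. real q * (1 + real N) powr (- Re s)) \<longlonglongrightarrow> 0)"
        using s by (intro tendsto_mult_right_zero tendsto_neg_powr) (auto, real_asymp)
      thus "((\<lambda>N. real q * real (Suc N) powr (- Re s)) \<longlonglongrightarrow> 0)" by simp
      show "\<forall>\<^sub>F N in sequentially. norm (S N * of_nat (Suc N) powr (-s)) \<le> real q * real (Suc N) powr (- Re s)"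
        unfolding norm_mult norm_of_nat_powr[OF zero_less_Suc] by (intro always_eventually allI mult_mono Sb) auto
    qed
    with summable_sums[OF Gs[of s]] s have "(\<lambda>n. a (Suc n) / of_nat (Suc n) powr s) sums (G s + 0)"
      unfolding sums_def eq G_def by (intro tendsto_add) auto
    moreover have "(\<lambda>n. a (Suc n) / of_nat (Suc n) powr s) sums dirichlet_L a s"
      using L s by (simp add: is_dirichlet_L_def)
    ultimately show ?thesis using sums_unique2 by fastforce
  qed
  have LG: "dirichlet_L a s = G s" if s: "Re s > 0" for s
  proof (rule nicely_meromorphic_imp_eq_holomorphic[where F = "dirichlet_L a" and G = G and z = s
      and A = "{s. Re s > 0}" and B = "{s. Re s > 1}"])
    show "dirichlet_L a nicely_meromorphic_on UNIV" using L by (simp add: is_dirichlet_L_def)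
    have "(2::complex) \<in> {s. Re s > 1}" by simp
    thus "{s. Re s > (1::real)} \<noteq> {}" by blast
    show "dirichlet_L a z = G z" if "z \<in> {s. Re s > 1}" for z using LG that by simp
  qed (use Gh s in \<open>auto intro!: open_halfspace_Re_gt convex_connected convex_halfspace_Re_gt\<close>)
  show "dirichlet_L a holomorphic_on {s. Re s > 0}"
    using Gh by (rule holomorphic_transform) (simp add: LG)
  assume s: "Re s > 0"
  have "norm (G s) \<le> (\<Sum>n. (real q * norm s) * real (Suc n) powr (- (Re s + 1)))"
    unfolding G_def using gb[OF s] sums_powr_le(2)[OF s]
    by (intro norm_suminf_le summable_mult) (auto simp: add_ac)
  also have "\<dots> = (real q * norm s) * (\<Sum>n. real (Suc n) powr (- (Re s + 1)))"
    by (rule suminf_mult[OF sums_powr_le(2)[OF s]])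
  also have "\<dots> \<le> (real q * norm s) * (1 + 1 / Re s)" by (intro mult_left_mono sums_powr_le s) auto
  finally show "norm (dirichlet_L a s) \<le> real q * norm s * (1 + 1 / Re s)" using LG[OF s] by simp
qed

text \<open>The entire function \<open>(s - 1) zeta s\<close>, on the half-plane \<open>Re s > 0\<close>.\<close>

definition zeta_reg :: "complex \<Rightarrow> complex" where
  "zeta_reg s = 1 + (\<Sum>n. taylor_rem 1 1 (1 + real n * 1) s)"

text \<open>The recursion \<open>arith_series_rec\<close> with \<open>a = q = 1\<close> and
  \<open>m = 1\<close> reads: 1 equals \<open>(s - 1) * zeta s\<close> minus the sum of the
  first-order Taylor remainders. Each remainder carries the factor \<open>(s - 1) * s\<close> in its
  bound and decays like \<open>u powr (- (Re s + 1))\<close>, so the sum continues to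
  \<open>Re s > 0\<close>. At \<open>s = 1\<close> all remainders vanish, which is the residue 1 of
  zeta.\<close>

lemma zeta_reg:
  shows "zeta_reg holomorphic_on {s. Re s > 0}"
    and "zeta_reg 1 = 1"
    and "Re s > 0 \<Longrightarrow> norm (zeta_reg s) \<le> 1 + norm (s - 1) * norm s * (1 + 1 / Re s)"
    and "Re s > 0 \<Longrightarrow> s \<noteq> 1 \<Longrightarrow> zeta s = zeta_reg s / (s - 1)"
    and "Re s > 1 \<Longrightarrow> (\<lambda>n. 1 / of_nat (Suc n) powr s) sums zeta s"
proof -
  define g where "g = (\<lambda>n. taylor_rem 1 1 (1 + real n * 1))"
  have gh: "g n holomorphic_on {s. Re s > 0}" for n
    unfolding g_def by (rule taylor_rem_holomorphic) auto
  have ff: "norm (fallfact (1 - s) (Suc 1)) = norm (s - 1) * norm s" for s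
    by (simp add: fallfact_def norm_mult numeral_2_eq_2 norm_minus_commute)
  have gb: "norm (g n s) \<le> (norm (s - 1) * norm s) * (1 + real n * 1) powr (- (Re s - 0 + 1))" if "Re s > 0" for n s
    using taylor_rem_bound[of "1 + real n * 1" 1 s 1] that unfolding g_def ff by simp
  have *: "(\<lambda>s. \<Sum>n. g n s) holomorphic_on {s. Re s > 0}" and Gs: "Re s > 0 \<Longrightarrow> summable (\<lambda>n. g n s)" for s
    by (rule holomorphic_suminf_halfplane[OF gh gb]; auto intro!: continuous_intros)+
  show hol: "zeta_reg holomorphic_on {s. Re s > 0}"
    using * unfolding zeta_reg_def g_def by (intro holomorphic_intros)
  have "taylor_rem 1 1 (1 + real n * 1) 1 = 0" for n
  proof -
    have "1 + real n * 1 \<noteq> 0" "1 + real n * 1 + 1 \<noteq> 0" by (auto simp: add_eq_0_iff2)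
    hence "complex_of_real (1 + real n * 1) \<noteq> 0" "complex_of_real (1 + real n * 1 + 1) \<noteq> 0"
      by (simp_all only: of_real_eq_0_iff not_False_eq_True)
    thus ?thesis unfolding taylor_rem_def by (simp add: fallfact_def del: of_real_add of_real_mult)
  qed
  thus "zeta_reg 1 = 1" by (simp add: zeta_reg_def)
  show "norm (zeta_reg s) \<le> 1 + norm (s - 1) * norm s * (1 + 1 / Re s)" if s: "Re s > 0"
  proof -
    have "norm (\<Sum>n. g n s) \<le> (\<Sum>n. (norm (s - 1) * norm s) * real (Suc n) powr (- (Re s + 1)))"
      using gb[OF s] sums_powr_le(2)[OF s]
      by (intro norm_suminf_le summable_mult) (auto simp: add_ac)
    also have "\<dots> = (norm (s - 1) * norm s) * (\<Sum>n. real (Suc n) powr (- (Re s + 1)))"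
      by (rule suminf_mult[OF sums_powr_le(2)[OF s]])
    also have "\<dots> \<le> (norm (s - 1) * norm s) * (1 + 1 / Re s)" by (intro mult_left_mono sums_powr_le s) auto
    finally show ?thesis unfolding zeta_reg_def g_def[symmetric]
      by (intro norm_triangle_le) (auto simp: g_def)
  qed
  have L: "is_dirichlet_L (\<lambda>_. 1) zeta" by (rule is_dirichlet_L_zeta)
  show ser: "Re s > 1 \<Longrightarrow> (\<lambda>n. 1 / of_nat (Suc n) powr s) sums zeta s" for s
    using L by (simp add: is_dirichlet_L_def)
  have eq1: "zeta s = zeta_reg s / (s - 1)" if s: "Re s > 1" for s
  proof -
    have a: "1 + real n * 1 = real (Suc n)" for n by simp
    have "(1::complex) = of_real 1 powr (1 - s)" by simp
    also have "\<dots> = - (\<Sum>i=1..1. fallfact (1 - s) i * of_real 1 ^ i / fact i * arith_series 1 1 (s + of_nat i - 1))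
     - (\<Sum>n. taylor_rem 1 1 (1 + real n * 1) s)"
      by (rule arith_series_rec) (use s in auto)
    also have "\<dots> = (s - 1) * arith_series 1 1 s - (zeta_reg s - 1)"
      by (simp add: zeta_reg_def fallfact_def algebra_simps)
    finally have "zeta_reg s = (s - 1) * arith_series 1 1 s" by simp
    moreover have "arith_series 1 1 s = zeta s"
    proof -
      have "(\<lambda>n. 1 / of_nat (Suc n) powr s) sums arith_series 1 1 s"
        using arith_series(2)[of 1 1 s] s unfolding a by (simp add: powr_minus divide_inverse del: of_nat_Suc)
      thus ?thesis using ser[OF s] sums_unique2 by blast
    qed
    ultimately show ?thesis using s by auto
  qed
  show "zeta s = zeta_reg s / (s - 1)" if s: "Re s > 0" "s \<noteq> 1"
  proof (rule nicely_meromorphic_imp_eq_holomorphic[where F = zeta and G = "\<lambda>s. zeta_reg s / (s - 1)" and z = s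
      and A = "{s. Re s > 0} - {1}" and B = "{s. Re s > 1}"])
    show "(\<lambda>s. zeta_reg s / (s - 1)) holomorphic_on {s. Re s > 0} - {1}"
      using holomorphic_on_subset[OF hol, of "{s. Re s > 0} - {1}"] by (intro holomorphic_on_divide holomorphic_intros) auto
    show "connected ({s. Re s > 0} - {1::complex})"
      by (rule connected_open_delete[OF open_halfspace_Re_gt convex_connected[OF convex_halfspace_Re_gt]]) simp
    show "zeta nicely_meromorphic_on UNIV" using L by (simp add: is_dirichlet_L_def)
    show "open ({s. Re s > 0} - {1::complex})" by (intro open_delete open_halfspace_Re_gt)
    show "open {s. Re s > (1::real)}" by (rule open_halfspace_Re_gt)
    show "{s. Re s > 1} \<subseteq> {s. Re s > 0} - {1::complex}" by auto
    have "(2::complex) \<in> {s. Re s > 1}" by simp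
    thus "{s. Re s > (1::real)} \<noteq> {}" by blast
    show "zeta z = zeta_reg z / (z - 1)" if "z \<in> {s. Re s > 1}" for z using eq1 that by simp
  qed (use s in auto)
qed

section \<open>Nonvanishing on the line \<open>Re s = 1\<close>\<close>

text \<open>By complete multiplicativity the Dirichlet product of \<open>a\<close> with its Moebius
  twist has the coefficients of the constant 1. Both series have coefficients of modulus at most 1,
  so the same explicit majorant bounds \<open>A\<close> and its inverse; the bound for the inverse
  is the lower bound for an L-function at the centre of the discs used later.\<close>

lemma dirichlet_inverse:
  fixes a :: "nat \<Rightarrow> complex"
  assumes mult: "\<And>m n. a (m * n) = a m * a n" and a1: "a 1 = 1" and bdd: "\<And>n. norm (a n) \<le> 1" and s: "Re s > 1"
    and A: "(\<lambda>n. a (Suc n) / of_nat (Suc n) powr s) sums A"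
  shows "(\<lambda>n. of_int (moebius_mu (Suc n)) * a (Suc n) / of_nat (Suc n) powr s) sums inverse A"
    and "A \<noteq> 0" and "norm A \<le> 1 + 1 / (Re s - 1)" and "norm (inverse A) \<le> 1 + 1 / (Re s - 1)"
proof -
  have mb: "norm (of_int (moebius_mu n) * a n) \<le> 1" for n
    unfolding norm_mult using mult_mono[OF norm_moebius_mu_le[of n] bdd[of n]] by simp
  have sm: "summable (\<lambda>n. norm (of_int (moebius_mu (Suc n)) * a (Suc n) / of_nat (Suc n) powr s))"
    by (rule summable_dirichlet_series[where a = "\<lambda>n. of_int (moebius_mu n) * a n" and B = 1 and \<eta> = 0]) (use mb s in auto)
  have sa: "summable (\<lambda>n. norm (a (Suc n) / of_nat (Suc n) powr s))"
    by (rule summable_dirichlet_series[where B = 1 and \<eta> = 0]) (use bdd s in auto)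
  define M where "M = (\<Sum>n. of_int (moebius_mu (Suc n)) * a (Suc n) / of_nat (Suc n) powr s)"
  have M: "(\<lambda>n. of_int (moebius_mu (Suc n)) * a (Suc n) / of_nat (Suc n) powr s) sums M"
    unfolding M_def by (rule summable_sums[OF summable_norm_cancel[OF sm]])
  have "(\<lambda>n. (\<Sum>d | d dvd Suc n. of_int (moebius_mu d) * a d * a (Suc n div d)) / of_nat (Suc n) powr s) sums (M * A)"
    by (rule dirichlet_product[OF sm M sa A])
  also have "(\<lambda>n. (\<Sum>d | d dvd Suc n. of_int (moebius_mu d) * a d * a (Suc n div d)) / of_nat (Suc n) powr s) =
     (\<lambda>n. if n = 0 then 1 else 0)"
  proof
    fix n
    have "(\<Sum>d | d dvd Suc n. of_int (moebius_mu d) * a d * a (Suc n div d)) = of_int (\<Sum>d | d dvd Suc n. moebius_mu d) * a (Suc n)"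
      unfolding of_int_sum sum_distrib_right
    proof (rule sum.cong[OF refl])
      fix d assume "d \<in> {d. d dvd Suc n}"
      hence "a d * a (Suc n div d) = a (Suc n)" by (simp flip: mult)
      thus "of_int (moebius_mu d) * a d * a (Suc n div d) = of_int (moebius_mu d) * a (Suc n)" by (simp add: mult.assoc)
    qed
    thus "(\<Sum>d | d dvd Suc n. of_int (moebius_mu d) * a d * a (Suc n div d)) / of_nat (Suc n) powr s = (if n = 0 then 1 else 0)"
      using a1 by (simp add: sum_moebius_mu_dvd)
  qed
  finally have "M * A = 1" using sums_single[of 0 "\<lambda>_. 1::complex"] sums_unique2 by (simp add: sums_unique2)
  have A0: "A \<noteq> 0" using \<open>M * A = 1\<close> by auto
  hence MA: "M = inverse A" using \<open>M * A = 1\<close> by (simp add: field_simps)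
  from A0 MA show "A \<noteq> 0" "(\<lambda>n. of_int (moebius_mu (Suc n)) * a (Suc n) / of_nat (Suc n) powr s) sums inverse A"
    using M by auto
  have bound: "norm S \<le> 1 + 1 / (Re s - 1)"
    if "\<And>n. norm (b n) \<le> 1" "(\<lambda>n. b (Suc n) / of_nat (Suc n) powr s) sums S" for S and b :: "nat \<Rightarrow> complex"
  proof -
    have s': "Re s - 1 > 0" using s by simp
    have "norm S = norm (\<Sum>n. b (Suc n) / of_nat (Suc n) powr s)" using that(2) by (simp add: sums_iff)
    also have "\<dots> \<le> (\<Sum>n. real (Suc n) powr (- ((Re s - 1) + 1)))"
    proof (rule norm_suminf_le[OF _ sums_powr_le(2)[OF s']])
      fix n
      have "norm (b (Suc n) / of_nat (Suc n) powr s) = norm (b (Suc n)) * real (Suc n) powr (- Re s)"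
        unfolding norm_divide norm_of_nat_powr[OF zero_less_Suc] by (simp add: powr_minus divide_inverse)
      also have "\<dots> \<le> 1 * real (Suc n) powr (- Re s)" by (intro mult_right_mono that) auto
      finally show "norm (b (Suc n) / of_nat (Suc n) powr s) \<le> real (Suc n) powr (- ((Re s - 1) + 1))" by simp
    qed
    also have "\<dots> \<le> 1 + 1 / (Re s - 1)" by (rule sums_powr_le(1)[OF s'])
    finally show ?thesis .
  qed
  show "norm A \<le> 1 + 1 / (Re s - 1)" by (rule bound[OF bdd A])
  show "norm (inverse A) \<le> 1 + 1 / (Re s - 1)"
    using bound[of "\<lambda>n. of_int (moebius_mu n) * a n", OF mb M] MA by simp
qed

text \<open>Dirichlet product with the two-term series \<open>e\<close>: for \<open>p\<close>
  dividing \<open>n\<close> the two contributions \<open>a n\<close> and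
  \<open>- a p * a (n div p)\<close> cancel.\<close>

lemma dirichlet_remove_prime:
  fixes a :: "nat \<Rightarrow> complex"
  assumes mult: "\<And>m n. a (m * n) = a m * a n" and bdd: "\<And>n. norm (a n) \<le> 1" and s: "Re s > 1" and p: "p \<ge> 2"
    and A: "(\<lambda>n. a (Suc n) / of_nat (Suc n) powr s) sums A"
  shows "(\<lambda>n. (if p dvd Suc n then 0 else a (Suc n)) / of_nat (Suc n) powr s) sums ((1 - a p / of_nat p powr s) * A)"
proof -
  define e where "e = (\<lambda>d. if d = 1 then 1 else if d = p then - a p else 0)"
  have sa: "summable (\<lambda>n. norm (a (Suc n) / of_nat (Suc n) powr s))"
    by (rule summable_dirichlet_series[where B = 1 and \<eta> = 0]) (use bdd s in auto)
  have e0: "e (Suc n) / of_nat (Suc n) powr s = 0" if "n \<notin> {0, p - 1}" for n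
    using that p by (auto simp: e_def)
  have se: "summable (\<lambda>n. norm (e (Suc n) / of_nat (Suc n) powr s))"
    by (rule summable_finite[of "{0, p - 1}"]) (use e0 in auto)
  have "(\<lambda>n. e (Suc n) / of_nat (Suc n) powr s) sums (\<Sum>n\<in>{0, p - 1}. e (Suc n) / of_nat (Suc n) powr s)"
    by (rule sums_finite) (use e0 in auto)
  also have "(\<Sum>n\<in>{0, p - 1}. e (Suc n) / of_nat (Suc n) powr s) = 1 - a p / of_nat p powr s"
    using p by (simp add: e_def)
  finally have E: "(\<lambda>n. e (Suc n) / of_nat (Suc n) powr s) sums (1 - a p / of_nat p powr s)" .
  have "(\<lambda>n. (\<Sum>d | d dvd Suc n. e d * a (Suc n div d)) / of_nat (Suc n) powr s) sums ((1 - a p / of_nat p powr s) * A)"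
    by (rule dirichlet_product[OF se E sa A])
  moreover have "(\<Sum>d | d dvd Suc n. e d * a (Suc n div d)) = (if p dvd Suc n then 0 else a (Suc n))" for n
  proof -
    have "(\<Sum>d | d dvd Suc n. e d * a (Suc n div d)) = (\<Sum>d\<in>{d. d dvd Suc n \<and> (d = 1 \<or> d = p)}. e d * a (Suc n div d))"
      by (rule sum.mono_neutral_right) (auto simp: e_def)
    also have "\<dots> = (if p dvd Suc n then 0 else a (Suc n))"
    proof (cases "p dvd Suc n")
      case True
      hence "{d. d dvd Suc n \<and> (d = 1 \<or> d = p)} = {1, p}" by auto
      moreover have "a p * a (Suc n div p) = a (Suc n)" using True by (simp flip: mult)
      ultimately show ?thesis using True p by (simp add: e_def)
    next
      case False
      hence "{d. d dvd Suc n \<and> (d = 1 \<or> d = p)} = {1}" by auto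
      thus ?thesis using False by (simp add: e_def)
    qed
    finally show ?thesis .
  qed
  ultimately show ?thesis by (simp only:)
qed

section \<open>Landau's argument for Dirichlet series with nonnegative coefficients\<close>

lemma sum_nonneg_Reals: "(\<And>x. x \<in> A \<Longrightarrow> f x \<in> \<real>\<^sub>\<ge>\<^sub>0) \<Longrightarrow> (\<Sum>x\<in>A. f x :: complex) \<in> \<real>\<^sub>\<ge>\<^sub>0"
  by (induction A rule: infinite_finite_induct) (auto intro: nonneg_Reals_add_I)

lemma higher_deriv_dirichlet_polynomial:
  "(deriv ^^ k) (\<lambda>s. \<Sum>n<N. c n * (of_nat (Suc n) :: complex) powr (-s)) =
     (\<lambda>s. \<Sum>n<N. c n * (- of_real (ln (real (Suc n)))) ^ k * of_nat (Suc n) powr (-s))"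
proof (induction k)
  case (Suc k)
  have "deriv (\<lambda>s. \<Sum>n<N. c n * (- of_real (ln (real (Suc n)))) ^ k * of_nat (Suc n) powr (-s)) s =
     (\<Sum>n<N. c n * (- of_real (ln (real (Suc n)))) ^ Suc k * of_nat (Suc n) powr (-s))" for s
  proof (rule DERIV_imp_deriv, rule DERIV_sum)
    fix n
    show "((\<lambda>s. c n * (- of_real (ln (real (Suc n)))) ^ k * of_nat (Suc n) powr (-s)) has_field_derivative
      c n * (- of_real (ln (real (Suc n)))) ^ Suc k * of_nat (Suc n) powr (-s)) (at s)"
      by (rule DERIV_cong[OF DERIV_cmult[OF has_field_derivative_of_nat_Suc_powr]]) (simp del: of_nat_Suc)
  qed
  thus ?case unfolding funpow.simps o_apply Suc by (rule ext)
qed simp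

text \<open>Each derivative of \<open>of_nat n powr (-s)\<close> brings down the factor
  \<open>- ln n\<close>, so the signs alternate for partial sums, and uniform limits preserve this.
  With coefficients up to \<open>n powr (1 / 2)\<close>, the bound \<open>7 / 4\<close> keeps the
  terms below \<open>n powr (- (5 / 4))\<close>.\<close>

lemma dirichlet_series_completely_monotone:
  fixes c :: "nat \<Rightarrow> complex"
  assumes c: "\<And>n. c n \<in> \<real>\<^sub>\<ge>\<^sub>0" and bdd: "\<And>n. n \<ge> 1 \<Longrightarrow> norm (c n) \<le> B * real n powr (1 / 2)"
  defines "W \<equiv> (\<lambda>s. \<Sum>n. c (Suc n) * of_nat (Suc n) powr (-s))"
  shows "W holomorphic_on {s. Re s > 7 / 4}" and "(-1) ^ k * (deriv ^^ k) W 2 \<in> \<real>\<^sub>\<ge>\<^sub>0"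
proof -
  define A where "A = {s. Re s > (7 / 4 :: real)}"
  have opA: "open A" unfolding A_def by (rule open_halfspace_Re_gt)
  define P where "P = (\<lambda>N s. \<Sum>n<N. c (Suc n) * (of_nat (Suc n) :: complex) powr (-s))"
  have ul: "uniform_limit A P W sequentially"
    unfolding P_def W_def
  proof (rule Weierstrass_m_test)
    show "summable (\<lambda>n. B * (1 + real n * 1) powr (- (5 / 4)))"
      by (intro summable_mult summable_arith_powr) auto
    fix n s assume s: "s \<in> A"
    have "norm (c (Suc n) * of_nat (Suc n) powr (-s)) = norm (c (Suc n)) * real (Suc n) powr (- Re s)"
      unfolding norm_mult norm_of_nat_powr[OF zero_less_Suc] by simp
    also have "\<dots> \<le> (B * real (Suc n) powr (1 / 2)) * real (Suc n) powr (- (7 / 4))"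
      using s bdd[of "Suc n"] order.trans[OF norm_ge_zero bdd[of "Suc n"]]
      by (intro mult_mono powr_mono) (auto simp: A_def)
    also have "\<dots> = B * (real (Suc n) powr (1 / 2) * real (Suc n) powr (- (7 / 4)))" by simp
    also have "real (Suc n) powr (1 / 2) * real (Suc n) powr (- (7 / 4)) = (1 + real n * 1) powr (- (5 / 4))"
      unfolding powr_add[symmetric] by simp
    finally show "norm (c (Suc n) * of_nat (Suc n) powr (-s)) \<le> B * (1 + real n * 1) powr (- (5 / 4))" .
  qed
  have A2: "2 \<in> A" by (simp add: A_def)
  have hol: "P N holomorphic_on A" for N
    unfolding P_def by (intro holomorphic_intros) (auto simp del: of_nat_Suc)
  show "W holomorphic_on {s. Re s > 7 / 4}"
    unfolding A_def[symmetric]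
  proof (rule holomorphic_uniform_sequence[OF opA hol])
    fix x assume "x \<in> A"
    then obtain d where "d > 0" "cball x d \<subseteq> A" using opA open_contains_cball by blast
    thus "\<exists>d>0. cball x d \<subseteq> A \<and> uniform_limit (cball x d) P W sequentially"
      using uniform_limit_on_subset[OF ul] by blast
  qed
  have lim: "(\<lambda>N. (-1) ^ k * (deriv ^^ k) (P N) 2) \<longlonglongrightarrow> (-1) ^ k * (deriv ^^ k) W 2"
    using hol by (intro tendsto_mult_left higher_deriv_complex_uniform_limit[OF ul _ _ opA]) (auto simp: A_def[symmetric] A2)
  have "(-1) ^ k * (deriv ^^ k) (P N) 2 \<in> \<real>\<^sub>\<ge>\<^sub>0" for N
  proof -
    have "(-1) ^ k * (deriv ^^ k) (P N) 2 = (\<Sum>n<N. c (Suc n) * of_real (ln (real (Suc n)) ^ k * real (Suc n) powr (-2)))"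
      unfolding P_def higher_deriv_dirichlet_polynomial sum_distrib_left
    proof (rule sum.cong[OF refl])
      fix n
      have "(-1) ^ k * (- complex_of_real (ln (real (Suc n)))) ^ k = of_real (ln (real (Suc n)) ^ k)"
        by (simp flip: power_mult_distrib)
      moreover have "(of_nat (Suc n) :: complex) powr (-2) = of_real (real (Suc n) powr (-2))"
        using powr_of_real[of "real (Suc n)" "-2"] by (simp del: of_nat_Suc)
      ultimately show "(-1) ^ k * (c (Suc n) * (- of_real (ln (real (Suc n)))) ^ k * of_nat (Suc n) powr (-2)) =
         c (Suc n) * of_real (ln (real (Suc n)) ^ k * real (Suc n) powr (-2))"
        by (metis (no_types, lifting) mult.assoc mult.left_commute of_real_mult)
    qed
    also have "\<dots> \<in> \<real>\<^sub>\<ge>\<^sub>0"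
      by (intro sum_nonneg_Reals nonneg_Reals_mult_I c) (auto intro!: mult_nonneg_nonneg zero_le_power)
    finally show ?thesis .
  qed
  thus "(-1) ^ k * (deriv ^^ k) W 2 \<in> \<real>\<^sub>\<ge>\<^sub>0"
    by (intro Lim_in_closed_set[OF closed_nonneg_Reals_complex _ _ lim] always_eventually) auto
qed

text \<open>
  Landau's argument: if \<open>F' = - F W\<close> and \<open>W\<close> is completely monotone at \<open>2\<close>, then so is \<open>F\<close>, and all
  terms of its Taylor series at \<open>2\<close> are nonnegative to the left of \<open>2\<close>.
\<close>

lemma landau_monotone:
  assumes F: "F holomorphic_on ball 2 2" and W: "W holomorphic_on {s. Re s > 7 / 4}"
    and dF: "\<And>s. Re s > 7 / 4 \<Longrightarrow> s \<in> ball 2 2 \<Longrightarrow> (F has_field_derivative - (F s * W s)) (at s)"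
    and cm: "\<And>k. (-1) ^ k * (deriv ^^ k) W 2 \<in> \<real>\<^sub>\<ge>\<^sub>0" and F2: "F 2 \<in> \<real>\<^sub>\<ge>\<^sub>0" and \<sigma>: "0 < \<sigma>" "\<sigma> < 2"
  shows "Re (F 2) \<le> Re (F (of_real \<sigma>))"
proof -
  define A where "A = ball (2::complex) 2 \<inter> {s. Re s > 7 / 4}"
  have A: "open A" "2 \<in> A" unfolding A_def by (intro open_Int open_ball open_halfspace_Re_gt) simp
  have FA: "F holomorphic_on A" and WA: "W holomorphic_on A"
    by (rule holomorphic_on_subset[OF F] holomorphic_on_subset[OF W], force simp: A_def)+
  have pos: "(-1) ^ k * (deriv ^^ k) F 2 \<in> \<real>\<^sub>\<ge>\<^sub>0" for k
  proof (induction k rule: less_induct)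
    case (less k)
    show ?case
    proof (cases k)
      case (Suc m)
      have "(deriv ^^ k) F 2 = (deriv ^^ m) (deriv F) 2" by (simp only: Suc funpow_Suc_right o_apply)
      also have "\<dots> = (deriv ^^ m) (\<lambda>s. (-1) * (F s * W s)) 2"
      proof (rule higher_deriv_transform_within_open[OF _ _ A])
        show "deriv F holomorphic_on A" by (intro holomorphic_deriv FA A)
        show "(\<lambda>s. (-1) * (F s * W s)) holomorphic_on A" by (intro holomorphic_intros FA WA)
        show "deriv F w = (-1) * (F w * W w)" if "w \<in> A" for w
          using DERIV_imp_deriv[OF dF[of w]] that by (auto simp: A_def)
      qed
      also have "\<dots> = (-1) * (deriv ^^ m) (\<lambda>s. F s * W s) 2"
        by (rule higher_deriv_cmult[OF _ A(2,1)]) (intro holomorphic_intros FA WA)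
      also have "\<dots> = (-1) * (\<Sum>i=0..m. of_nat (m choose i) * (deriv ^^ i) F 2 * (deriv ^^ (m - i)) W 2)"
        using higher_deriv_mult[OF FA WA A] by simp
      finally have "(-1) ^ k * (deriv ^^ k) F 2 =
          (-1) ^ m * (\<Sum>i=0..m. of_nat (m choose i) * (deriv ^^ i) F 2 * (deriv ^^ (m - i)) W 2)"
        by (simp add: Suc)
      also have "\<dots> = (\<Sum>i=0..m. of_nat (m choose i) * ((-1) ^ i * (deriv ^^ i) F 2) * ((-1) ^ (m - i) * (deriv ^^ (m - i)) W 2))"
        unfolding sum_distrib_left
      proof (rule sum.cong[OF refl])
        fix i assume "i \<in> {0..m}"
        hence "(-1::complex) ^ m = (-1) ^ i * (-1) ^ (m - i)" by (simp flip: power_add)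
        thus "(-1) ^ m * (of_nat (m choose i) * (deriv ^^ i) F 2 * (deriv ^^ (m - i)) W 2) =
          of_nat (m choose i) * ((-1) ^ i * (deriv ^^ i) F 2) * ((-1) ^ (m - i) * (deriv ^^ (m - i)) W 2)" by simp
      qed
      also have "\<dots> \<in> \<real>\<^sub>\<ge>\<^sub>0"
        by (intro sum_nonneg_Reals nonneg_Reals_mult_I cm less) (auto simp: Suc)
      finally show ?thesis .
    qed (use F2 in simp)
  qed
  have "of_real \<sigma> \<in> ball (2::complex) 2"
  proof -
    have "norm (of_real 2 - of_real \<sigma> :: complex) = \<bar>2 - \<sigma>\<bar>" by (simp only: of_real_diff[symmetric] norm_of_real)
    thus ?thesis using \<sigma> by (simp add: dist_norm)
  qed
  hence "(\<lambda>n. (deriv ^^ n) F 2 / fact n * (of_real \<sigma> - 2) ^ n) sums F (of_real \<sigma>)"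
    by (rule holomorphic_power_series[OF F])
  hence S: "(\<lambda>n. Re ((deriv ^^ n) F 2 / fact n * (of_real \<sigma> - 2) ^ n)) sums Re (F (of_real \<sigma>))" by (rule sums_Re)
  have "0 \<le> Re ((deriv ^^ n) F 2 / fact n * (of_real \<sigma> - 2) ^ n)" for n
  proof -
    \<comment> \<open>To the left of 2 the powers of \<open>\<sigma> - 2\<close> alternate in sign
      exactly as the derivatives do, so every Taylor term is nonnegative and the zeroth one bounds
      the sum from below.\<close>
    have "complex_of_real \<sigma> - 2 = (-1) * of_real (2 - \<sigma>)" by simp
    hence "(deriv ^^ n) F 2 / fact n * (of_real \<sigma> - 2) ^ n = (-1) ^ n * (deriv ^^ n) F 2 * of_real ((2 - \<sigma>) ^ n / fact n)"
      by (simp only: power_mult_distrib) simp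
    also have "\<dots> \<in> \<real>\<^sub>\<ge>\<^sub>0"
      by (rule nonneg_Reals_mult_I[OF pos], subst nonneg_Reals_of_real_iff) (use \<sigma> in simp)
    finally show ?thesis by (simp add: complex_nonneg_Reals_iff)
  qed
  hence "(\<Sum>n\<in>{0}. Re ((deriv ^^ n) F 2 / fact n * (of_real \<sigma> - 2) ^ n)) \<le> Re (F (of_real \<sigma>))"
    unfolding sums_unique[OF S] by (intro sum_le_suminf sums_summable[OF S]) auto
  thus ?thesis by simp
qed

lemma dirichlet_series_shift:
  "(\<lambda>n. a (Suc n) / of_nat (Suc n) powr t / of_nat (Suc n) powr s) = (\<lambda>n. a (Suc n) / of_nat (Suc n) powr (s + t :: complex))"
  by (simp add: powr_add mult.commute)

lemma dirichlet_series_cnj: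
  assumes "(\<lambda>n. a (Suc n) / of_nat (Suc n) powr cnj s) sums A"
  shows "(\<lambda>n. cnj (a (Suc n)) / of_nat (Suc n) powr s) sums cnj A"
proof -
  have "cnj (of_nat (Suc n) powr cnj s) = of_nat (Suc n) powr s" for n
    by (simp add: cnj_powr complex_nonpos_Reals_iff del: of_nat_Suc)
  thus ?thesis using assms sums_cnj[of "\<lambda>n. a (Suc n) / of_nat (Suc n) powr cnj s" A] by simp
qed

text \<open>Multiplying \<open>\<Phi>\<close> by its reflection gives a function \<open>F\<close>
  whose negative logarithmic derivative has the coefficients
  \<open>mangoldt n * (2 * Re (a n + b n))\<close>, which are nonnegative. Landau's argument then
  keeps \<open>F\<close> above the positive value \<open>F 2\<close> on \<open>(0, 2)\<close>,
  although \<open>small\<close> forces \<open>F\<close> to 0 at 0. Only the product with the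
  reflection occurs in \<open>eq\<close>, so \<open>\<Phi>\<close> may differ from
  \<open>A s * B s\<close> by a factor whose reflection is its reciprocal.\<close>

lemma landau_contradiction:
  fixes a b :: "nat \<Rightarrow> complex"
  assumes a: "\<And>m n. a (m * n) = a m * a n" "a 1 = 1" "\<And>n. norm (a n) \<le> 1"
    and b: "\<And>m n. b (m * n) = b m * b n" "b 1 = 1" "\<And>n. norm (b n) \<le> 1"
    and ab: "\<And>n. Re (a n + b n) \<ge> 0"
    and A: "\<And>s. Re s > 1 \<Longrightarrow> (\<lambda>n. a (Suc n) / of_nat (Suc n) powr s) sums A s"
    and B: "\<And>s. Re s > 1 \<Longrightarrow> (\<lambda>n. b (Suc n) / of_nat (Suc n) powr s) sums B s"
    and \<Phi>: "\<Phi> holomorphic_on {s. Re s > 0}"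
    and eq: "\<And>s. Re s > 1 \<Longrightarrow> \<Phi> s * cnj (\<Phi> (cnj s)) = A s * B s * cnj (A (cnj s) * B (cnj s))"
    and small: "\<And>\<sigma>. 0 < \<sigma> \<Longrightarrow> \<sigma> < 1 / 2 \<Longrightarrow> norm (\<Phi> (of_real \<sigma>)) \<le> C * \<sigma>"
  shows False
proof -
  define F where "F = (\<lambda>s. \<Phi> s * cnj (\<Phi> (cnj s)))"
  have cnjH: "cnj ` {s. Re s > 0} = {s. Re s > 0}" by (force simp: image_iff intro: exI[of _ "cnj _"])
  have "cnj \<circ> \<Phi> \<circ> cnj holomorphic_on {s. Re s > 0}"
    by (rule holomorphic_on_compose_cnj_cnj) (use \<Phi> cnjH in \<open>auto intro: open_halfspace_Re_gt\<close>)
  hence F: "F holomorphic_on {s. Re s > 0}"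
    unfolding F_def by (intro holomorphic_intros \<Phi>) (simp add: o_def)
  have ballsub: "ball (2::complex) 2 \<subseteq> {s. Re s > 0}"
  proof
    fix s :: complex assume "s \<in> ball 2 2"
    thus "s \<in> {s. Re s > 0}" using complex_Re_le_cmod[of "2 - s"] by (simp add: dist_norm)
  qed
  \<comment> \<open>The conjugate coefficients come from the reflected factors; they make the sum
    real, so that its sign can be controlled.\<close>
  define c where "c = (\<lambda>n. mangoldt n * (a n + b n + cnj (a n) + cnj (b n)))"
  define W where "W = (\<lambda>s. \<Sum>n. c (Suc n) * of_nat (Suc n) powr (-s))"
  have c_eq: "c n = of_real (mangoldt n * (2 * Re (a n + b n)))" for n
    by (simp add: c_def complex_eq_iff)
  have c_pos: "c n \<in> \<real>\<^sub>\<ge>\<^sub>0" for n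
    unfolding c_eq nonneg_Reals_of_real_iff by (intro mult_nonneg_nonneg mangoldt_nonneg) (use ab in auto)
  have c_bd: "norm (c n) \<le> 8 * real n powr (1 / 2)" if "n \<ge> 1" for n
  proof -
    have "norm (a n + b n + cnj (a n) + cnj (b n)) \<le> 1 + 1 + 1 + 1"
      by (intro order.trans[OF norm_triangle_ineq] add_mono) (use a(3) b(3) in auto)
    moreover have "norm (mangoldt n :: complex) \<le> 1 / (1 / 2) * real n powr (1 / 2)"
      by (rule norm_mangoldt_le_powr) (use that in auto)
    ultimately have "norm (c n) \<le> (1 / (1 / 2) * real n powr (1 / 2)) * (1 + 1 + 1 + 1)"
      unfolding c_def norm_mult by (intro mult_mono) auto
    thus ?thesis by simp
  qed
  note W = dirichlet_series_completely_monotone[of c, OF c_pos c_bd, folded W_def]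
  have dF: "(F has_field_derivative - (F s * W s)) (at s)" if s: "Re s > 7 / 4" for s
  proof -
    have s1: "Re s > 1" using s by simp
    note A' = dirichlet_series_cnj[OF A] and B' = dirichlet_series_cnj[OF B]
    obtain W1 where W1: "(\<lambda>n. mangoldt (Suc n) * a (Suc n) / of_nat (Suc n) powr s) sums W1" "(A has_field_derivative - (A s * W1)) (at s)"
      using dirichlet_log_derivative[OF a(1,3) s1 A] by blast
    obtain W2 where W2: "(\<lambda>n. mangoldt (Suc n) * b (Suc n) / of_nat (Suc n) powr s) sums W2" "(B has_field_derivative - (B s * W2)) (at s)"
      using dirichlet_log_derivative[OF b(1,3) s1 B] by blast
    have "\<exists>W3. (\<lambda>n. mangoldt (Suc n) * cnj (a (Suc n)) / of_nat (Suc n) powr s) sums W3 \<and> ((\<lambda>s. cnj (A (cnj s))) has_field_derivative - (cnj (A (cnj s)) * W3)) (at s)"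
      by (rule dirichlet_log_derivative[where a = "\<lambda>n. cnj (a n)", OF _ _ s1 A']) (use a in auto)
    then obtain W3 where W3: "(\<lambda>n. mangoldt (Suc n) * cnj (a (Suc n)) / of_nat (Suc n) powr s) sums W3"
      "((\<lambda>s. cnj (A (cnj s))) has_field_derivative - (cnj (A (cnj s)) * W3)) (at s)" by blast
    have "\<exists>W4. (\<lambda>n. mangoldt (Suc n) * cnj (b (Suc n)) / of_nat (Suc n) powr s) sums W4 \<and> ((\<lambda>s. cnj (B (cnj s))) has_field_derivative - (cnj (B (cnj s)) * W4)) (at s)"
      by (rule dirichlet_log_derivative[where a = "\<lambda>n. cnj (b n)", OF _ _ s1 B']) (use b in auto)
    then obtain W4 where W4: "(\<lambda>n. mangoldt (Suc n) * cnj (b (Suc n)) / of_nat (Suc n) powr s) sums W4"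
      "((\<lambda>s. cnj (B (cnj s))) has_field_derivative - (cnj (B (cnj s)) * W4)) (at s)" by blast
    have "(\<lambda>n. c (Suc n) * of_nat (Suc n) powr (-s)) sums (W1 + W2 + W3 + W4)"
      using sums_add[OF sums_add[OF sums_add[OF W1(1) W2(1)] W3(1)] W4(1)]
      by (simp add: c_def powr_minus divide_inverse algebra_simps del: of_nat_Suc)
    hence Ws: "W s = W1 + W2 + W3 + W4" unfolding W_def by (simp add: sums_iff)
    have "((\<lambda>s. A s * B s * (cnj (A (cnj s)) * cnj (B (cnj s)))) has_field_derivative
        - (A s * B s * (cnj (A (cnj s)) * cnj (B (cnj s))) * W s)) (at s)"
      unfolding Ws
      by (rule DERIV_cong[OF DERIV_mult[OF DERIV_mult[OF W1(2) W2(2)] DERIV_mult[OF W3(2) W4(2)]]]) (simp add: algebra_simps)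
    moreover have "A s * B s * (cnj (A (cnj s)) * cnj (B (cnj s))) = F s" if "s \<in> {s. Re s > 1}" for s
      using eq[of s] that by (simp add: F_def)
    ultimately show ?thesis
      using has_field_derivative_transform_within_open[OF _ open_halfspace_Re_gt[of 1], of _ _ s F] s1 by force
  qed
  have "F 2 = of_real ((norm (A 2 * B 2))\<^sup>2)"
    using eq[of 2] unfolding F_def complex_norm_square by simp
  moreover have "A 2 \<noteq> 0" "B 2 \<noteq> 0"
    by (rule dirichlet_inverse(2)[OF a _ A] dirichlet_inverse(2)[OF b _ B]; simp)+
  ultimately have F2: "F 2 \<in> \<real>\<^sub>\<ge>\<^sub>0" "Re (F 2) > 0" by (auto simp: nonneg_Reals_of_real_iff simp del: of_real_power)
  have le: "Re (F 2) \<le> (C * \<sigma>) * (C * \<sigma>)" if \<sigma>: "0 < \<sigma>" "\<sigma> < 1 / 2" for \<sigma>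
  proof -
    have "Re (F 2) \<le> Re (F (of_real \<sigma>))"
      by (rule landau_monotone[OF holomorphic_on_subset[OF F ballsub] W(1) dF W(2) F2(1)]) (use \<sigma> in auto)
    also have "\<dots> \<le> norm (F (of_real \<sigma>))" by (rule complex_Re_le_cmod)
    also have "\<dots> = norm (\<Phi> (of_real \<sigma>)) * norm (\<Phi> (of_real \<sigma>))" by (simp add: F_def norm_mult)
    also have "\<dots> \<le> (C * \<sigma>) * (C * \<sigma>)"
      using small[OF \<sigma>] by (intro mult_mono) (auto intro: order.trans[OF norm_ge_zero])
    finally show ?thesis .
  qed
  have "((\<lambda>\<sigma>. (C * \<sigma>) * (C * \<sigma>)) \<longlongrightarrow> (C * 0) * (C * 0)) (at_right 0)"
    by (intro tendsto_intros)
  moreover have "eventually (\<lambda>\<sigma>. Re (F 2) \<le> (C * \<sigma>) * (C * \<sigma>)) (at_right 0)"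
    by (intro eventually_at_rightI[of 0 "1 / 2"]) (auto intro: le)
  ultimately have "Re (F 2) \<le> C * 0 * (C * 0)" by (intro tendsto_lowerbound) auto
  thus False using F2(2) by simp
qed

text \<open>The reciprocals of the Euler factors at 2 and 3. Two primes are taken because
  \<open>\<Psi>\<close> may grow like \<open>1 / \<sigma>\<close> at 0: for
  \<open>a = (\<lambda>_. 1)\<close> each factor has a zero there, one to absorb this growth and one
  to make \<open>\<Phi>\<close> tend to 0.\<close>

definition euler23 :: "(nat \<Rightarrow> complex) \<Rightarrow> complex \<Rightarrow> complex" where
  "euler23 a s = (1 - a 2 / of_nat 2 powr s) * (1 - a 3 / of_nat 3 powr s)"

lemma dirichlet_remove_2_3:
  fixes a :: "nat \<Rightarrow> complex"
  assumes mult: "\<And>m n. a (m * n) = a m * a n" and a1: "a 1 = 1" and bdd: "\<And>n. norm (a n) \<le> 1" and s: "Re s > 1"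
    and A: "(\<lambda>n. a (Suc n) / of_nat (Suc n) powr s) sums A"
  shows "(\<lambda>n. (if 2 dvd Suc n \<or> 3 dvd Suc n then 0 else a (Suc n)) / of_nat (Suc n) powr s) sums (euler23 a s * A)"
proof -
  define b where "b = (\<lambda>n. if 2 dvd n then 0 else a n)"
  have "(\<lambda>n. (if 2 dvd Suc n then 0 else a (Suc n)) / of_nat (Suc n) powr s) sums ((1 - a 2 / of_nat 2 powr s) * A)"
    by (rule dirichlet_remove_prime[OF mult bdd s _ A]) simp
  hence B: "(\<lambda>n. b (Suc n) / of_nat (Suc n) powr s) sums ((1 - a 2 / of_nat 2 powr s) * A)" by (simp only: b_def)
  have "(\<lambda>n. (if 3 dvd Suc n then 0 else b (Suc n)) / of_nat (Suc n) powr s) sums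
      ((1 - b 3 / of_nat 3 powr s) * ((1 - a 2 / of_nat 2 powr s) * A))"
    by (rule dirichlet_remove_prime[OF _ _ s _ B]) (use mult bdd in \<open>auto simp: b_def\<close>)
  moreover have "(if 3 dvd Suc n then 0 else b (Suc n)) = (if 2 dvd Suc n \<or> 3 dvd Suc n then 0 else a (Suc n))" for n
    by (auto simp: b_def)
  moreover have "b 3 = a 3" by (simp add: b_def)
  ultimately show ?thesis by (simp only: euler23_def mult_ac)
qed

text \<open>
  Removing the Euler factors at \<open>2\<close> and \<open>3\<close> makes \<open>\<Phi>\<close> vanish at \<open>0\<close>, which contradicts its
  monotonicity on \<open>(0, 2)\<close>.
\<close>

lemma nonvanishing_line:
  fixes a :: "nat \<Rightarrow> complex" and t :: real
  assumes a: "\<And>m n. a (m * n) = a m * a n" "a 1 = 1" "\<And>n. norm (a n) \<le> 1"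
    and A: "\<And>s. Re s > 1 \<Longrightarrow> (\<lambda>n. a (Suc n) / of_nat (Suc n) powr s) sums A s"
    and \<Psi>: "\<Psi> holomorphic_on {s. Re s > 0}"
    and eq: "\<And>s. Re s > 1 \<Longrightarrow> \<Psi> s * cnj (\<Psi> (cnj s)) =
       zeta s * A (s + \<i> * t) * cnj (zeta (cnj s) * A (cnj s + \<i> * t))"
    and small: "\<And>\<sigma>. 0 < \<sigma> \<Longrightarrow> \<sigma> < 1 / 2 \<Longrightarrow> norm (\<Psi> (of_real \<sigma>)) \<le> C / \<sigma>"
  shows False
proof -
  define b where "b = (\<lambda>n. a n / of_nat n powr (\<i> * t))"
  have b: "b (m * n) = b m * b n" "b 1 = 1" "norm (b n) \<le> 1" for m n
  proof -
    show "b (m * n) = b m * b n"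
      unfolding b_def of_nat_mult using a(1) by (subst powr_times_real) auto
    show "b 1 = 1" using a(2) by (simp add: b_def)
    show "norm (b n) \<le> 1"
      using a(3)[of n] norm_of_nat_powr[of n "\<i> * t"] by (cases "n = 0") (auto simp: b_def norm_divide)
  qed
  define one6 where "one6 = (\<lambda>n::nat. if 2 dvd n \<or> 3 dvd n then 0 else 1 :: complex)"
  define b6 where "b6 = (\<lambda>n. if 2 dvd n \<or> 3 dvd n then 0 else b n)"
  have p23: "2 dvd m * n \<longleftrightarrow> 2 dvd m \<or> 2 dvd n" "3 dvd m * n \<longleftrightarrow> 3 dvd m \<or> 3 dvd n" for m n :: nat
    by (simp_all add: prime_dvd_mult_iff)
  define \<Phi> where "\<Phi> = (\<lambda>s. euler23 (\<lambda>_. 1) s * euler23 b s * \<Psi> s)"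
  have B: "(\<lambda>n. b (Suc n) / of_nat (Suc n) powr s) sums A (s + \<i> * t)" if "Re s > 1" for s
    unfolding b_def dirichlet_series_shift by (rule A) (use that in simp)
  show False
  proof (rule landau_contradiction[where a = one6 and b = b6 and \<Phi> = \<Phi> and C = "8 * \<bar>C\<bar>"])
    show "one6 (m * n) = one6 m * one6 n" "b6 (m * n) = b6 m * b6 n" for m n
      using b(1)[of m n] by (auto simp: one6_def b6_def p23)
    show "one6 1 = 1" "b6 1 = 1" using b(2) by (auto simp: one6_def b6_def)
    show "norm (one6 n) \<le> 1" "norm (b6 n) \<le> 1" for n using b(3)[of n] by (auto simp: one6_def b6_def)
    \<comment> \<open>Where the coefficient of zeta is 1, the other has real part at least -1. Where
      it has been removed, the other must vanish as well; hence the same primes are removed from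
      both series.\<close>
    show "0 \<le> Re (one6 n + b6 n)" for n
      using b(3)[of n] abs_Re_le_cmod[of "b n"] by (auto simp: one6_def b6_def)
    show "(\<lambda>n. one6 (Suc n) / of_nat (Suc n) powr s) sums (euler23 (\<lambda>_. 1) s * zeta s)" if "Re s > 1" for s
      unfolding one6_def by (rule dirichlet_remove_2_3) (use that zeta_reg(5) in auto)
    show "(\<lambda>n. b6 (Suc n) / of_nat (Suc n) powr s) sums (euler23 b s * A (s + \<i> * t))" if "Re s > 1" for s
      unfolding b6_def by (rule dirichlet_remove_2_3[OF b that B[OF that]])
    have "euler23 f holomorphic_on {s. Re s > 0}" for f
      unfolding euler23_def by (intro holomorphic_intros) auto
    thus "\<Phi> holomorphic_on {s. Re s > 0}" unfolding \<Phi>_def by (intro holomorphic_intros \<Psi>)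
    show "\<Phi> s * cnj (\<Phi> (cnj s)) = euler23 (\<lambda>_. 1) s * zeta s * (euler23 b s * A (s + \<i> * t)) *
       cnj (euler23 (\<lambda>_. 1) (cnj s) * zeta (cnj s) * (euler23 b (cnj s) * A (cnj s + \<i> * t)))" if "Re s > 1" for s
    proof -
      have "\<Phi> s * cnj (\<Phi> (cnj s)) = euler23 (\<lambda>_. 1) s * euler23 b s * cnj (euler23 (\<lambda>_. 1) (cnj s) * euler23 b (cnj s)) *
          (\<Psi> s * cnj (\<Psi> (cnj s)))" by (simp add: \<Phi>_def)
      thus ?thesis unfolding eq[OF that] by (simp add: mult_ac)
    qed
    fix \<sigma> :: real assume \<sigma>: "0 < \<sigma>" "\<sigma> < 1 / 2"
    have e1: "norm (1 - 1 / of_nat p powr of_real \<sigma> :: complex) \<le> \<sigma> * ln p" if "p \<ge> 2" for p :: nat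
    proof -
      have "(of_nat p :: complex) powr of_real \<sigma> = of_real (real p powr \<sigma>)"
        using powr_of_real[of "real p" \<sigma>] by simp
      hence "1 - 1 / of_nat p powr of_real \<sigma> = (of_real (1 - real p powr (-\<sigma>)) :: complex)"
        by (simp add: powr_minus divide_inverse)
      hence "norm (1 - 1 / of_nat p powr of_real \<sigma> :: complex) = \<bar>1 - real p powr (-\<sigma>)\<bar>" by (simp only: norm_of_real)
      also have "real p powr (-\<sigma>) \<le> 1" using powr_mono[of "-\<sigma>" 0 "real p"] \<sigma> that by simp
      hence "\<bar>1 - real p powr (-\<sigma>)\<bar> = 1 - exp (- (\<sigma> * ln p))" using that by (simp add: powr_def)
      also have "\<dots> \<le> \<sigma> * ln p" using exp_ge_add_one_self[of "- (\<sigma> * ln p)"] by linarith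
      finally show ?thesis .
    qed
    have "ln (2::real) \<le> 1" "ln (3::real) \<le> 2" using ln_le_minus_one[of 2] ln_le_minus_one[of 3] by auto
    hence "\<sigma> * ln (real 2) \<le> \<sigma> * 1" "\<sigma> * ln (real 3) \<le> \<sigma> * 2" using \<sigma> by (intro mult_left_mono; simp)+
    hence e23: "norm (1 - 1 / of_nat 2 powr of_real \<sigma> :: complex) \<le> \<sigma> * 1" "norm (1 - 1 / of_nat 3 powr of_real \<sigma> :: complex) \<le> \<sigma> * 2"
      using e1[of 2] e1[of 3] by linarith+
    have "norm (euler23 (\<lambda>_. 1) (of_real \<sigma>)) \<le> (\<sigma> * 1) * (\<sigma> * 2)"
      unfolding euler23_def norm_mult by (rule mult_mono[OF e23]) (use \<sigma> in auto)
    moreover have b2: "norm (1 - b p / of_nat p powr of_real \<sigma>) \<le> 2" if "p \<ge> 1" for p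
    proof -
      have "norm (b p / of_nat p powr of_real \<sigma>) = norm (b p) / real p powr \<sigma>"
        using that norm_of_nat_powr[of p "of_real \<sigma>"] by (simp add: norm_divide)
      also have "\<dots> \<le> 1 / 1" using b(3)[of p] \<sigma> that by (intro frac_le) (auto intro: ge_one_powr_ge_zero)
      finally show ?thesis using norm_triangle_ineq4[of 1 "b p / of_nat p powr of_real \<sigma>"] by simp
    qed
    have "norm (euler23 b (of_real \<sigma>)) \<le> 2 * 2"
      unfolding euler23_def norm_mult by (intro mult_mono b2) auto
    ultimately have "norm (\<Phi> (of_real \<sigma>)) \<le> ((\<sigma> * 1) * (\<sigma> * 2)) * (2 * 2) * (C / \<sigma>)"
      unfolding \<Phi>_def norm_mult using small[OF \<sigma>] \<sigma> by (intro mult_mono) auto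
    also have "\<dots> = 8 * \<sigma> * C" using \<sigma> by simp
    also have "\<dots> \<le> 8 * \<bar>C\<bar> * \<sigma>" using \<sigma> by (simp add: mult_left_mono)
    finally show "norm (\<Phi> (of_real \<sigma>)) \<le> 8 * \<bar>C\<bar> * \<sigma>" .
  qed
qed

section \<open>Zeta and the nonprincipal L-functions on Re s = 1\<close>

lemma holomorphic_divide_zero:
  assumes f: "f holomorphic_on {s. Re s > 0}" and z: "Re z > 0" "f z = 0"
  obtains g where "g holomorphic_on {s. Re s > 0}" "\<And>s. f s = (s - z) * g s"
proof
  define g where "g = (\<lambda>s. if s = z then deriv f z else (f s - f z) / (s - z))"
  have "z \<in> interior {s. Re s > 0}" using z(1) interior_open[OF open_halfspace_Re_gt[of 0]] by simp
  thus "g holomorphic_on {s. Re s > 0}" unfolding g_def by (rule pole_lemma[OF f])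
  show "f s = (s - z) * g s" for s using z(2) by (simp add: g_def)
qed

text \<open>The factor \<open>norm s = \<sigma>\<close> cancels the \<open>1 / \<sigma>\<close> in
  the general bound, so there is no growth at 0 when the imaginary part is 0.\<close>

lemma zeta_reg_right_of_0:
  assumes \<sigma>: "0 < \<sigma>" "\<sigma> < 1 / 2"
  shows "norm (of_real \<sigma> - 1 :: complex) = 1 - \<sigma>" and "norm (zeta_reg (of_real \<sigma>)) \<le> 2"
proof -
  have "norm (of_real \<sigma> - 1 :: complex) = \<bar>\<sigma> - 1\<bar>" by (metis norm_of_real of_real_1 of_real_diff)
  thus n1: "norm (of_real \<sigma> - 1 :: complex) = 1 - \<sigma>" using \<sigma> by simp
  have "norm (zeta_reg (of_real \<sigma>)) \<le> 1 + norm (of_real \<sigma> - 1 :: complex) * norm (of_real \<sigma> :: complex) * (1 + 1 / \<sigma>)"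
    using zeta_reg(3)[of "of_real \<sigma>"] \<sigma> by simp
  also have "\<dots> = 2 - \<sigma> * \<sigma>" unfolding n1 using \<sigma> by (simp add: field_simps)
  also have "\<dots> \<le> 2" by simp
  finally show "norm (zeta_reg (of_real \<sigma>)) \<le> 2" .
qed

text \<open>In \<open>zeta s * zeta (s + \<i> * t)\<close> a zero at \<open>w = 1 + \<i> * t\<close>
  cancels the pole of the first factor at 1. The pole of the second factor at
  \<open>1 - \<i> * t\<close> remains; it is traded for the zero of the first factor at
  \<open>w\<close>, which is harmless since only the product with the reflection matters.\<close>

theorem zeta_reg_nonzero_line:
  "zeta_reg (Complex 1 t) \<noteq> 0"
proof
  assume z: "zeta_reg (Complex 1 t) = 0"
  have t: "t \<noteq> 0"
  proof
    assume "t = 0"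
    hence "Complex 1 t = 1" by (simp add: complex_eq_iff)
    thus False using z zeta_reg(2) by simp
  qed
  define w where "w = Complex 1 t"
  have w: "w = 1 + \<i> * t" by (simp add: w_def Complex_eq)
  obtain Y where Y: "Y holomorphic_on {s. Re s > 0}" "\<And>s. zeta_reg s = (s - w) * Y s"
    using holomorphic_divide_zero[OF zeta_reg(1), of w] z by (auto simp: w_def)
  have "(\<lambda>s. zeta_reg (s + \<i> * t)) holomorphic_on {s. Re s > 0}"
    by (rule holomorphic_on_compose_gen[OF _ zeta_reg(1), unfolded o_def]) (auto intro!: holomorphic_intros)
  then obtain X where X: "X holomorphic_on {s. Re s > 0}" "\<And>s. zeta_reg (s + \<i> * t) = (s - 1) * X s"
    using holomorphic_divide_zero[of "\<lambda>s. zeta_reg (s + \<i> * t)" 1] z by (auto simp: w_def[symmetric] w)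
  define \<Psi> where "\<Psi> = (\<lambda>s. Y s * X s)"
  show False
  proof (rule nonvanishing_line[where a = "\<lambda>_. 1" and A = zeta and \<Psi> = \<Psi> and t = t and C = "32 * (1 + \<bar>t\<bar>)\<^sup>2"])
    show "\<Psi> holomorphic_on {s. Re s > 0}" unfolding \<Psi>_def by (intro holomorphic_intros X Y)
    show "(\<lambda>n. 1 / of_nat (Suc n) powr s) sums zeta s" if "Re s > 1" for s by (rule zeta_reg(5)[OF that])
    show "\<Psi> s * cnj (\<Psi> (cnj s)) = zeta s * zeta (s + \<i> * t) * cnj (zeta (cnj s) * zeta (cnj s + \<i> * t))" if s: "Re s > 1" for s
    proof -
      have s': "s \<noteq> 1" "cnj s \<noteq> 1" "s + \<i> * t \<noteq> 1" "cnj s + \<i> * t \<noteq> 1" "s \<noteq> w" "cnj s \<noteq> w" using s by (auto simp: complex_eq_iff w)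
      have *: "zeta s * zeta (s + \<i> * t) = \<Psi> s * ((s - w) / (s + \<i> * t - 1))" if "Re s > 1" for s
      proof -
        have ne: "s \<noteq> 1" "s + \<i> * t \<noteq> 1" using that by (auto simp: complex_eq_iff)
        have "zeta s = (s - w) * Y s / (s - 1)" using zeta_reg(4)[of s] Y(2)[of s] ne that by simp
        moreover have "zeta (s + \<i> * t) = (s - 1) * X s / (s + \<i> * t - 1)"
          using zeta_reg(4)[of "s + \<i> * t"] X(2)[of s] ne that by simp
        ultimately show ?thesis using ne by (simp add: \<Psi>_def)
      qed
      \<comment> \<open>Reflection exchanges \<open>s - w\<close> and
        \<open>s + \<i> * t - 1\<close>, so this quotient and its reflection are reciprocal.\<close>
      have "((s - w) / (s + \<i> * t - 1)) * cnj ((cnj s - w) / (cnj s + \<i> * t - 1)) = 1"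
      proof -
        have "cnj ((cnj s - w) / (cnj s + \<i> * t - 1)) = (s + \<i> * t - 1) / (s - w)"
          by (simp add: w algebra_simps)
        moreover have "s + \<i> * t - 1 \<noteq> 0" "s - w \<noteq> 0" using s' by auto
        ultimately show ?thesis by simp
      qed
      thus ?thesis using *[OF s] *[of "cnj s"] s by (simp add: mult_ac)
    qed
    fix \<sigma> :: real assume \<sigma>: "0 < \<sigma>" "\<sigma> < 1 / 2"
    have 1: "1 + 1 / \<sigma> \<le> 2 / \<sigma>" using \<sigma> by (simp add: field_simps)
    have bz: "norm (zeta_reg (of_real \<sigma> + \<i> * u)) \<le> 4 * (1 + \<bar>u\<bar>)\<^sup>2 / \<sigma>" for u :: real
    proof -
      have "norm (of_real \<sigma> + \<i> * u - 1 :: complex) \<le> 1 + \<bar>u\<bar>" "norm (of_real \<sigma> + \<i> * u :: complex) \<le> 1 + \<bar>u\<bar>"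
        by (rule order.trans[OF cmod_le]; use \<sigma> in simp)+
      hence "norm (zeta_reg (of_real \<sigma> + \<i> * u)) \<le> 1 + (1 + \<bar>u\<bar>) * (1 + \<bar>u\<bar>) * (2 / \<sigma>)"
        using \<sigma> 1 by (intro order.trans[OF zeta_reg(3)] add_left_mono mult_mono) auto
      moreover have "1 * 1 * 1 \<le> (1 + \<bar>u\<bar>) * (1 + \<bar>u\<bar>) * (2 / \<sigma>)"
        using \<sigma> by (intro mult_mono) auto
      moreover have "4 * (1 + \<bar>u\<bar>)\<^sup>2 / \<sigma> = 2 * ((1 + \<bar>u\<bar>) * (1 + \<bar>u\<bar>) * (2 / \<sigma>))"
        by (simp add: power2_eq_square)
      ultimately show ?thesis by linarith
    qed
    note n1 = zeta_reg_right_of_0(1)[OF \<sigma>] and z2 = zeta_reg_right_of_0(2)[OF \<sigma>]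
    have "1 / 2 \<le> norm (of_real \<sigma> - w)"
      using abs_Re_le_cmod[of "of_real \<sigma> - w"] \<sigma> by (simp add: w)
    hence "1 / 2 * norm (Y (of_real \<sigma>)) \<le> norm (of_real \<sigma> - w) * norm (Y (of_real \<sigma>))"
      by (intro mult_right_mono) auto
    also have "\<dots> \<le> 2" using z2 Y(2)[of "of_real \<sigma>"] by (simp add: norm_mult)
    finally have Yb: "norm (Y (of_real \<sigma>)) \<le> 4" by simp
    have "1 / 2 * norm (X (of_real \<sigma>)) \<le> norm (of_real \<sigma> - 1 :: complex) * norm (X (of_real \<sigma>))"
      unfolding n1 using \<sigma> by (intro mult_right_mono) auto
    also have "\<dots> \<le> 4 * (1 + \<bar>t\<bar>)\<^sup>2 / \<sigma>" using bz[of t] X(2)[of "of_real \<sigma>"] by (simp add: norm_mult)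
    finally have Xb: "norm (X (of_real \<sigma>)) \<le> 8 * (1 + \<bar>t\<bar>)\<^sup>2 / \<sigma>" by simp
    have "norm (\<Psi> (of_real \<sigma>)) \<le> 4 * (8 * (1 + \<bar>t\<bar>)\<^sup>2 / \<sigma>)"
      unfolding \<Psi>_def norm_mult by (intro mult_mono Xb Yb) auto
    thus "norm (\<Psi> (of_real \<sigma>)) \<le> 32 * (1 + \<bar>t\<bar>)\<^sup>2 / \<sigma>" by simp
  qed auto
qed

lemma nonprincipal_character_facts:
  assumes "\<xi> \<in> nonprincipal_characters q"
  shows "q > 0" "\<And>m n. \<xi> (m * n) = \<xi> m * \<xi> n" "\<xi> 1 = 1" "\<And>n. norm (\<xi> n) \<le> 1" "\<And>n. \<xi> (n + q) = \<xi> n"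
    "dirichlet_L \<xi> holomorphic_on {s. Re s > 0}"
    "\<And>s. Re s > 0 \<Longrightarrow> norm (dirichlet_L \<xi> s) \<le> real q * norm s * (1 + 1 / Re s)"
    "\<And>s. Re s > 1 \<Longrightarrow> (\<lambda>n. \<xi> (Suc n) / of_nat (Suc n) powr s) sums dirichlet_L \<xi> s"
proof -
  have \<xi>: "dirichlet_character q \<xi>" using assms by (simp add: nonprincipal_characters_def)
  show q: "q > 0" and "\<And>m n. \<xi> (m * n) = \<xi> m * \<xi> n" and per: "\<And>n. \<xi> (n + q) = \<xi> n"
    using \<xi> by (auto simp: dirichlet_character_def)
  show "\<xi> 1 = 1" by (rule dirichlet_character_1[OF \<xi>])
  show bdd: "\<And>n. norm (\<xi> n) \<le> 1" by (rule norm_dirichlet_character_le_1[OF \<xi>])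
  note L = dirichlet_L_mean_zero[of q \<xi>, OF q per sum_nonprincipal_character[OF assms] bdd]
  show "dirichlet_L \<xi> holomorphic_on {s. Re s > 0}" by (rule L(1))
  show "\<And>s. Re s > 0 \<Longrightarrow> norm (dirichlet_L \<xi> s) \<le> real q * norm s * (1 + 1 / Re s)" by (rule L(2))
  show "\<And>s. Re s > 1 \<Longrightarrow> (\<lambda>n. \<xi> (Suc n) / of_nat (Suc n) powr s) sums dirichlet_L \<xi> s"
    using is_dirichlet_L_dirichlet_L[of q \<xi>] q per by (simp add: is_dirichlet_L_def)
qed

text \<open>Here the only pole is that of zeta at 1, and the assumed zero of the shifted L-function
  cancels it. The argument treats \<open>t = 0\<close> and real characters like all others, so
  \<open>L(1, \<chi>)\<close> requires no case of its own.\<close>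

theorem dirichlet_L_nonzero_line:
  assumes \<xi>: "\<xi> \<in> nonprincipal_characters q"
  shows "dirichlet_L \<xi> (Complex 1 t) \<noteq> 0"
proof
  assume z: "dirichlet_L \<xi> (Complex 1 t) = 0"
  note c = nonprincipal_character_facts[OF \<xi>]
  have w: "Complex 1 t = 1 + \<i> * t" by (simp add: Complex_eq)
  have "(\<lambda>s. dirichlet_L \<xi> (s + \<i> * t)) holomorphic_on {s. Re s > 0}"
    by (rule holomorphic_on_compose_gen[OF _ c(6), unfolded o_def]) (auto intro!: holomorphic_intros)
  then obtain X where X: "X holomorphic_on {s. Re s > 0}" "\<And>s. dirichlet_L \<xi> (s + \<i> * t) = (s - 1) * X s"
    using holomorphic_divide_zero[of "\<lambda>s. dirichlet_L \<xi> (s + \<i> * t)" 1] z by (auto simp: w)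
  define \<Psi> where "\<Psi> = (\<lambda>s. zeta_reg s * X s)"
  show False
  proof (rule nonvanishing_line[where a = \<xi> and A = "dirichlet_L \<xi>" and \<Psi> = \<Psi> and t = t and C = "8 * (real q * (1 + \<bar>t\<bar>))"])
    show "\<Psi> holomorphic_on {s. Re s > 0}" unfolding \<Psi>_def by (intro holomorphic_intros X zeta_reg)
    show "\<Psi> s * cnj (\<Psi> (cnj s)) = zeta s * dirichlet_L \<xi> (s + \<i> * t) * cnj (zeta (cnj s) * dirichlet_L \<xi> (cnj s + \<i> * t))" if s: "Re s > 1" for s
    proof -
      have "zeta s * dirichlet_L \<xi> (s + \<i> * t) = \<Psi> s" if "Re s > 1" for s
      proof -
        have "s \<noteq> 1" using that by auto
        moreover have "zeta s = zeta_reg s / (s - 1)" using zeta_reg(4)[of s] that \<open>s \<noteq> 1\<close> by simp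
        ultimately show ?thesis by (simp add: \<Psi>_def X(2))
      qed
      from this[of s] this[of "cnj s"] s show ?thesis by simp
    qed
    fix \<sigma> :: real assume \<sigma>: "0 < \<sigma>" "\<sigma> < 1 / 2"
    have 1: "1 + 1 / \<sigma> \<le> 2 / \<sigma>" using \<sigma> by (simp add: field_simps)
    note n1 = zeta_reg_right_of_0(1)[OF \<sigma>] and z2 = zeta_reg_right_of_0(2)[OF \<sigma>]
    have "norm (of_real \<sigma> + \<i> * t :: complex) \<le> 1 + \<bar>t\<bar>"
      by (rule order.trans[OF cmod_le]) (use \<sigma> in simp)
    hence "norm (dirichlet_L \<xi> (of_real \<sigma> + \<i> * t)) \<le> real q * (1 + \<bar>t\<bar>) * (2 / \<sigma>)"
      using \<sigma> 1 by (intro order.trans[OF c(7)] mult_mono) auto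
    moreover have "1 / 2 * norm (X (of_real \<sigma>)) \<le> norm (of_real \<sigma> - 1 :: complex) * norm (X (of_real \<sigma>))"
      unfolding n1 using \<sigma> by (intro mult_right_mono) auto
    ultimately have "norm (X (of_real \<sigma>)) \<le> 4 * (real q * (1 + \<bar>t\<bar>)) / \<sigma>"
      using X(2)[of "of_real \<sigma>"] by (simp add: norm_mult)
    hence "norm (\<Psi> (of_real \<sigma>)) \<le> 2 * (4 * (real q * (1 + \<bar>t\<bar>)) / \<sigma>)"
      unfolding \<Psi>_def norm_mult by (intro mult_mono z2) auto
    thus "norm (\<Psi> (of_real \<sigma>)) \<le> 8 * (real q * (1 + \<bar>t\<bar>)) / \<sigma>" by simp
  qed (use c in auto)
qed

lemma dirichlet_L_nonzero_GRH:
  assumes GRH and \<xi>: "\<xi> \<in> nonprincipal_characters q" and s: "Re s > 1 / 2"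
  shows "dirichlet_L \<xi> s \<noteq> 0"
proof
  assume z: "dirichlet_L \<xi> s = 0"
  note c = nonprincipal_character_facts[OF \<xi>]
  consider "Re s < 1" | "Re s = 1" | "Re s > 1" by linarith
  thus False
  proof cases
    case 1
    hence "s \<in> nontrivial_zeros (dirichlet_L \<xi>)" using s z by (simp add: nontrivial_zeros_def)
    moreover have "dirichlet_character q \<xi>" using \<xi> by (simp add: nonprincipal_characters_def)
    ultimately have "Re s = 1 / 2" using \<open>GRH\<close> unfolding GRH_def by blast
    thus False using s by simp
  next
    case 2
    hence "s = Complex 1 (Im s)" by (simp add: complex_eq_iff)
    thus False using dirichlet_L_nonzero_line[OF \<xi>, of "Im s"] z by simp
  next
    case 3
    thus False using dirichlet_inverse(2)[OF c(2,3,4) 3 c(8)[OF 3]] z by simp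
  qed
qed

lemma zeta_reg_nonzero_GRH:
  assumes GRH and s: "Re s > 1 / 2"
  shows "zeta_reg s \<noteq> 0"
proof
  assume z: "zeta_reg s = 0"
  have s1: "s \<noteq> 1" using z zeta_reg(2) by auto
  hence zz: "zeta s = 0" using zeta_reg(4)[of s] s z by simp
  consider "Re s < 1" | "Re s = 1" | "Re s > 1" by linarith
  thus False
  proof cases
    case 1
    hence "s \<in> nontrivial_zeros zeta" using s zz by (simp add: nontrivial_zeros_def)
    hence "Re s = 1 / 2" using \<open>GRH\<close> unfolding GRH_def by blast
    thus False using s by simp
  next
    case 2
    hence "s = Complex 1 (Im s)" by (simp add: complex_eq_iff)
    thus False using zeta_reg_nonzero_line[of "Im s"] z by simp
  next
    case 3
    have "zeta s \<noteq> 0" by (rule dirichlet_inverse(2)[where a = "\<lambda>_. 1", OF _ _ _ 3 zeta_reg(5)[OF 3]]) auto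
    thus False using zz by simp
  qed
qed

section \<open>Logarithms of L-functions\<close>

text \<open>The map sending v to \<open>v / (2 * M - v)\<close> takes the half-plane
  \<open>Re v < M\<close> into the unit disc and fixes 0. Schwarz's lemma applies to its composition
  with the rescaled \<open>f\<close>, and solving for \<open>f z\<close> gives the bound.\<close>

lemma borel_caratheodory:
  assumes f: "f holomorphic_on ball c R" "f c = 0" and R: "R > 0" and M: "M > 0"
    and Re: "\<And>z. z \<in> ball c R \<Longrightarrow> Re (f z) < M" and r: "norm (z - c) \<le> r" "r < R"
  shows "norm (f z) \<le> 2 * M * r / (R - r)"
proof -
  define h where "h = (\<lambda>w. f (c + of_real R * w))"
  define g where "g = (\<lambda>w. h w / (2 * of_real M - h w))"
  have in_ball: "c + of_real R * w \<in> ball c R" if "norm w < 1" for w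
    using that R by (simp add: dist_norm norm_mult)
  have hM: "Re (h w) < M" if "norm w < 1" for w
    unfolding h_def by (rule Re[OF in_ball[OF that]])
  have ne: "2 * of_real M - h w \<noteq> 0" if "norm w < 1" for w
  proof
    assume "2 * of_real M - h w = 0"
    hence "Re (h w) = 2 * M" by (simp add: complex_eq_iff)
    thus False using hM[OF that] M by simp
  qed
  have holh: "h holomorphic_on ball 0 1"
    unfolding h_def by (rule holomorphic_on_compose_gen[OF _ f(1), unfolded o_def])
      (use in_ball in \<open>auto intro!: holomorphic_intros\<close>)
  have holg: "g holomorphic_on ball 0 1"
    unfolding g_def using ne by (intro holomorphic_intros holh) auto
  have g1: "norm (g w) < 1" if "norm w < 1" for w
  proof -
    have "(norm (h w))\<^sup>2 < (norm (2 * of_real M - h w))\<^sup>2"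
      using mult_strict_left_mono[OF hM[OF that] M] by (simp add: cmod_power2) (simp add: power2_eq_square algebra_simps)
    hence "norm (h w) < norm (2 * of_real M - h w)" by (rule power2_less_imp_less) simp
    thus ?thesis using ne[OF that] by (simp add: g_def norm_divide)
  qed
  define w where "w = (z - c) / of_real R"
  define t where "t = r / R"
  have w: "norm w \<le> t" "t < 1" using r R by (auto simp: w_def t_def norm_divide divide_right_mono)
  have w1: "norm w < 1" using w by simp
  have "norm (g w) \<le> norm w"
    by (rule Schwarz_Lemma(1)[OF holg _ g1 w1]) (use f(2) in \<open>auto simp: g_def h_def\<close>)
  hence gt: "norm (g w) \<le> t" using w by simp
  have fz: "h w = f z" using R by (simp add: h_def w_def)
  have "f z = g w * (2 * of_real M - f z)" using ne[OF w1] by (simp add: g_def fz)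
  hence "norm (f z) = norm (g w) * norm (2 * of_real M - f z)" by (metis norm_mult)
  also have "\<dots> \<le> t * (2 * M + norm (f z))"
    using gt M norm_triangle_ineq4[of "2 * of_real M" "f z"] order.trans[OF norm_ge_zero gt]
    by (intro mult_mono) (auto simp: norm_mult)
  finally have "norm (f z) * (1 - t) \<le> 2 * M * t" by (simp add: algebra_simps)
  hence "norm (f z) \<le> 2 * M * t / (1 - t)" using w by (simp add: field_simps)
  also have "\<dots> = 2 * M * r / (R - r)" using R r by (simp add: t_def field_simps)
  finally show ?thesis .
qed

text \<open>Here \<open>g\<close> is the logarithm of \<open>L z / L c\<close> that vanishes at
  \<open>c\<close>. The radius \<open>R'\<close> and the bound \<open>M\<close> are quantified after
  \<open>g\<close>, so that a single logarithm can be estimated both near the centre and near the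
  boundary.\<close>

lemma holomorphic_log_bound:
  assumes L: "L holomorphic_on ball c R" "\<And>z. z \<in> ball c R \<Longrightarrow> L z \<noteq> 0" and R: "R > 0" 
  obtains g where "g holomorphic_on ball c R" "\<And>z. z \<in> ball c R \<Longrightarrow> L z = L c * exp (g z)"
    "\<And>z. z \<in> ball c R \<Longrightarrow> deriv L z / L z = deriv g z"
    "\<And>R' M r z. 0 < R' \<Longrightarrow> R' \<le> R \<Longrightarrow> M > 0 \<Longrightarrow> (\<And>z. z \<in> ball c R' \<Longrightarrow> norm (L z) < exp M * norm (L c)) \<Longrightarrow>
       norm (z - c) \<le> r \<Longrightarrow> r < R' \<Longrightarrow> norm (g z) \<le> 2 * M * r / (R' - r)"
proof -
  have cb: "c \<in> ball c R" using R by simp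
  obtain g0 where g0: "g0 holomorphic_on ball c R" "\<And>x. x \<in> ball c R \<Longrightarrow> exp (g0 x) = L x"
    using holomorphic_logarithm_exists[OF convex_ball open_ball L cb] by blast
  define g where "g = (\<lambda>z. g0 z - g0 c)"
  have holg: "g holomorphic_on ball c R" unfolding g_def by (intro holomorphic_intros g0)
  have Lg: "L z = L c * exp (g z)" if "z \<in> ball c R" for z
    using g0(2)[OF that] g0(2)[OF cb] L(2)[OF cb] by (simp add: g_def exp_diff)
  show ?thesis
  proof (rule that[OF holg Lg])
    fix z assume z: "z \<in> ball c R"
    have dg: "(g has_field_derivative deriv g z) (at z)" by (rule holomorphic_derivI[OF holg open_ball z])
    have "((\<lambda>z. L c * exp (g z)) has_field_derivative (L c * (exp (g z) * deriv g z))) (at z)"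
      by (intro DERIV_cmult DERIV_chain2[OF DERIV_exp dg])
    hence "(L has_field_derivative (L c * (exp (g z) * deriv g z))) (at z)"
      by (rule has_field_derivative_transform_within_open[OF _ open_ball z]) (simp add: Lg)
    hence "deriv L z = L z * deriv g z" using Lg[OF z] by (simp add: DERIV_imp_deriv mult.assoc)
    thus "deriv L z / L z = deriv g z" using L(2)[OF z] by simp
  next
    fix R' M r z
    assume R': "0 < R'" "R' \<le> R" and M: "M > 0" and bd: "\<And>z. z \<in> ball c R' \<Longrightarrow> norm (L z) < exp M * norm (L c)"
      and r: "norm (z - c) \<le> r" "r < R'"
    have sub: "ball c R' \<subseteq> ball c R" using R' by auto
    show "norm (g z) \<le> 2 * M * r / (R' - r)"
    proof (rule borel_caratheodory[OF holomorphic_on_subset[OF holg sub] _ R'(1) M _ r])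
      show "g c = 0" by (simp add: g_def)
      fix z assume z: "z \<in> ball c R'"
      have "norm (L c) * exp (Re (g z)) < norm (L c) * exp M"
        using bd[OF z] Lg[of z] z sub by (simp add: norm_mult mult.commute subset_iff)
      thus "Re (g z) < M" by (metis exp_less_cancel_iff mult_less_cancel_left_pos mult_less_cancel_left norm_ge_zero not_less)
    qed
  qed
qed

text \<open>
  A weak form of the three circles theorem: the Taylor coefficients up to order \<open>K\<close> are estimated on
  the small circle of radius \<open>r1\<close>, the others on the circle of radius \<open>r2\<close>.
\<close>

lemma two_circle_bound:
  assumes g: "g holomorphic_on ball c R" and r: "0 < r1" "0 \<le> \<rho>" "\<rho> < r2" "r1 < R" "r2 < R"
    and A: "\<And>z. norm (z - c) = r1 \<Longrightarrow> norm (g z) \<le> A" and M: "\<And>z. norm (z - c) = r2 \<Longrightarrow> norm (g z) \<le> M"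
    and z: "norm (z - c) \<le> \<rho>"
  shows "norm (g z) \<le> A * (\<Sum>k<K. (\<rho> / r1) ^ k) + M * ((\<rho> / r2) ^ K / (1 - \<rho> / r2))"
proof -
  have contg: "continuous_on (ball c R) g" using g by (rule holomorphic_on_imp_continuous_on)
  define u where "u = (\<lambda>n. (deriv ^^ n) g c / fact n * (z - c) ^ n)"
  have S: "u sums g z"
    unfolding u_def by (rule holomorphic_power_series[OF g]) (use z r in \<open>simp add: dist_norm norm_minus_commute\<close>)
  \<comment> \<open>Cauchy's inequality on a circle of radius \<open>r'\<close>, kept general
    because it is applied with \<open>r1\<close> to the first \<open>K\<close> terms and with
    \<open>r2\<close> to the tail.\<close>
  have bnd: "norm (u n) \<le> B * (\<rho> / r') ^ n"
    if "0 < r'" "r' < R" and B: "\<And>z. norm (z - c) = r' \<Longrightarrow> norm (g z) \<le> B" for n r' B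
  proof -
    have "norm ((deriv ^^ n) g c) \<le> fact n * B / r' ^ n"
      by (rule Cauchy_inequality)
         (use that in \<open>auto intro!: holomorphic_on_subset[OF g] continuous_on_subset[OF contg] B simp: norm_minus_commute\<close>)
    moreover have "0 \<le> (fact n * B / r' ^ n) / fact n"
      using order.trans[OF norm_ge_zero \<open>norm ((deriv ^^ n) g c) \<le> fact n * B / r' ^ n\<close>]
      by (rule divide_nonneg_nonneg[OF _ fact_ge_zero])
    ultimately have "norm (u n) \<le> (fact n * B / r' ^ n) / fact n * \<rho> ^ n"
      unfolding u_def norm_mult norm_divide norm_power norm_fact using z
      by (intro mult_mono divide_right_mono power_mono) auto
    thus ?thesis by (simp add: power_divide)
  qed
  have q: "0 \<le> \<rho> / r2" "\<rho> / r2 < 1" using r by auto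
  have "norm (g z) = norm ((\<Sum>n. u (n + K)) + (\<Sum>n<K. u n))"
    using suminf_split_initial_segment[OF sums_summable[OF S], of K] sums_unique[OF S] by simp
  also have "\<dots> \<le> M * ((\<rho> / r2) ^ K / (1 - \<rho> / r2)) + A * (\<Sum>k<K. (\<rho> / r1) ^ k)"
  proof (rule norm_triangle_le[OF add_mono])
    have "norm (\<Sum>n. u (n + K)) \<le> (\<Sum>n. M * (\<rho> / r2) ^ K * (\<rho> / r2) ^ n)"
    proof (rule norm_suminf_le)
      show "summable (\<lambda>n. M * (\<rho> / r2) ^ K * (\<rho> / r2) ^ n)" using q by (intro summable_mult summable_geometric) auto
      show "norm (u (n + K)) \<le> M * (\<rho> / r2) ^ K * (\<rho> / r2) ^ n" for n
        using bnd[of r2 M "n + K"] M r by (simp add: power_add mult_ac)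
    qed
    also have "\<dots> = M * ((\<rho> / r2) ^ K / (1 - \<rho> / r2))"
      using q by (subst suminf_mult) (auto simp: suminf_geometric summable_geometric)
    finally show "norm (\<Sum>n. u (n + K)) \<le> M * ((\<rho> / r2) ^ K / (1 - \<rho> / r2))" .
    have "norm (\<Sum>n<K. u n) \<le> (\<Sum>n<K. A * (\<rho> / r1) ^ n)"
      by (intro sum_norm_le bnd A) (use r in auto)
    thus "norm (\<Sum>n<K. u n) \<le> A * (\<Sum>k<K. (\<rho> / r1) ^ k)" by (simp add: sum_distrib_left)
  qed
  finally show ?thesis by simp
qed

section \<open>Summatory functions under the Riemann hypothesis\<close>

lemma norm_Complex_2_ball:
  assumes "z \<in> ball (Complex 2 t) r"
  shows "2 - r < Re z" "Re z < 2 + r" "\<bar>Im z - t\<bar> < r" "norm z < 2 + \<bar>t\<bar> + r"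
proof -
  have n: "norm (z - Complex 2 t) < r" using assms by (simp add: dist_norm norm_minus_commute)
  have "\<bar>Re z - 2\<bar> < r" using abs_Re_le_cmod[of "z - Complex 2 t"] n by simp
  thus "2 - r < Re z" "Re z < 2 + r" by auto
  show "\<bar>Im z - t\<bar> < r" using abs_Im_le_cmod[of "z - Complex 2 t"] n by simp
  have "norm z \<le> norm (z - Complex 2 t) + norm (Complex 2 t)" using norm_triangle_ineq[of "z - Complex 2 t" "Complex 2 t"] by simp
  moreover have "norm (Complex 2 t) \<le> 2 + \<bar>t\<bar>" using cmod_le[of "Complex 2 t"] by simp
  ultimately show "norm z < 2 + \<bar>t\<bar> + r" using n by linarith
qed

lemma dist_Complex_2:
  assumes "1 / 2 + \<eta> \<le> Re s" "Re s \<le> 2"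
  shows "norm (s - Complex 2 (Im s)) \<le> 3 / 2 - \<eta>"
proof -
  have "s - Complex 2 (Im s) = of_real (Re s - 2)" by (simp add: complex_eq_iff)
  thus ?thesis using assms by (simp del: of_real_diff)
qed

text \<open>The disc of radius \<open>3 / 2\<close> about \<open>2 + \<i> * t\<close> touches the
  critical line, so GRH provides a logarithm on all of it. Borel-Caratheodory bounds the logarithm
  up to radius \<open>3 / 2 - \<eta> / 2\<close>, and Cauchy's inequality on a circle of radius
  \<open>\<eta> / 2\<close> about \<open>s\<close> turns this into a bound for its
  derivative.\<close>

lemma dirichlet_L_log_deriv_bound:
  assumes GRH and \<xi>: "\<xi> \<in> nonprincipal_characters q" and \<eta>: "0 < \<eta>" "\<eta> \<le> 1 / 4"
    and s: "1 / 2 + \<eta> \<le> Re s" "Re s \<le> 2"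
  shows "norm (deriv (dirichlet_L \<xi>) s / dirichlet_L \<xi> s) \<le> 12 / \<eta>\<^sup>2 * ln (7 * real q * (\<bar>Im s\<bar> + 4))"
proof -
  note c = nonprincipal_character_facts[OF \<xi>]
  define t where "t = Im s"
  define w where "w = Complex 2 t"
  define L where "L = dirichlet_L \<xi>"
  \<comment> \<open>On the disc \<open>norm (L z)\<close> is at most
    \<open>3 * real q * (\<bar>t\<bar> + 4)\<close>, and \<open>norm (L w)\<close> is at least
    \<open>1 / 2\<close>; any constant above 6 gives the strict inequality
    \<open>up\<close>.\<close>
  define M where "M = ln (7 * real q * (\<bar>t\<bar> + 4))"
  have q: "real q \<ge> 1" using c(1) by simp
  have arg: "7 * real q * (\<bar>t\<bar> + 4) \<ge> 28" using mult_mono[of 1 "real q" 4 "\<bar>t\<bar> + 4"] q by simp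
  have M: "M > 0" unfolding M_def using arg by simp
  have expM: "exp M = 7 * real q * (\<bar>t\<bar> + 4)" unfolding M_def using arg by simp
  have ball: "Re z > 1 / 2" if "z \<in> ball w (3 / 2)" for z
    using norm_Complex_2_ball(1)[of z t "3/2"] that by (simp add: w_def)
  have L1: "L holomorphic_on ball w (3 / 2)"
    unfolding L_def by (rule holomorphic_on_subset[OF c(6)]) (use ball in force)
  have L2: "L z \<noteq> 0" if "z \<in> ball w (3 / 2)" for z
    unfolding L_def by (rule dirichlet_L_nonzero_GRH[OF \<open>GRH\<close> \<xi> ball[OF that]])
  have Lw: "norm (L w) \<ge> 1 / 2"
  proof -
    have Rw: "Re w > 1" by (simp add: w_def)
    have "norm (inverse (L w)) \<le> 1 + 1 / (Re w - 1)"
      unfolding L_def by (rule dirichlet_inverse(4)[OF c(2,3,4) Rw c(8)[OF Rw]])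
    moreover have "L w \<noteq> 0" by (rule L2) simp
    ultimately show ?thesis by (simp add: w_def norm_inverse norm_divide field_simps)
  qed
  obtain g where g: "g holomorphic_on ball w (3 / 2)" "\<And>z. z \<in> ball w (3 / 2) \<Longrightarrow> deriv L z / L z = deriv g z"
    "\<And>R' M r z. 0 < R' \<Longrightarrow> R' \<le> 3 / 2 \<Longrightarrow> M > 0 \<Longrightarrow> (\<And>z. z \<in> ball w R' \<Longrightarrow> norm (L z) < exp M * norm (L w)) \<Longrightarrow>
       norm (z - w) \<le> r \<Longrightarrow> r < R' \<Longrightarrow> norm (g z) \<le> 2 * M * r / (R' - r)"
    using holomorphic_log_bound[OF L1 L2] by (metis zero_less_divide_iff zero_less_numeral)
  have up: "norm (L z) < exp M * norm (L w)" if z: "z \<in> ball w (3 / 2)" for z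
  proof -
    have "norm (L z) \<le> real q * norm z * (1 + 1 / Re z)"
      unfolding L_def by (rule c(7)) (use ball[OF z] in simp)
    also have "\<dots> \<le> real q * (\<bar>t\<bar> + 4) * 3"
      using norm_Complex_2_ball(4)[of z t "3/2"] z ball[OF z] by (intro mult_mono) (auto simp: w_def field_simps)
    also have "\<dots> < exp M * (1 / 2)" unfolding expM using mult_pos_pos[of "real q" "\<bar>t\<bar> + 4"] q by simp
    also have "\<dots> \<le> exp M * norm (L w)" by (intro mult_left_mono Lw) simp
    finally show ?thesis .
  qed
  have gb: "norm (g z) \<le> 6 * M / \<eta>" if z: "norm (z - w) \<le> 3 / 2 - \<eta> / 2" for z
  proof -
    have "norm (g z) \<le> 2 * M * (3 / 2 - \<eta> / 2) / (3 / 2 - (3 / 2 - \<eta> / 2))"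
      by (rule g(3)[OF _ _ M up z]) (use \<eta> in auto)
    also have "\<dots> \<le> 2 * M * (3 / 2) / (\<eta> / 2)" using M \<eta> by (intro frac_le mult_left_mono) auto
    finally show ?thesis by simp
  qed
  have sw: "norm (s - w) \<le> 3 / 2 - \<eta>" unfolding w_def t_def by (rule dist_Complex_2[OF s])
  have sub: "cball s (\<eta> / 2) \<subseteq> ball w (3 / 2)"
  proof
    fix z assume "z \<in> cball s (\<eta> / 2)"
    hence "norm (z - w) \<le> \<eta> / 2 + (3 / 2 - \<eta>)"
      using norm_triangle_ineq[of "z - s" "s - w"] sw by (simp add: dist_norm norm_minus_commute)
    thus "z \<in> ball w (3 / 2)" using \<eta> by (simp add: dist_norm norm_minus_commute)
  qed
  have "norm ((deriv ^^ 1) g s) \<le> fact 1 * (6 * M / \<eta>) / (\<eta> / 2) ^ 1"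
  proof (rule Cauchy_inequality)
    show "g holomorphic_on ball s (\<eta> / 2)" by (rule holomorphic_on_subset[OF g(1)]) (use sub ball_subset_cball in blast)
    show "continuous_on (cball s (\<eta> / 2)) g"
      by (rule holomorphic_on_imp_continuous_on[OF holomorphic_on_subset[OF g(1) sub]])
    show "norm (g x) \<le> 6 * M / \<eta>" if "norm (s - x) = \<eta> / 2" for x
      by (rule gb) (use norm_triangle_ineq[of "x - s" "s - w"] sw that in \<open>simp add: norm_minus_commute\<close>)
  qed (use \<eta> in auto)
  hence "norm (deriv g s) \<le> 12 / \<eta>\<^sup>2 * M" by (simp add: power2_eq_square)
  moreover have "s \<in> ball w (3 / 2)" using sw \<eta> by (simp add: dist_norm norm_minus_commute)
  ultimately show ?thesis using g(2)[of s] by (simp add: L_def M_def t_def)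
qed

text \<open>The constant precedes \<open>q\<close>, \<open>\<xi>\<close> and \<open>x\<close>.
  Uniformity comes from weakening the logarithm of \<open>q * (\<bar>Im s\<bar> + 4)\<close> to its
  power \<open>\<eta>\<close>, which splits into a power of \<open>q\<close> and one of
  \<open>1 + \<bar>Im s\<bar>\<close>.\<close>

theorem psi_character_bound:
  assumes GRH and \<eta>: "0 < \<eta>" "\<eta> \<le> 1 / 4"
  shows "\<exists>C\<ge>0. \<forall>q \<xi> x. \<xi> \<in> nonprincipal_characters q \<longrightarrow> x \<ge> 1 \<longrightarrow>
    norm (\<Sum>n=1..x. mangoldt n * \<xi> n) \<le> C * real q powr \<eta> * real x powr (1 / 2 + 2 * \<eta>)"
proof -
  \<comment> \<open>The first factor comes from the logarithmic derivative,
    \<open>1 / \<eta>\<close> from \<open>ln_powr_bound\<close>, and 28 is 7 times the 4 in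
    \<open>\<bar>Im s\<bar> + 4 \<le> 4 * (1 + \<bar>Im s\<bar>)\<close>.\<close>
  define K where "K = 12 / \<eta>\<^sup>2 * (28 / \<eta>)"
  have K: "K \<ge> 0" using \<eta> by (simp add: K_def)
  have "norm (\<Sum>n=1..x. mangoldt n * \<xi> n) \<le> 24 / \<eta> * (K + 1 / \<eta>) * real q powr \<eta> * real x powr (1 / 2 + 2 * \<eta>)"
    if \<xi>: "\<xi> \<in> nonprincipal_characters q" and x: "x \<ge> 1" for q \<xi> x
  proof -
    note c = nonprincipal_character_facts[OF \<xi>]
    have q: "real q \<ge> 1" using c(1) by simp
    define F where "F = (\<lambda>s. - (deriv (dirichlet_L \<xi>) s / dirichlet_L \<xi> s))"
    have "norm (\<Sum>n=1..x. mangoldt n * \<xi> n) \<le> 24 / \<eta> * (K * real q powr \<eta> + 1 / \<eta>) * real x powr (1 / 2 + 2 * \<eta>)"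
    proof (rule summatory_function_bound[OF \<eta> _ x, where F = F])
      show "0 \<le> K * real q powr \<eta>" using K by simp
      show "norm (mangoldt n * \<xi> n) \<le> 1 / \<eta> * real n powr \<eta>" if "n \<ge> 1" for n
        by (rule norm_mangoldt_times_le[OF that \<eta>(1) c(4)])
      have hol: "dirichlet_L \<xi> holomorphic_on {s. Re s > 1 / 2}" by (rule holomorphic_on_subset[OF c(6)]) auto
      show "F holomorphic_on {s. Re s > 1 / 2}"
        unfolding F_def using dirichlet_L_nonzero_GRH[OF \<open>GRH\<close> \<xi>]
        by (intro holomorphic_intros holomorphic_deriv hol open_halfspace_Re_gt) auto
      show "(\<lambda>n. mangoldt (Suc n) * \<xi> (Suc n) / of_nat (Suc n) powr s) sums F s" if "Re s = 2" for s
      proof -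
        have s: "Re s > 1" using that by simp
        obtain W where W: "(\<lambda>n. mangoldt (Suc n) * \<xi> (Suc n) / of_nat (Suc n) powr s) sums W"
          "(dirichlet_L \<xi> has_field_derivative - (dirichlet_L \<xi> s * W)) (at s)"
          using dirichlet_log_derivative[OF c(2,4) s c(8)] by blast
        moreover have "dirichlet_L \<xi> s \<noteq> 0" by (rule dirichlet_L_nonzero_GRH[OF \<open>GRH\<close> \<xi>]) (use s in simp)
        ultimately show ?thesis using DERIV_imp_deriv[OF W(2)] by (simp add: F_def)
      qed
      fix s assume s: "1 / 2 + \<eta> \<le> Re s" "Re s \<le> 2"
      define y where "y = 7 * real q * (\<bar>Im s\<bar> + 4)"
      have y: "1 \<le> y" using mult_mono[of 1 "real q" 4 "\<bar>Im s\<bar> + 4"] q by (simp add: y_def)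
      have "norm (F s) \<le> 12 / \<eta>\<^sup>2 * ln y"
        using dirichlet_L_log_deriv_bound[OF \<open>GRH\<close> \<xi> \<eta> s] by (simp add: F_def y_def)
      also have "\<dots> \<le> 12 / \<eta>\<^sup>2 * (y powr \<eta> / \<eta>)"
        using ln_powr_bound[OF y \<eta>(1)] by (intro mult_left_mono) auto
      also have "y powr \<eta> \<le> 28 * (real q powr \<eta> * (1 + \<bar>Im s\<bar>) powr \<eta>)"
      proof -
        have "y \<le> 28 * (real q * (1 + \<bar>Im s\<bar>))" unfolding y_def using mult_nonneg_nonneg[of "real q" "\<bar>Im s\<bar>"] by (simp add: algebra_simps)
        hence "y powr \<eta> \<le> (28 * (real q * (1 + \<bar>Im s\<bar>))) powr \<eta>" using y \<eta> by (intro powr_mono2) auto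
        also have "\<dots> = 28 powr \<eta> * (real q powr \<eta> * (1 + \<bar>Im s\<bar>) powr \<eta>)" using q by (subst powr_mult | simp)+
        also have "\<dots> \<le> 28 powr 1 * (real q powr \<eta> * (1 + \<bar>Im s\<bar>) powr \<eta>)" using \<eta> by (intro mult_right_mono powr_mono) auto
        finally show ?thesis by simp
      qed
      finally show "norm (F s) \<le> K * real q powr \<eta> * (1 + \<bar>Im s\<bar>) powr \<eta>"
        using \<eta> by (simp add: K_def mult_left_mono divide_right_mono mult_ac)
    qed
    also have "\<dots> \<le> 24 / \<eta> * ((K + 1 / \<eta>) * real q powr \<eta>) * real x powr (1 / 2 + 2 * \<eta>)"
    proof (intro mult_right_mono mult_left_mono)
      have "1 / \<eta> * 1 \<le> 1 / \<eta> * real q powr \<eta>" using q \<eta> by (intro mult_left_mono ge_one_powr_ge_zero) auto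
      thus "K * real q powr \<eta> + 1 / \<eta> \<le> (K + 1 / \<eta>) * real q powr \<eta>" by (simp add: algebra_simps)
    qed (use \<eta> in auto)
    finally show ?thesis by (simp add: mult_ac)
  qed
  moreover have "24 / \<eta> * (K + 1 / \<eta>) \<ge> 0" using K \<eta> by simp
  ultimately show ?thesis by blast
qed

text \<open>Near the critical line Borel-Caratheodory yields only \<open>(6 / \<eta>) * M\<close>
  for the logarithm of zeta. On the circle of radius \<open>1 / 2\<close> about \<open>w\<close>,
  well inside the region of absolute convergence, the logarithm is bounded by an absolute constant.
  Combining the two circles reduces the factor of \<open>M\<close> to \<open>\<eta>\<close>, hence
  the exponent of \<open>1 + \<bar>Im s\<bar>\<close> to \<open>\<eta>\<close>. The condition
  \<open>\<bar>Im s\<bar> \<ge> 2\<close> keeps the pole at 1 at distance at least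
  \<open>1 / 2\<close> from the disc.\<close>

lemma inverse_zeta_bound_high:
  assumes GRH and \<eta>: "0 < \<eta>" "\<eta> \<le> 1 / 4"
  shows "\<exists>C\<ge>0. \<forall>s. 1 / 2 + \<eta> \<le> Re s \<longrightarrow> Re s \<le> 2 \<longrightarrow> \<bar>Im s\<bar> \<ge> 2 \<longrightarrow>
     norm ((s - 1) / zeta_reg s) \<le> C * (1 + \<bar>Im s\<bar>) powr \<eta>"
proof -
  define \<rho> r2 where "\<rho> = 3 / 2 - \<eta>" and "r2 = 3 / 2 - \<eta> / 2"
  have \<rho>: "0 < \<rho>" "\<rho> < r2" "r2 < 3 / 2" "1 < \<rho>" using \<eta> by (auto simp: \<rho>_def r2_def)
  have q: "0 \<le> \<rho> / r2" "\<rho> / r2 < 1" using \<rho> by auto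
  have "(\<lambda>K. (\<rho> / r2) ^ K) \<longlonglongrightarrow> 0" by (rule LIMSEQ_power_zero) (use q in simp)
  moreover have "\<eta>\<^sup>2 * (1 - \<rho> / r2) / 6 > 0" using \<eta> q by simp
  ultimately have "eventually (\<lambda>K. (\<rho> / r2) ^ K < \<eta>\<^sup>2 * (1 - \<rho> / r2) / 6) sequentially" by (rule order_tendstoD)
  \<comment> \<open>\<open>K\<close> depends on \<open>\<eta>\<close> alone. It is large enough for
    the tail from order \<open>K\<close> on, computed with the bound \<open>6 / \<eta> * M\<close>
    on the outer circle, to be at most \<open>\<eta> * M\<close>.\<close>
  then obtain K where K: "(\<rho> / r2) ^ K < \<eta>\<^sup>2 * (1 - \<rho> / r2) / 6" by (auto simp: eventually_sequentially)
  define D where "D = 1 - \<rho> / r2"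
  have "D > 0" using q by (simp add: D_def)
  have "(\<rho> / r2) ^ K / D \<le> \<eta>\<^sup>2 * D / 6 / D" using K \<open>D > 0\<close> by (intro divide_right_mono) (auto simp: D_def)
  hence "6 / \<eta> * ((\<rho> / r2) ^ K / D) \<le> 6 / \<eta> * (\<eta>\<^sup>2 / 6)" using \<eta> \<open>D > 0\<close> by (intro mult_left_mono) auto
  hence K: "6 / \<eta> * ((\<rho> / r2) ^ K / (1 - \<rho> / r2)) \<le> \<eta>" using \<eta> by (simp add: D_def power2_eq_square)
  define C0 where "C0 = 12 * (\<Sum>k<K. (\<rho> / (1 / 2)) ^ k)"
  have "norm ((s - 1) / zeta_reg s) \<le> (2 * exp C0 * 36) * (1 + \<bar>Im s\<bar>) powr \<eta>"
    if s: "1 / 2 + \<eta> \<le> Re s" "Re s \<le> 2" "\<bar>Im s\<bar> \<ge> 2" for s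
  proof -
    define t where "t = Im s"
    define w where "w = Complex 2 t"
    define L where "L = (\<lambda>s. zeta_reg s / (s - 1))"
    \<comment> \<open>On the disc \<open>norm (L z)\<close> is at most
      \<open>2 + 3 * (\<bar>t\<bar> + 4)\<close>, and \<open>norm (L w)\<close> is at least
      \<open>1 / 2\<close>.\<close>
    define M where "M = ln (9 * (\<bar>t\<bar> + 4))"
    have M: "M > 0" unfolding M_def by simp
    have expM: "exp M = 9 * (\<bar>t\<bar> + 4)" unfolding M_def by simp
    have ball: "Re z > 1 / 2" "1 / 2 \<le> norm (z - 1)" if "z \<in> ball w (3 / 2)" for z
    proof -
      note b = norm_Complex_2_ball[of z t "3/2"]
      show "Re z > 1 / 2" using b(1) that by (simp add: w_def)
      have "\<bar>Im z - t\<bar> < 3 / 2" using b(3) that by (simp add: w_def)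
      hence "\<bar>Im z\<bar> \<ge> 1 / 2" using s(3) unfolding t_def by arith
      thus "1 / 2 \<le> norm (z - 1)" using abs_Im_le_cmod[of "z - 1"] by simp
    qed
    have L1: "L holomorphic_on ball w (3 / 2)"
      unfolding L_def using ball by (intro holomorphic_intros holomorphic_on_subset[OF zeta_reg(1)]) force+
    have L2: "L z \<noteq> 0" if "z \<in> ball w (3 / 2)" for z
      using zeta_reg_nonzero_GRH[OF \<open>GRH\<close> ball(1)[OF that]] ball(2)[OF that] by (auto simp: L_def)
    have Lz: "L z = zeta z" if "Re z > 1" for z
      using zeta_reg(4)[of z] that by (cases "z = 1") (auto simp: L_def)
    have Rw: "Re w > 1" by (simp add: w_def)
    have inv: "norm A \<le> 1 + 1 / (Re z - 1) \<and> norm (inverse A) \<le> 1 + 1 / (Re z - 1)" if "A = zeta z" "Re z > 1" for A z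
      using dirichlet_inverse(3,4)[where a = "\<lambda>_. 1", OF _ _ _ that(2) zeta_reg(5)[OF that(2)]] that(1) by simp
    have Lw: "norm (L w) \<ge> 1 / 2"
    proof -
      have "norm (inverse (L w)) \<le> 1 + 1 / (Re w - 1)" using inv[OF Lz[OF Rw] Rw] by blast
      moreover have "L w \<noteq> 0" by (rule L2) simp
      ultimately show ?thesis by (simp add: w_def norm_inverse norm_divide field_simps)
    qed
    obtain g where g: "g holomorphic_on ball w (3 / 2)" "\<And>z. z \<in> ball w (3 / 2) \<Longrightarrow> L z = L w * exp (g z)"
      "\<And>R' M r z. 0 < R' \<Longrightarrow> R' \<le> 3 / 2 \<Longrightarrow> M > 0 \<Longrightarrow> (\<And>z. z \<in> ball w R' \<Longrightarrow> norm (L z) < exp M * norm (L w)) \<Longrightarrow>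
         norm (z - w) \<le> r \<Longrightarrow> r < R' \<Longrightarrow> norm (g z) \<le> 2 * M * r / (R' - r)"
      using holomorphic_log_bound[OF L1 L2] by (metis zero_less_divide_iff zero_less_numeral)
    have up: "norm (L z) < exp M * norm (L w)" if z: "z \<in> ball w (3 / 2)" for z
    proof -
      have z1: "norm (z - 1) > 0" using ball(2)[OF z] by linarith
      have "norm (zeta_reg z) \<le> 1 + norm (z - 1) * norm z * (1 + 1 / Re z)"
        by (rule zeta_reg(3)) (use ball(1)[OF z] in simp)
      hence "norm (L z) \<le> (1 + norm (z - 1) * norm z * (1 + 1 / Re z)) / norm (z - 1)"
        unfolding L_def norm_divide by (rule divide_right_mono) simp
      also have "\<dots> = 1 / norm (z - 1) + norm z * (1 + 1 / Re z)" using z1 by (simp add: field_simps)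
      also have "\<dots> \<le> 1 / (1 / 2) + (\<bar>t\<bar> + 4) * 3"
        using ball[OF z] norm_Complex_2_ball(4)[of z t "3/2"] z
        by (intro add_mono mult_mono frac_le) (auto simp: w_def field_simps)
      also have "\<dots> < exp M * (1 / 2)" unfolding expM by simp
      also have "\<dots> \<le> exp M * norm (L w)" by (intro mult_left_mono Lw) simp
      finally show ?thesis .
    qed
    \<comment> \<open>For radius \<open>3 / 4\<close> the real part exceeds \<open>5 / 4\<close>,
      where the modulus is at most 5. Since \<open>norm (L w) \<ge> 1 / 2\<close>, any bound above
      10 suffices, and \<open>exp 3\<close> is one, independent of \<open>t\<close>.\<close>
    have up2: "norm (L z) < exp 3 * norm (L w)" if z: "z \<in> ball w (3 / 4)" for z
    proof -
      have Rz: "Re z > 5 / 4" using norm_Complex_2_ball(1)[of z t "3/4"] z by (simp add: w_def)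
      hence "norm (L z) \<le> 1 + 1 / (Re z - 1)" using inv[OF Lz[of z]] by simp
      also have "\<dots> \<le> 5" using Rz by (simp add: field_simps)
      also have "\<dots> < exp 3 * (1 / 2)"
      proof -
        have "(1 + 3 / 3) ^ 3 \<le> exp (3::real)" using exp_ge_one_plus_x_over_n_power_n[of 3 3] by simp
        moreover have "5 / 2 < exp (1::real)" using e_approx_32 by (simp add: abs_if split: if_splits)
        hence "(5 / 2) ^ 3 < exp (1::real) ^ 3" by (intro power_strict_mono) auto
        ultimately show ?thesis by (simp add: exp_of_nat_mult[of 3 1, simplified] power3_eq_cube flip: exp_of_nat_mult)
      qed
      also have "\<dots> \<le> exp 3 * norm (L w)" by (intro mult_left_mono Lw) simp
      finally show ?thesis .
    qed
    have g12: "norm (g z) \<le> 12" if "norm (z - w) = 1 / 2" for z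
    proof -
      have "norm (g z) \<le> 2 * 3 * (1 / 2) / (3 / 4 - 1 / 2)"
        by (rule g(3)[OF _ _ _ up2]) (use that in auto)
      thus ?thesis by simp
    qed
    have gM: "norm (g z) \<le> 6 / \<eta> * M" if z: "norm (z - w) = r2" for z
    proof -
      have "norm (g z) \<le> 2 * M * r2 / (3 / 2 - r2)"
        by (rule g(3)[OF _ _ M up]) (use \<rho> z in auto)
      also have "\<dots> \<le> 2 * M * (3 / 2) / (\<eta> / 2)" using M \<eta> \<rho> by (intro frac_le mult_left_mono) (auto simp: r2_def)
      finally show ?thesis by simp
    qed
    have sw: "norm (s - w) \<le> \<rho>" unfolding w_def t_def \<rho>_def by (rule dist_Complex_2[OF s(1,2)])
    have "norm (g s) \<le> 12 * (\<Sum>k<K. (\<rho> / (1 / 2)) ^ k) + 6 / \<eta> * M * ((\<rho> / r2) ^ K / (1 - \<rho> / r2))"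
      by (rule two_circle_bound[OF g(1) _ _ _ _ _ g12 gM sw]) (use \<rho> in auto)
    also have "\<dots> = C0 + (6 / \<eta> * ((\<rho> / r2) ^ K / (1 - \<rho> / r2))) * M" by (simp add: C0_def)
    also have "\<dots> \<le> C0 + \<eta> * M" using K M by (intro add_left_mono mult_right_mono) auto
    finally have gs: "norm (g s) \<le> C0 + \<eta> * M" .
    have sb: "s \<in> ball w (3 / 2)" using sw \<rho> by (simp add: dist_norm norm_minus_commute)
    have "norm ((s - 1) / zeta_reg s) = inverse (norm (L s))" by (simp add: L_def norm_divide)
    also have "\<dots> = inverse (norm (L w)) * exp (- Re (g s))"
      unfolding g(2)[OF sb] by (simp add: norm_mult exp_minus)
    also have "\<dots> \<le> 2 * exp (C0 + \<eta> * M)"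
    proof (intro mult_mono)
      show "inverse (norm (L w)) \<le> 2" using le_imp_inverse_le[OF Lw] by simp
      show "exp (- Re (g s)) \<le> exp (C0 + \<eta> * M)" using gs abs_Re_le_cmod[of "g s"] by simp
    qed auto
    also have "\<dots> = 2 * exp C0 * (9 * (\<bar>t\<bar> + 4)) powr \<eta>"
      unfolding exp_add by (simp add: M_def powr_def)
    also have "\<dots> \<le> 2 * exp C0 * (36 * (1 + \<bar>t\<bar>) powr \<eta>)"
    proof (intro mult_left_mono)
      have "(9 * (\<bar>t\<bar> + 4)) powr \<eta> \<le> (36 * (1 + \<bar>t\<bar>)) powr \<eta>" using \<eta> by (intro powr_mono2) auto
      also have "\<dots> = 36 powr \<eta> * (1 + \<bar>t\<bar>) powr \<eta>" by (subst powr_mult) auto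
      also have "\<dots> \<le> 36 powr 1 * (1 + \<bar>t\<bar>) powr \<eta>" using \<eta> by (intro mult_right_mono powr_mono) auto
      finally show "(9 * (\<bar>t\<bar> + 4)) powr \<eta> \<le> 36 * (1 + \<bar>t\<bar>) powr \<eta>" by simp
    qed auto
    finally show ?thesis by (simp add: t_def)
  qed
  thus ?thesis by (intro exI[of _ "2 * exp C0 * 36"]) auto
qed

text \<open>What remains is a compact rectangle around the pole. The quotient is continuous there,
  also at 1, because \<open>zeta_reg\<close> has no zero to the right of
  \<open>1 / 2\<close>.\<close>

lemma inverse_zeta_bound:
  assumes GRH and \<eta>: "0 < \<eta>" "\<eta> \<le> 1 / 4"
  shows "\<exists>C\<ge>0. \<forall>s. 1 / 2 + \<eta> \<le> Re s \<longrightarrow> Re s \<le> 2 \<longrightarrow> norm ((s - 1) / zeta_reg s) \<le> C * (1 + \<bar>Im s\<bar>) powr \<eta>"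
proof -
  obtain C1 where C1: "C1 \<ge> 0" "\<And>s. 1 / 2 + \<eta> \<le> Re s \<Longrightarrow> Re s \<le> 2 \<Longrightarrow> \<bar>Im s\<bar> \<ge> 2 \<Longrightarrow>
     norm ((s - 1) / zeta_reg s) \<le> C1 * (1 + \<bar>Im s\<bar>) powr \<eta>"
    using inverse_zeta_bound_high[OF assms] by blast
  define S where "S = cbox (Complex (1 / 2 + \<eta>) (-2)) (Complex 2 2)"
  have S: "Re s > 1 / 2" if "s \<in> S" for s using that \<eta> by (auto simp: S_def in_cbox_complex_iff)
  have "(\<lambda>s. (s - 1) / zeta_reg s) holomorphic_on {s. Re s > 1 / 2}"
    using zeta_reg_nonzero_GRH[OF \<open>GRH\<close>] by (intro holomorphic_intros holomorphic_on_subset[OF zeta_reg(1)]) auto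
  hence "continuous_on S (\<lambda>s. (s - 1) / zeta_reg s)"
    using S by (intro continuous_on_subset[OF holomorphic_on_imp_continuous_on]) auto
  hence "bounded ((\<lambda>s. (s - 1) / zeta_reg s) ` S)"
    by (intro compact_imp_bounded compact_continuous_image) (auto simp: S_def)
  then obtain C2 where C2: "\<And>s. s \<in> S \<Longrightarrow> norm ((s - 1) / zeta_reg s) \<le> C2" by (auto simp: bounded_iff)
  have "norm ((s - 1) / zeta_reg s) \<le> (C1 + \<bar>C2\<bar>) * (1 + \<bar>Im s\<bar>) powr \<eta>" if s: "1 / 2 + \<eta> \<le> Re s" "Re s \<le> 2" for s
  proof -
    have one: "1 \<le> (1 + \<bar>Im s\<bar>) powr \<eta>" using \<eta> by (intro ge_one_powr_ge_zero) auto
    show ?thesis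
    proof (cases "\<bar>Im s\<bar> \<ge> 2")
      case True
      have "norm ((s - 1) / zeta_reg s) \<le> C1 * (1 + \<bar>Im s\<bar>) powr \<eta>" by (rule C1(2)[OF s True])
      also have "\<dots> \<le> (C1 + \<bar>C2\<bar>) * (1 + \<bar>Im s\<bar>) powr \<eta>" by (intro mult_right_mono) auto
      finally show ?thesis .
    next
      case False
      hence "s \<in> S" using s by (auto simp: S_def in_cbox_complex_iff)
      hence "norm ((s - 1) / zeta_reg s) \<le> (C1 + \<bar>C2\<bar>) * 1" using C2 C1(1) by force
      also have "\<dots> \<le> (C1 + \<bar>C2\<bar>) * (1 + \<bar>Im s\<bar>) powr \<eta>" using one C1(1) by (intro mult_left_mono) auto
      finally show ?thesis .
    qed
  qed
  thus ?thesis using C1(1) by (intro exI[of _ "C1 + \<bar>C2\<bar>"]) auto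
qed

theorem mertens_function_bound:
  assumes GRH and \<eta>: "0 < \<eta>" "\<eta> \<le> 1 / 4"
  shows "\<exists>C\<ge>0. \<forall>x\<ge>1. norm (\<Sum>n=1..x. of_int (moebius_mu n) :: complex) \<le> C * real x powr (1 / 2 + 2 * \<eta>)"
proof -
  obtain K where K: "K \<ge> 0" "\<And>s. 1 / 2 + \<eta> \<le> Re s \<Longrightarrow> Re s \<le> 2 \<Longrightarrow> norm ((s - 1) / zeta_reg s) \<le> K * (1 + \<bar>Im s\<bar>) powr \<eta>"
    using inverse_zeta_bound[OF assms] by blast
  have "norm (\<Sum>n=1..x. of_int (moebius_mu n) :: complex) \<le> 24 / \<eta> * (K + 1) * real x powr (1 / 2 + 2 * \<eta>)" if x: "x \<ge> 1" for x
  proof (rule summatory_function_bound[OF \<eta> K(1) x, where F = "\<lambda>s. (s - 1) / zeta_reg s"])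
    show "norm (of_int (moebius_mu n) :: complex) \<le> 1 * real n powr \<eta>" if "n \<ge> 1" for n
      using norm_moebius_mu_le[of n] ge_one_powr_ge_zero[of "real n" \<eta>] \<eta> that by simp
    show "(\<lambda>s. (s - 1) / zeta_reg s) holomorphic_on {s. Re s > 1 / 2}"
      using zeta_reg_nonzero_GRH[OF \<open>GRH\<close>] by (intro holomorphic_intros holomorphic_on_subset[OF zeta_reg(1)]) auto
    show "(\<lambda>n. of_int (moebius_mu (Suc n)) / of_nat (Suc n) powr s) sums ((s - 1) / zeta_reg s)" if "Re s = 2" for s
    proof -
      have s: "Re s > 1" using that by simp
      have s1: "s \<noteq> 1" using s by auto
      have "(\<lambda>n. of_int (moebius_mu (Suc n)) * 1 / of_nat (Suc n) powr s) sums inverse (zeta s)"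
        by (rule dirichlet_inverse(1)[where a = "\<lambda>_. 1"]) (use s zeta_reg(5)[OF s] in auto)
      thus ?thesis using zeta_reg(4)[of s] s s1 by simp
    qed
  qed (use K in auto)
  moreover have "24 / \<eta> * (K + 1) \<ge> 0" using K \<eta> by simp
  ultimately show ?thesis by blast
qed

section \<open>Bilinear sums with a smoothed weight\<close>

text \<open>A principal inducing character would take the value 1 at all residues coprime to
  \<open>q\<close>, making \<open>\<xi>\<close> principal. The bound for character sums thus applies
  to the inducing character, with a modulus dividing \<open>q\<close>.\<close>

lemma inducing_primitive_character_nonprincipal:
  assumes \<xi>: "\<xi> \<in> nonprincipal_characters q"
  obtains d where "d dvd q" "inducing_primitive_character q \<xi> \<in> nonprincipal_characters d"
proof -
  have dc: "dirichlet_character q \<xi>" and np: "\<xi> \<noteq> principal_character q"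
    using \<xi> by (auto simp: nonprincipal_characters_def)
  define \<psi> where "\<psi> = inducing_primitive_character q \<xi>"
  have "\<exists>d. primitive_character d \<psi> \<and> induces_character d \<psi> q \<xi>"
    unfolding \<psi>_def inducing_primitive_character_def
    by (rule theI'[OF ex1_inducing_primitive_character[OF dc]])
  then obtain d where d: "induces_character d \<psi> q \<xi>" by blast
  have "\<psi> \<noteq> principal_character d"
  proof
    assume *: "\<psi> = principal_character d"
    have "\<xi> a = principal_character q a" for a
    proof (cases "coprime a q")
      case True
      moreover from this have "coprime a d" using d coprime_divisors[of a a d q] by (auto simp: induces_character_def)
      ultimately show ?thesis using d * by (simp add: induces_character_def principal_character_def)
    next
      case False
      thus ?thesis using dc by (auto simp: dirichlet_character_def principal_character_def)
    qed
    thus False using np by blast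
  qed
  hence "\<psi> \<in> nonprincipal_characters d" "d dvd q"
    using d by (auto simp: nonprincipal_characters_def induces_character_def)
  thus ?thesis using that unfolding \<psi>_def by blast
qed



text \<open>As \<open>f\<close> vanishes from \<open>\<beta>\<close> on, every pair with
  \<open>n + m \<ge> k\<close> contributes 0. The triangle of summation may be enlarged to a square,
  where the two variables are independent.\<close>

lemma double_sum_extend:
  fixes f :: "real \<Rightarrow> complex" and a b :: "nat \<Rightarrow> complex"
  assumes f: "{x. f x \<noteq> 0} \<subseteq> {0..<\<beta>}" and N: "N > 0" and k: "real N * \<beta> = real k" and L: "k \<le> L"
  shows "(\<Sum>n | 0 < n \<and> real n \<le> real N * \<beta>. \<Sum>m | 0 < m \<and> real m \<le> real N * \<beta> - real n. a n * b m * f (real (n + m) / real N))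
     = (\<Sum>n=1..L. \<Sum>m=1..L. a n * b m * f (real_of_int (int n + int m) / real N))"
proof -
  have f0: "f (real j / real N) = 0" if "j \<ge> k" for j
  proof -
    have "real j / real N \<ge> \<beta>" using that N k by (simp add: pos_le_divide_eq mult.commute)
    thus ?thesis using f by force
  qed
  have "(\<Sum>m | 0 < m \<and> real m \<le> real N * \<beta> - real n. a n * b m * f (real (n + m) / real N)) =
     (\<Sum>m=1..L. a n * b m * f (real (n + m) / real N))" for n
  proof (rule sum.mono_neutral_left)
    show "{m. 0 < m \<and> real m \<le> real N * \<beta> - real n} \<subseteq> {1..L}" using L unfolding k by auto
    show "\<forall>m\<in>{1..L} - {m. 0 < m \<and> real m \<le> real N * \<beta> - real n}. a n * b m * f (real (n + m) / real N) = 0"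
    proof
      fix m assume "m \<in> {1..L} - {m. 0 < m \<and> real m \<le> real N * \<beta> - real n}"
      hence "k \<le> n + m" unfolding k by auto
      thus "a n * b m * f (real (n + m) / real N) = 0" by (simp only: f0 mult_zero_right)
    qed
  qed simp
  hence "(\<Sum>n | 0 < n \<and> real n \<le> real N * \<beta>. \<Sum>m | 0 < m \<and> real m \<le> real N * \<beta> - real n. a n * b m * f (real (n + m) / real N))
     = (\<Sum>n | 0 < n \<and> real n \<le> real N * \<beta>. \<Sum>m=1..L. a n * b m * f (real (n + m) / real N))" by simp
  also have "\<dots> = (\<Sum>n=1..L. \<Sum>m=1..L. a n * b m * f (real (n + m) / real N))"
  proof (rule sum.mono_neutral_left)
    show "{n. 0 < n \<and> real n \<le> real N * \<beta>} \<subseteq> {1..L}" using L unfolding k by auto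
    show "\<forall>n\<in>{1..L} - {n. 0 < n \<and> real n \<le> real N * \<beta>}. (\<Sum>m=1..L. a n * b m * f (real (n + m) / real N)) = 0"
    proof
      fix n assume n: "n \<in> {1..L} - {n. 0 < n \<and> real n \<le> real N * \<beta>}"
      have "f (real (n + m) / real N) = 0" for m by (rule f0) (use n in \<open>auto simp: k\<close>)
      thus "(\<Sum>m=1..L. a n * b m * f (real (n + m) / real N)) = 0" by (simp only: mult_zero_right sum.neutral_const)
    qed
  qed simp
  finally show ?thesis by simp
qed

text \<open>
  Smoothing at the scale \<open>H / N\<close> with \<open>H\<close> about \<open>sqrt N\<close> balances the trivial bound for the error against the
  square-root bounds for the two summatory functions.
\<close>

lemma bilinear_sum_bound:
  fixes f :: "real \<Rightarrow> complex" and a b :: "nat \<Rightarrow> complex"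
  assumes f: "{x. f x \<noteq> 0} \<subseteq> {0..<\<beta>}" "\<And>x h. norm (f (x + h) - 2 * f x + f (x - h)) \<le> K * \<bar>h\<bar> powr \<delta>"
    and K: "K \<ge> 0" and \<delta>: "1 \<le> \<delta>" "\<delta> < 2" and \<eta>: "0 < \<eta>" and \<beta>: "\<beta> > 0"
    and N: "N > 0" and k: "real N * \<beta> = real k"
    and A: "\<And>x. x \<ge> 1 \<Longrightarrow> norm (\<Sum>n=1..x. a n) \<le> CA * real x powr (1 / 2 + 2 * \<eta>)"
    and B: "\<And>x. x \<ge> 1 \<Longrightarrow> norm (\<Sum>n=1..x. b n) \<le> CB * real x powr (1 / 2 + 2 * \<eta>)"
    and a: "\<And>n. n \<ge> 1 \<Longrightarrow> norm (a n) \<le> Ca * real n powr \<eta>" and b: "\<And>n. n \<ge> 1 \<Longrightarrow> norm (b n) \<le> 1"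
    and C0: "CA \<ge> 0" "CB \<ge> 0" "Ca \<ge> 0"
  shows "norm (\<Sum>n | 0 < n \<and> real n \<le> real N * \<beta>. \<Sum>m | 0 < m \<and> real m \<le> real N * \<beta> - real n. a n * b m * f (real (n + m) / real N))
     \<le> (\<beta> + 2) powr (3 + 4 * \<eta>) * 4 * K * (Ca + CA * CB) * real N powr (2 - \<delta> / 2 + 4 * \<eta>)"
proof -
  \<comment> \<open>Rounding up gives \<open>H ^ 2 \<ge> N\<close> for the main part;
    \<open>H \<le> 2 * sqrt (real N)\<close> keeps the replacement error small.\<close>
  define H where "H = nat \<lceil>sqrt (real N)\<rceil>"
  have N1: "real N \<ge> 1" using N by simp
  have sq: "sqrt (real N) \<ge> 1" "sqrt (real N) * sqrt (real N) = real N" "sqrt (real N) \<le> real N"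
    using N1 by (auto simp: real_le_lsqrt power2_eq_square)
  have H: "sqrt (real N) \<le> real H" "real H \<le> 2 * sqrt (real N)" unfolding H_def using sq(1) by linarith+
  have H0: "H > 0" using H(1) sq(1) by (cases H) auto
  define L where "L = k + H"
  \<comment> \<open>A common upper bound for all indices, since \<open>k = real N * \<beta>\<close>
    and \<open>H\<close> is at most \<open>2 * real N\<close>.\<close>
  define M where "M = (\<beta> + 2) * real N"
  have LM: "real L \<le> M" using H sq k by (simp add: L_def M_def algebra_simps)
  have M1: "M \<ge> 1" using mult_mono[of 1 "\<beta> + 2" 1 "real N"] N1 \<beta> by (simp add: M_def)
  define g where "g = (\<lambda>j::int. f (real_of_int j / real N))"
  define E where "E = K * (real H / real N) powr \<delta>"
  have gE: "norm (g (i + j) - 2 * g i + g (i - j)) \<le> E" if "\<bar>j\<bar> \<le> int H" for i j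
  proof -
    have "\<bar>real_of_int j\<bar> \<le> real H" using that by linarith
    hence "\<bar>real_of_int j / real N\<bar> powr \<delta> \<le> (real H / real N) powr \<delta>"
      using \<delta> by (intro powr_mono2) (auto simp: divide_right_mono)
    hence "K * \<bar>real_of_int j / real N\<bar> powr \<delta> \<le> E" unfolding E_def by (rule mult_left_mono[OF _ K])
    moreover have "norm (g (i + j) - 2 * g i + g (i - j)) \<le> K * \<bar>real_of_int j / real N\<bar> powr \<delta>"
      using f(2)[of "real_of_int i / real N" "real_of_int j / real N"]
      by (simp add: g_def add_divide_distrib diff_divide_distrib)
    ultimately show ?thesis by linarith
  qed
  have g0: "g j = 0" if "j \<ge> int k" for j
  proof -
    have "real_of_int j \<ge> real k" using that by linarith
    hence "real_of_int j / real N \<ge> \<beta>" using N k by (simp add: pos_le_divide_eq mult.commute)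
    thus ?thesis using f(1) unfolding g_def by force
  qed
  define P where "P = M powr (1 / 2 + 2 * \<eta>)"
  have S: "norm (\<Sum>n=1..x. c n) \<le> C * P" if "\<And>x. x \<ge> 1 \<Longrightarrow> norm (\<Sum>n=1..x. c n) \<le> C * real x powr (1 / 2 + 2 * \<eta>)" "C \<ge> 0" "x \<le> k + H"
    for c :: "nat \<Rightarrow> complex" and C x
  proof (cases "x = 0")
    case False
    have "real x \<le> M" using that(3) LM by (simp add: L_def)
    hence "real x powr (1 / 2 + 2 * \<eta>) \<le> P" unfolding P_def using \<eta> by (intro powr_mono2) auto
    hence "C * real x powr (1 / 2 + 2 * \<eta>) \<le> C * P" using that(2) by (rule mult_left_mono)
    thus ?thesis using that(1)[of x] False by simp
  qed (use that(2) in \<open>simp add: P_def\<close>)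
  have "norm (\<Sum>n=1..k+H. \<Sum>m=1..k+H. a n * b m * g (int n + int m)) \<le>
     real (k + H) ^ 2 * (E * (Ca * M powr \<eta>) * 1 + E * (CA * P) * (CB * P) / real H ^ 2)"
  proof (rule bilinear_form_bound[OF H0 gE g0 S[OF A C0(1)] S[OF B C0(2)]])
    fix n assume n: "n \<in> {1..k+H}"
    have "norm (a n) \<le> Ca * real n powr \<eta>" by (rule a) (use n in auto)
    also have "\<dots> \<le> Ca * M powr \<eta>" using n LM C0 \<eta> by (intro mult_left_mono powr_mono2) (auto simp: L_def)
    finally show "norm (a n) \<le> Ca * M powr \<eta>" .
    show "norm (b n) \<le> 1" by (rule b) (use n in auto)
  qed
  also have "(\<Sum>n=1..k+H. \<Sum>m=1..k+H. a n * b m * g (int n + int m)) =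
     (\<Sum>n | 0 < n \<and> real n \<le> real N * \<beta>. \<Sum>m | 0 < m \<and> real m \<le> real N * \<beta> - real n. a n * b m * f (real (n + m) / real N))"
    unfolding g_def by (rule double_sum_extend[symmetric, OF f(1) N k]) simp
  finally have 1: "norm (\<Sum>n | 0 < n \<and> real n \<le> real N * \<beta>. \<Sum>m | 0 < m \<and> real m \<le> real N * \<beta> - real n. a n * b m * f (real (n + m) / real N))
     \<le> real (k + H) ^ 2 * (E * (Ca * M powr \<eta>) * 1 + E * (CA * P) * (CB * P) / real H ^ 2)" .
  have E0: "E \<ge> 0" using K by (simp add: E_def)
  \<comment> \<open>The window has relative length at most
    \<open>2 * real N powr (- (1 / 2))\<close>, and 4 bounds \<open>2 powr \<delta>\<close>. This is
    the entire saving \<open>real N powr (- (\<delta> / 2))\<close>.\<close>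
  have Eb: "E \<le> 4 * K * real N powr (- (\<delta> / 2))"
  proof -
    have "real H / real N \<le> 2 * sqrt (real N) / real N" using H by (intro divide_right_mono) auto
    also have "\<dots> = 2 * real N powr (- (1 / 2))"
      using sq N1 by (simp add: powr_minus powr_half_sqrt field_simps)
    finally have "(real H / real N) powr \<delta> \<le> (2 * real N powr (- (1 / 2))) powr \<delta>"
      using \<delta> by (intro powr_mono2) auto
    also have "\<dots> = 2 powr \<delta> * real N powr (- (\<delta> / 2))" by (simp add: powr_mult powr_powr)
    also have "\<dots> \<le> 2 powr 2 * real N powr (- (\<delta> / 2))" using \<delta> by (intro mult_right_mono powr_mono) auto
    finally have "(real H / real N) powr \<delta> \<le> 4 * real N powr (- (\<delta> / 2))" by simp
    from mult_left_mono[OF this K] show ?thesis by (simp add: E_def mult_ac)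
  qed
  have "P * P = M * M powr (4 * \<eta>)" using M1 by (simp add: P_def powr_add flip: powr_add) (simp add: powr_add)
  have H2: "real N \<le> real H ^ 2" using mult_mono[OF H(1) H(1)] sq by (simp add: power2_eq_square)
  \<comment> \<open>The two square-root bounds multiply to \<open>M * M powr (4 * \<eta>)\<close>,
    and division by \<open>H ^ 2 \<ge> N\<close> reduces the factor \<open>M\<close> to a constant.
    The main part is then no larger than the replacement error up to
    \<open>M powr (4 * \<eta>)\<close>.\<close>
  have PP: "P * P / real H ^ 2 \<le> (\<beta> + 2) * M powr (4 * \<eta>)"
  proof -
    have "P * P / real H ^ 2 \<le> M * M powr (4 * \<eta>) / real N"
      unfolding \<open>P * P = M * M powr (4 * \<eta>)\<close> using H2 N1 M1 by (intro frac_le) auto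
    also have "\<dots> = (\<beta> + 2) * M powr (4 * \<eta>)" using N1 by (simp add: M_def)
    finally show ?thesis .
  qed
  have Me: "M powr \<eta> \<le> (\<beta> + 2) * M powr (4 * \<eta>)"
  proof -
    have "M powr \<eta> \<le> 1 * M powr (4 * \<eta>)" using M1 \<eta> powr_mono[of \<eta> "4 * \<eta>" M] by simp
    also have "\<dots> \<le> (\<beta> + 2) * M powr (4 * \<eta>)" using \<beta> by (intro mult_right_mono) auto
    finally show ?thesis .
  qed
  have "E * (Ca * M powr \<eta>) * 1 + E * (CA * P) * (CB * P) / real H ^ 2 = E * (Ca * M powr \<eta> + CA * CB * (P * P / real H ^ 2))"
    by (simp add: algebra_simps)
  also have "\<dots> \<le> E * (Ca * ((\<beta> + 2) * M powr (4 * \<eta>)) + CA * CB * ((\<beta> + 2) * M powr (4 * \<eta>)))"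
    using E0 C0 by (intro mult_left_mono add_mono Me PP) auto
  also have "\<dots> = E * ((Ca + CA * CB) * ((\<beta> + 2) * M powr (4 * \<eta>)))" by (simp add: algebra_simps)
  also have "\<dots> \<le> 4 * K * real N powr (- (\<delta> / 2)) * ((Ca + CA * CB) * ((\<beta> + 2) * M powr (4 * \<eta>)))"
    using C0 \<beta> by (intro mult_right_mono Eb) auto
  finally have 2: "E * (Ca * M powr \<eta>) * 1 + E * (CA * P) * (CB * P) / real H ^ 2 \<le>
      4 * K * real N powr (- (\<delta> / 2)) * ((Ca + CA * CB) * ((\<beta> + 2) * M powr (4 * \<eta>)))" .
  have "real (k + H) ^ 2 \<le> M ^ 2" using LM by (intro power_mono) (auto simp: L_def)
  hence "real (k + H) ^ 2 * (E * (Ca * M powr \<eta>) * 1 + E * (CA * P) * (CB * P) / real H ^ 2) \<le>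
      M ^ 2 * (4 * K * real N powr (- (\<delta> / 2)) * ((Ca + CA * CB) * ((\<beta> + 2) * M powr (4 * \<eta>))))"
    using E0 C0 by (intro mult_mono 2) (auto simp: P_def)
  also have "M powr (4 * \<eta>) = (\<beta> + 2) powr (4 * \<eta>) * real N powr (4 * \<eta>)"
    unfolding M_def using \<beta> by (simp add: powr_mult)
  also have "M ^ 2 * (4 * K * real N powr (- (\<delta> / 2)) * ((Ca + CA * CB) * ((\<beta> + 2) * ((\<beta> + 2) powr (4 * \<eta>) * real N powr (4 * \<eta>))))) =
     ((\<beta> + 2) ^ 3 * (\<beta> + 2) powr (4 * \<eta>)) * 4 * K * (Ca + CA * CB) * (real N ^ 2 * real N powr (- (\<delta> / 2)) * real N powr (4 * \<eta>))"
    by (simp add: M_def power2_eq_square power3_eq_cube)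
  also have "(\<beta> + 2) ^ 3 * (\<beta> + 2) powr (4 * \<eta>) = (\<beta> + 2) powr (3 + 4 * \<eta>)"
    using \<beta> by (simp add: powr_add flip: powr_numeral)
  also have "real N ^ 2 * real N powr (- (\<delta> / 2)) * real N powr (4 * \<eta>) = real N powr (2 - \<delta> / 2 + 4 * \<eta>)"
    using N1 by (simp flip: powr_numeral powr_add)
  finally show ?thesis using 1 by linarith
qed

theorem theorem24:
  fixes \<delta> \<epsilon> \<theta> \<beta> :: real and f :: "real \<Rightarrow> complex"
  assumes GRH
    and weak_Gonek_Hejhal
    and "1 \<le> \<delta>" and "\<delta> < 2"
    and "(3 / 2 \<le> \<delta> \<and> 0 < \<epsilon> \<and> \<epsilon> < (\<delta> - 1) / 2 \<and> \<theta> = \<delta> - 1 - 2 * \<epsilon>) \<or>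
         (\<delta> < 3 / 2 \<and> 0 < \<epsilon> \<and> \<epsilon> < 1 / 4 \<and> \<theta> = 1 / 2 - 2 * \<epsilon>)"
    and "\<beta> > 0"
    and "{x. f x \<noteq> 0} \<subseteq> {0..<\<beta>}"
    and "f \<in> hoelder_zygmund \<delta>"
  shows "\<exists>C::real. \<forall>N::nat. N \<ge> 4 \<and> (\<exists>k::nat. k > 0 \<and> real N * \<beta> = real k) \<longrightarrow>
    (\<Sum>q | 1 < q \<and> real q \<le> real N powr \<theta>.
       1 / real (totient q) *
       norm (\<Sum>\<xi>\<in>nonprincipal_characters q.
         cnj (inducing_primitive_character q \<xi> N) *
         (\<Sum>n | 0 < n \<and> real n \<le> real N * \<beta>.
            \<Sum>m | 0 < m \<and> real m \<le> real N * \<beta> - real n.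
              mangoldt n * inducing_primitive_character q \<xi> n *
              of_int (moebius_mu m) * f (real (n + m) / real N))))
    \<le> C * real N powr (2 - \<epsilon>)"
proof -
  note \<delta> = assms(3,4)
  \<comment> \<open>Four parts are lost in the bilinear bound and one through the power of the
    modulus, in total exactly \<open>\<epsilon>\<close>.\<close>
  define \<eta> where "\<eta> = \<epsilon> / 5"
  have \<epsilon>: "0 < \<epsilon>" "\<epsilon> < 1 / 2" using assms(3-5) by auto
  hence \<eta>: "0 < \<eta>" "\<eta> \<le> 1 / 4" by (auto simp: \<eta>_def)
  \<comment> \<open>In the range \<open>\<delta> \<ge> 3 / 2\<close> the second inequality amounts
    to \<open>\<delta> \<le> 2\<close>, in the other range to \<open>1 \<le> \<delta>\<close>. The
    first one ensures \<open>q \<le> N\<close>.\<close>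
  have \<theta>: "\<theta> \<le> 1" "\<theta> + (2 - \<delta> / 2 + 5 * \<eta>) \<le> 2 - \<epsilon>" using assms(3-5) by (auto simp: \<eta>_def field_simps)
  obtain K where K: "K \<ge> 0" "\<And>x h. norm (f (x + h) - 2 * f x + f (x - h)) \<le> K * \<bar>h\<bar> powr \<delta>"
    using hoelder_zygmund_second_difference[OF assms(8) \<delta>] by blast
  obtain CA where CA: "CA \<ge> 0" "\<And>q \<xi> x. \<xi> \<in> nonprincipal_characters q \<Longrightarrow> x \<ge> 1 \<Longrightarrow>
      norm (\<Sum>n=1..x. mangoldt n * \<xi> n) \<le> CA * real q powr \<eta> * real x powr (1 / 2 + 2 * \<eta>)"
    using psi_character_bound[OF \<open>GRH\<close> \<eta>] by blast
  obtain CB where CB: "CB \<ge> 0" "\<And>x. x \<ge> 1 \<Longrightarrow>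
      norm (\<Sum>n=1..x. of_int (moebius_mu n) :: complex) \<le> CB * real x powr (1 / 2 + 2 * \<eta>)"
    using mertens_function_bound[OF \<open>GRH\<close> \<eta>] by blast
  define D0 where "D0 = (\<beta> + 2) powr (3 + 4 * \<eta>) * 4 * K"
  define D where "D = D0 * (1 / \<eta> + CA * CB)"
  have D0: "D0 \<ge> 0" using K by (simp add: D0_def)
  have D: "D \<ge> 0" unfolding D_def using D0 CA CB \<eta> by simp
  show ?thesis
  proof (rule exI[of _ D], intro allI impI, elim conjE exE)
    fix N k :: nat
    assume N: "N \<ge> 4" and k: "real N * \<beta> = real k"
    have N1: "real N \<ge> 1" using N by simp
    define S where "S = (\<lambda>\<psi>. \<Sum>n | 0 < n \<and> real n \<le> real N * \<beta>. \<Sum>m | 0 < m \<and> real m \<le> real N * \<beta> - real n.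
        mangoldt n * \<psi> n * of_int (moebius_mu m) * f (real (n + m) / real N))"
    define B where "B = D * real N powr (2 - \<delta> / 2 + 5 * \<eta>)"
    have B: "B \<ge> 0" using D by (simp add: B_def)
    have character_bound: "norm (cnj (inducing_primitive_character q \<xi> N) * S (inducing_primitive_character q \<xi>)) \<le> B"
      if q: "1 < q" "real q \<le> real N powr \<theta>" and \<xi>: "\<xi> \<in> nonprincipal_characters q" for q \<xi>
    proof -
      define \<psi> where "\<psi> = inducing_primitive_character q \<xi>"
      obtain d where d: "d dvd q" "\<psi> \<in> nonprincipal_characters d"
        using inducing_primitive_character_nonprincipal[OF \<xi>] unfolding \<psi>_def by blast
      note c = nonprincipal_character_facts[OF d(2)]
      \<comment> \<open>The character sums are estimated at the modulus \<open>d\<close> of the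
        inducing character, which is at most \<open>q\<close> and hence at most
        \<open>N\<close>.\<close>
      have "real d \<le> real q" using dvd_imp_le[OF d(1)] q(1) by simp
      also have "\<dots> \<le> real N powr 1" using q(2) powr_mono[OF \<theta>(1) N1] by linarith
      finally have dN: "real d powr \<eta> \<le> real N powr \<eta>" using \<eta> by (intro powr_mono2) auto
      have N\<eta>: "1 \<le> real N powr \<eta>" using N1 \<eta> by (intro ge_one_powr_ge_zero) auto
      have "norm (S \<psi>) \<le> D0 * (1 / \<eta> + CA * real d powr \<eta> * CB) * real N powr (2 - \<delta> / 2 + 4 * \<eta>)"
        unfolding S_def D0_def
      proof (rule bilinear_sum_bound[OF assms(7) K(2) K(1) \<delta> \<eta>(1) \<open>\<beta> > 0\<close> _ k CA(2)[OF d(2)] CB(2)])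
        show "norm (mangoldt n * \<psi> n) \<le> 1 / \<eta> * real n powr \<eta>" if "n \<ge> 1" for n
          by (rule norm_mangoldt_times_le[OF that \<eta>(1) c(4)])
      qed (use N CA(1) CB(1) \<eta> norm_moebius_mu_le in auto)
      also have "1 / \<eta> + CA * real d powr \<eta> * CB \<le> (1 / \<eta> + CA * CB) * real N powr \<eta>"
      proof -
        have "1 / \<eta> * 1 \<le> 1 / \<eta> * real N powr \<eta>" using N\<eta> \<eta> by (intro mult_left_mono) auto
        moreover have "(CA * CB) * real d powr \<eta> \<le> (CA * CB) * real N powr \<eta>" using dN CA CB by (intro mult_left_mono) auto
        ultimately show ?thesis by (simp add: algebra_simps)
      qed
      also have "D0 * ((1 / \<eta> + CA * CB) * real N powr \<eta>) * real N powr (2 - \<delta> / 2 + 4 * \<eta>) =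
          D * (real N powr \<eta> * real N powr (2 - \<delta> / 2 + 4 * \<eta>))" by (simp add: D_def)
      also have "real N powr \<eta> * real N powr (2 - \<delta> / 2 + 4 * \<eta>) = real N powr (2 - \<delta> / 2 + 5 * \<eta>)"
        by (simp add: algebra_simps flip: powr_add)
      finally have "norm (S \<psi>) \<le> B" using D0 by (simp add: B_def mult_left_mono mult_right_mono)
      hence "norm (cnj (\<psi> N)) * norm (S \<psi>) \<le> 1 * B" using c(4)[of N] by (intro mult_mono) auto
      thus ?thesis by (simp add: norm_mult \<psi>_def)
    qed
    \<comment> \<open>There are at most \<open>totient q\<close> characters, so the weight reduces
      the sum over characters to the bound for a single one. The sum over \<open>q\<close> then
      costs a factor \<open>real N powr \<theta>\<close>.\<close>
    have modulus_bound: "1 / real (totient q) * norm (\<Sum>\<xi>\<in>nonprincipal_characters q.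
         cnj (inducing_primitive_character q \<xi> N) * S (inducing_primitive_character q \<xi>)) \<le> B"
      if q: "1 < q" "real q \<le> real N powr \<theta>" for q
    proof -
      have "norm (\<Sum>\<xi>\<in>nonprincipal_characters q. cnj (inducing_primitive_character q \<xi> N) * S (inducing_primitive_character q \<xi>))
          \<le> (\<Sum>\<xi>\<in>nonprincipal_characters q. B)"
        by (intro sum_norm_le character_bound q)
      also have "\<dots> = real (card (nonprincipal_characters q)) * B" by simp
      also have "\<dots> \<le> real (totient q) * B"
        by (intro mult_right_mono of_nat_mono card_dirichlet_characters_le B) (use q in \<open>auto simp: nonprincipal_characters_def\<close>)
      finally show ?thesis using q(1) by (simp add: divide_le_eq mult.commute)
    qed
    define Q where "Q = {q. 1 < q \<and> real q \<le> real N powr \<theta>}"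
    have QN: "Q \<subseteq> {1..nat \<lfloor>real N powr \<theta>\<rfloor>}" by (auto simp: Q_def le_nat_floor)
    hence "card Q \<le> nat \<lfloor>real N powr \<theta>\<rfloor>" using card_mono[OF _ QN] by simp
    hence "real (card Q) \<le> real (nat \<lfloor>real N powr \<theta>\<rfloor>)" by (simp only: of_nat_le_iff)
    hence cQ: "real (card Q) \<le> real N powr \<theta>" using of_nat_floor[of "real N powr \<theta>"] powr_ge_zero[of "real N" \<theta>] by linarith
    have "(\<Sum>q\<in>Q. 1 / real (totient q) * norm (\<Sum>\<xi>\<in>nonprincipal_characters q.
         cnj (inducing_primitive_character q \<xi> N) * S (inducing_primitive_character q \<xi>))) \<le> (\<Sum>q\<in>Q. B)"
      by (intro sum_mono modulus_bound) (auto simp: Q_def)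
    also have "\<dots> = real (card Q) * B" by simp
    also have "\<dots> \<le> real N powr \<theta> * B" by (rule mult_right_mono[OF cQ B])
    also have "\<dots> = D * (real N powr \<theta> * real N powr (2 - \<delta> / 2 + 5 * \<eta>))" by (simp add: B_def)
    also have "\<dots> = D * real N powr (\<theta> + (2 - \<delta> / 2 + 5 * \<eta>))" by (simp only: powr_add)
    also have "\<dots> \<le> D * real N powr (2 - \<epsilon>)" by (intro mult_left_mono powr_mono \<theta> N1 D)
    finally show "(\<Sum>q | 1 < q \<and> real q \<le> real N powr \<theta>.
       1 / real (totient q) *
       norm (\<Sum>\<xi>\<in>nonprincipal_characters q.
         cnj (inducing_primitive_character q \<xi> N) *
         (\<Sum>n | 0 < n \<and> real n \<le> real N * \<beta>.
            \<Sum>m | 0 < m \<and> real m \<le> real N * \<beta> - real n.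
              mangoldt n * inducing_primitive_character q \<xi> n *
              of_int (moebius_mu m) * f (real (n + m) / real N))))
      \<le> D * real N powr (2 - \<epsilon>)"
      unfolding S_def Q_def .
  qed
qed

end
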